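(* Let $d,D,T,V,\mathcal H,g$ be as in the context (in particular $V$ satisfies the integrability hypothesis there). For each $\mathsf m\in\mathbb{N}^d$ let $\varphi_{\mathsf m,0}>0$, $\psi_{\mathsf m,T}>0$ be sufficiently smooth functions on $\overline D$ with $\int_{D\times D}\mathsf{dx\,dy}\,\varphi_{\mathsf m,0}(\mathsf x)g(\mathsf x,T,\mathsf y)\psi_{\mathsf m,T}(\mathsf y)=1$, and assume $$\sup_{\mathsf m\in\mathbb{N}^d}\sup_{\mathsf x\in\overline D}\varphi_{\mathsf m,0}(\mathsf x)<+\infty,\qquad \sup_{\mathsf m\in\mathbb{N}^d}\sup_{\mathsf x\in\overline D}\psi_{\mathsf m,T}(\mathsf x)<+\infty.$$ Let $\mu_{\mathsf m}(G)=\int_G\mathsf{dx\,dy}\,\varphi_{\mathsf m,0}(\mathsf x)g(\mathsf x,T,\mathsf y)\psi_{\mathsf m,T}(\mathsf y)$ and let $Z^{\mathsf m}_{\tau\in[0,T]}$ be the Bernstein process generated by $\mu_{\mathsf m}$ (with law $\mathbb P_{\mu_{\mathsf m}}$). Let $(p_{\mathsf m})_{\mathsf m\in\mathbb{N}^d}$ satisfy $p_{\mathsf m}\ge0$, $\sum_{\mathsf m}p_{\mathsf m}=1$, let $\overline\mu(G)=\sum_{\mathsf m}p_{\mathsf m}\mu_{\mathsf m}(G)$, and let $\overline Z_{\tau\in[0,T]}$ be the Bernstein process generated by $\overline\mu$ (with law $\mathbb P_{\overline\mu}$). Then: (a) $\mathbb P_{\overline\mu}(\overline Z_{t_1}\in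 F_1,\dots,\overline Z_{t_n}\in F_n)=\sum_{\mathsf m}p_{\mathsf m}\mathbb P_{\mu_{\mathsf m}}(Z^{\mathsf m}_{t_1}\in F_1,\dots,Z^{\mathsf m}_{t_n}\in F_n)$ for every $n\in\mathbb{N}^+$ and all $F_1,\dots,F_n\in\mathcal B(\overline D)$. In addition, if the measure with density $(\mathsf x,\mathsf y)\mapsto\sum_{\mathsf m}p_{\mathsf m}\varphi_{\mathsf m,0}(\mathsf x)\psi_{\mathsf m,T}(\mathsf y)$ is not of the form $\nu_0\otimes\nu_T$ with $\nu_0,\nu_T$ positive measures on $\mathcal B(\overline D)$, then $\overline Z$ is non-Markovian. (b) $\mathbb P_{\overline\mu}(\overline Z_t\in F)=\sum_{\mathsf m}p_{\mathsf m}\mathbb P_{\mu_{\mathsf m}}(Z^{\mathsf m}_t\in F)$ for each $t\in[0,T]$ and $F\in\mathcal B(\overline D)$, where $\mathbb P_{\mu_{\mathsf m}}(Z^{\mathsf m}_t\in F)=\int_F\mathsf{dx}\,u_{\mathsf m}(\mathsf x,t)v_{\mathsf m}(\mathsf x,t)$. (c) $\mathbb E_{\overline\mu}(b(\overline Z_t))=\sum_{\mathsf m}p_{\mathsf m}\mathbb E_{\mu_{\mathsf m}}(b(Z^{\mathsf m}_t))$ for each bounded Borel $b:\overline D\to\mathbb C$ and every $t\in[0,T]$, where $\mathbb E_{\mu_{\mathsf m}}(b(Z^{\mathsf m}_t))=\int_D\mathsf{dx}\,b(\mathsf x)u_{\mathsf m}(\mathsf x,t)v_{\mathsf m}(\mathsf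 x,t)$.
   Context: $d\in\mathbb{N}^+$, $D\subset\mathbb{R}^d$ open bounded with sufficiently smooth boundary, $T>0$, $V:D\to\mathbb{R}$ bounded from below with $V\in L^p(D)$, $p\in[1,\infty]$ if $d=1$, $p\in(1,\infty]$ if $d=2$, $p\in[d/2,\infty]$ if $d\ge3$. $\mathcal H=-\frac12\Delta_{\mathsf x}+V$ with Neumann Laplacian is self-adjoint with compact resolvent in $L^2(D)$. $g(\mathsf x,t,\mathsf y)$ is its heat kernel (kernel of $e^{-t\mathcal H}$, Neumann conditions), symmetric in $\mathsf x,\mathsf y$ with $0<g\le c_1t^{-d/2}e^{-c_2|\mathsf x-\mathsf y|^2/t}$ on $\overline D$, $t\in(0,T]$. $u_{\mathsf m}(\mathsf x,t)=\int_D g(\mathsf x,t,\mathsf y)\varphi_{\mathsf m,0}(\mathsf y)\mathsf{dy}$, $v_{\mathsf m}(\mathsf x,t)=\int_Dg(\mathsf x,T-t,\mathsf y)\psi_{\mathsf m,T}(\mathsf y)\mathsf{dy}$. A Bernstein process is a $\overline D$-valued process $Z_{\tau\in[0,T]}$ with $\mathbb E(b(Z_r)\mid\mathcal F_s^+\vee\mathcal F_t^-)=\mathbb E(b(Z_r)\mid Z_s,Z_t)$ a.s. for all bounded Borel $b$ and $r\in(s,t)\subset[0,T]$, where $\mathcal F_s^+$ (resp. $\mathcal F_t^-$) is generated by $Z_\tau$, $\tau\le s$ (resp. $\tau\ge t$). For a probability measure $\mu$ on $\mathcal B(\overline D)\times\mathcal B(\overline D)$, "the Bernstein process generated by $\mu$"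 is the Bernstein process $Z$, on a probability space with measure $\mathbb P_\mu$, whose law is uniquely determined by: $\mathbb P_\mu(Z_0\in F_0,Z_T\in F_T)=\mu(F_0\times F_T)$; $\mathbb P_\mu(Z_r\in F\mid Z_s,Z_t)=\int_F\mathsf{dz}\,\frac{g(Z_t,t-r,\mathsf z)g(\mathsf z,r-s,Z_s)}{g(Z_t,t-s,Z_s)}$ for $r\in(s,t)\subset[0,T]$; and, for $0=t_0<t_1<\dots<t_n<T$, $\mathbb P_\mu(Z_{t_1}\in F_1,\dots,Z_{t_n}\in F_n)=\int_{D\times D}\frac{\mathsf d\mu(\mathsf x,\mathsf y)}{g(\mathsf x,T,\mathsf y)}\int_{F_1}\mathsf{dx}_1\cdots\int_{F_n}\mathsf{dx}_n\prod_{k=1}^ng(\mathsf x_k,t_k-t_{k-1},\mathsf x_{k-1})\,g(\mathsf y,T-t_n,\mathsf x_n)$ with $\mathsf x_0=\mathsf x$. A process is Markovian if it has the Markov property. *)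

theory Defs
  imports "HOL-Analysis.Analysis" "HOL-Probability.Probability"
begin

text \<open>Properties of the Neumann heat kernel of H = -1/2 Laplacian + V that are
  listed in the context (symmetry, positivity, Gaussian upper bound on the
  closure of D for t in (0,T]), together with the semigroup (Chapman-Kolmogorov)
  property of e^{-tH} and joint Borel measurability.\<close>
definition heat_kernel_props ::
  "(real^'d) set \<Rightarrow> real \<Rightarrow> (real^'d \<Rightarrow> real \<Rightarrow> real^'d \<Rightarrow> real) \<Rightarrow> bool" where
  "heat_kernel_props D T g \<longleftrightarrow>
     (\<forall>x\<in>closure D. \<forall>y\<in>closure D. \<forall>t\<in>{0<..T}. g x t y = g y t x \<and> 0 < g x t y) \<and>
     (\<exists>c1>0. \<exists>c2>0. \<forall>x\<in>closure D. \<forall>y\<in>closure D. \<forall>t\<in>{0<..T}.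
          g x t y \<le> c1 * t powr (- real CARD('d) / 2) * exp (- c2 * (norm (x - y))\<^sup>2 / t)) \<and>
     (\<forall>x\<in>closure D. \<forall>y\<in>closure D. \<forall>s t. 0 < s \<longrightarrow> 0 < t \<longrightarrow> s + t \<le> T \<longrightarrow>
          g x (s + t) y = (LINT z:D|lborel. g x s z * g z t y)) \<and>
     (\<lambda>(x, t, y). g x t y) \<in> borel_measurable borel"

definition gen_by :: "'w measure \<Rightarrow> (real \<Rightarrow> 'w \<Rightarrow> real^'d) \<Rightarrow> real set \<Rightarrow> 'w measure" where
  "gen_by M Z A = sigma (space M)
      (\<Union>\<tau>\<in>A. {Z \<tau> -` B \<inter> space M | B. B \<in> sets (borel :: (real^'d) measure)})"

text \<open>Bernstein (reciprocal) process on [0,T] with values in closure D.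
  F_s^+ v F_t^- is generated by Z_tau, tau in [0,s] union [t,T].\<close>
definition bernstein_process ::
  "'w measure \<Rightarrow> (real \<Rightarrow> 'w \<Rightarrow> real^'d) \<Rightarrow> real \<Rightarrow> (real^'d) set \<Rightarrow> bool" where
  "bernstein_process M Z T D \<longleftrightarrow>
     prob_space M \<and>
     (\<forall>\<tau>\<in>{0..T}. Z \<tau> \<in> borel_measurable M \<and> (\<forall>\<omega>\<in>space M. Z \<tau> \<omega> \<in> closure D)) \<and>
     (\<forall>b :: real^'d \<Rightarrow> real. b \<in> borel_measurable (restrict_space borel (closure D)) \<longrightarrow>
        bounded (b ` closure D) \<longrightarrow>
        (\<forall>s r t. 0 \<le> s \<longrightarrow> s < r \<longrightarrow> r < t \<longrightarrow> t \<le> T \<longrightarrow>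
           (AE \<omega> in M. real_cond_exp M (gen_by M Z ({0..s} \<union> {t..T})) (\<lambda>\<omega>. b (Z r \<omega>)) \<omega>
                      = real_cond_exp M (gen_by M Z {s, t}) (\<lambda>\<omega>. b (Z r \<omega>)) \<omega>)))"

definition markov_process ::
  "'w measure \<Rightarrow> (real \<Rightarrow> 'w \<Rightarrow> real^'d) \<Rightarrow> real \<Rightarrow> (real^'d) set \<Rightarrow> bool" where
  "markov_process M Z T D \<longleftrightarrow>
     (\<forall>b :: real^'d \<Rightarrow> real. b \<in> borel_measurable (restrict_space borel (closure D)) \<longrightarrow>
        bounded (b ` closure D) \<longrightarrow>
        (\<forall>s t. 0 \<le> s \<longrightarrow> s < t \<longrightarrow> t \<le> T \<longrightarrow>
           (AE \<omega> in M. real_cond_exp M (gen_by M Z {0..s}) (\<lambda>\<omega>. b (Z t \<omega>)) \<omega>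
                      = real_cond_exp M (gen_by M Z {s}) (\<lambda>\<omega>. b (Z t \<omega>)) \<omega>)))"

text \<open>Nested integral of the finite-dimensional distribution formula:
  fd_kernel g T [(t1,F1),...,(tn,Fn)] t0 x0 y =
  int_{F1} dx1 ... int_{Fn} dxn prod_k g(x_k, t_k - t_{k-1}, x_{k-1}) g(y, T - t_n, x_n).\<close>
fun fd_kernel :: "(real^'d \<Rightarrow> real \<Rightarrow> real^'d \<Rightarrow> real) \<Rightarrow> real \<Rightarrow> (real \<times> (real^'d) set) list
                  \<Rightarrow> real \<Rightarrow> real^'d \<Rightarrow> real^'d \<Rightarrow> real" where
  "fd_kernel g T [] t0 x0 y = g y (T - t0) x0"
| "fd_kernel g T ((t, F) # rest) t0 x0 y =
     (LINT x1:F|lborel. g x1 (t - t0) x0 * fd_kernel g T rest t x1 y)"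

definition bernstein_generated ::
  "'w measure \<Rightarrow> (real \<Rightarrow> 'w \<Rightarrow> real^'d) \<Rightarrow> real \<Rightarrow> (real^'d) set
     \<Rightarrow> (real^'d \<Rightarrow> real \<Rightarrow> real^'d \<Rightarrow> real) \<Rightarrow> ((real^'d) \<times> (real^'d)) measure \<Rightarrow> bool" where
  "bernstein_generated M Z T D g \<mu> \<longleftrightarrow>
     bernstein_process M Z T D \<and>
     (\<forall>F0 FT. F0 \<in> sets borel \<longrightarrow> F0 \<subseteq> closure D \<longrightarrow> FT \<in> sets borel \<longrightarrow> FT \<subseteq> closure D \<longrightarrow>
        measure M {\<omega> \<in> space M. Z 0 \<omega> \<in> F0 \<and> Z T \<omega> \<in> FT} = measure \<mu> (F0 \<times> FT)) \<and>
     (\<forall>s r t F. 0 \<le> s \<longrightarrow> s < r \<longrightarrow> r < t \<longrightarrow> t \<le> T \<longrightarrow> F \<in> sets borel \<longrightarrow> F \<subseteq> closure D \<longrightarrow>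
        (AE \<omega> in M. real_cond_exp M (gen_by M Z {s, t}) (indicator (Z r -` F \<inter> space M)) \<omega>
            = (LINT z:F|lborel. g (Z t \<omega>) (t - r) z * g z (r - s) (Z s \<omega>))
                / g (Z t \<omega>) (t - s) (Z s \<omega>))) \<and>
     (\<forall>ts Fs. length ts = length Fs \<longrightarrow> ts \<noteq> [] \<longrightarrow> sorted_wrt (<) ts \<longrightarrow>
        0 < hd ts \<longrightarrow> last ts < T \<longrightarrow>
        (\<forall>F\<in>set Fs. F \<in> sets borel \<and> F \<subseteq> closure D) \<longrightarrow>
        measure M {\<omega> \<in> space M. \<forall>k<length ts. Z (ts ! k) \<omega> \<in> Fs ! k}
          = (\<integral>(x, y). fd_kernel g T (zip ts Fs) 0 x y / g x T y \<partial>\<mu>))"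

definition mu_of :: "(real^'d) set \<Rightarrow> real \<Rightarrow> (real^'d \<Rightarrow> real \<Rightarrow> real^'d \<Rightarrow> real)
                      \<Rightarrow> (real^'d \<Rightarrow> real) \<Rightarrow> (real^'d \<Rightarrow> real) \<Rightarrow> ((real^'d) \<times> (real^'d)) measure" where
  "mu_of D T g \<phi> \<psi> = density (lborel \<Otimes>\<^sub>M lborel)
      (\<lambda>(x, y). ennreal (indicator (D \<times> D) (x, y) * \<phi> x * g x T y * \<psi> y))"

definition mixture :: "('i \<Rightarrow> real) \<Rightarrow> ('i \<Rightarrow> ((real^'d) \<times> (real^'d)) measure) \<Rightarrow> ((real^'d) \<times> (real^'d)) measure" where
  "mixture p \<mu>s = measure_of UNIV (sets (lborel \<Otimes>\<^sub>M (lborel :: (real^'d) measure)))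
      (\<lambda>G. \<Sum>\<^sub>\<infinity>m. ennreal (p m) * emeasure (\<mu>s m) G)"

definition u_fun :: "(real^'d) set \<Rightarrow> (real^'d \<Rightarrow> real \<Rightarrow> real^'d \<Rightarrow> real) \<Rightarrow> (real^'d \<Rightarrow> real)
                     \<Rightarrow> real^'d \<Rightarrow> real \<Rightarrow> real" where
  "u_fun D g \<phi> x t = (if t = 0 then \<phi> x else (LINT y:D|lborel. g x t y * \<phi> y))"

definition v_fun :: "(real^'d) set \<Rightarrow> real \<Rightarrow> (real^'d \<Rightarrow> real \<Rightarrow> real^'d \<Rightarrow> real) \<Rightarrow> (real^'d \<Rightarrow> real)
                     \<Rightarrow> real^'d \<Rightarrow> real \<Rightarrow> real" where
  "v_fun D T g \<psi> x t = (if t = T then \<psi> x else (LINT y:D|lborel. g x (T - t) y * \<psi> y))"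

end

theory Submission
  imports Defs
begin

text \<open>Write every endpoint measure as \<open>r(x,y) g(x,T,y) dx dy\<close>. The probability of a cylinder event is
  the integral of a bounded nonnegative kernel against \<open>r\<close>, hence linear in \<open>r\<close>, and this passes to
  countable mixtures by dominated convergence; Fubini evaluates the one-dimensional marginals when \<open>r\<close>
  is a product. For the non-Markov part, \<open>(Z s, Z 0, Z T)\<close> has density
  \<open>r(x,y) g(w,s,x) g(y,T-s,w)\<close> for \<open>0 < s < T\<close>. The Markov property at time \<open>s\<close> makes \<open>Z 0\<close> and
  \<open>Z T\<close> conditionally independent given \<open>Z s\<close>, so for almost every \<open>w\<close> this density splits into a
  function of \<open>x\<close> times a function of \<open>y\<close>, and so does \<open>r\<close>.\<close>

subsection \<open>Measures on products and countable mixtures\<close>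

text \<open>The integrals of the statement run over D, the processes live in closure D, and the
  kernel estimates hold only on closure D. All computations are therefore moved to \<open>N\<close>,
  Lebesgue measure on closure D; the null boundary makes this change harmless. At a fixed time the
  Gaussian bound is a constant and \<open>N\<close> is finite, so integrability rests on constant
  bounds, and the uniform bounds on \<phi> and \<psi> give one constant for all indices of the
  mixture. The formula for the finite-dimensional distributions does not reach the times 0 and T.
  The joint law with the endpoints is obtained instead by integrating the prescribed conditional law
  of \<open>Z s\<close> given \<open>(Z 0, Z T)\<close> against the endpoint law. The non-Markov
  claim is proved by contraposition. One w is fixed at which the joint density splits; dividing by
  the positive factors g(w,s,x) and g(y,T-s,w), each of which depends on a single endpoint, carries
  the splitting over to r.\<close>

lemma pair_restrict_space:
  assumes "sigma_finite_measure M1" "sigma_finite_measure M2"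
    and A: "A \<in> sets M1" and B: "B \<in> sets M2"
  shows "restrict_space M1 A \<Otimes>\<^sub>M restrict_space M2 B = restrict_space (M1 \<Otimes>\<^sub>M M2) (A \<times> B)"
proof (rule pair_measure_eqI)
  interpret M1: sigma_finite_measure M1 by fact
  interpret M2: sigma_finite_measure M2 by fact
  show "sigma_finite_measure (restrict_space M1 A)" "sigma_finite_measure (restrict_space M2 B)"
    using A B M1.sigma_finite_measure_axioms M2.sigma_finite_measure_axioms
    by (auto intro: sigma_finite_measure_restrict_space)
  have AB: "A \<times> B \<in> sets (M1 \<Otimes>\<^sub>M M2)" using A B by auto
  have spA: "A \<inter> space M1 = A" "B \<inter> space M2 = B" using A B sets.sets_into_space by auto
  show "sets (restrict_space M1 A \<Otimes>\<^sub>M restrict_space M2 B) = sets (restrict_space (M1 \<Otimes>\<^sub>M M2) (A \<times> B))"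
  proof
    show "sets (restrict_space M1 A \<Otimes>\<^sub>M restrict_space M2 B) \<subseteq> sets (restrict_space (M1 \<Otimes>\<^sub>M M2) (A \<times> B))"
      unfolding sets_pair_measure
    proof (rule sigma_algebra.sigma_sets_subset)
      have "space (restrict_space M1 A) \<times> space (restrict_space M2 B) = space (restrict_space (M1 \<Otimes>\<^sub>M M2) (A \<times> B))"
        using spA AB sets.sets_into_space[OF AB] by (auto simp: space_restrict_space space_pair_measure)
      then show "sigma_algebra (space (restrict_space M1 A) \<times> space (restrict_space M2 B))
          (sets (restrict_space (M1 \<Otimes>\<^sub>M M2) (A \<times> B)))"
        using sets.sigma_algebra_axioms by metis
      show "{a \<times> b |a b. a \<in> sets (restrict_space M1 A) \<and> b \<in> sets (restrict_space M2 B)}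
          \<subseteq> sets (restrict_space (M1 \<Otimes>\<^sub>M M2) (A \<times> B))"
        using A B AB by (auto simp: sets_restrict_space_iff)
    qed
  next
    have *: "(\<lambda>x. x) \<in> restrict_space M1 A \<Otimes>\<^sub>M restrict_space M2 B \<rightarrow>\<^sub>M M1 \<Otimes>\<^sub>M M2"
      by (rule measurable_pair)
         (auto simp: comp_def intro!: measurable_compose[OF measurable_fst] measurable_compose[OF measurable_snd]
               measurable_restrict_space1)
    have "X \<inter> (A \<times> B) \<in> sets (restrict_space M1 A \<Otimes>\<^sub>M restrict_space M2 B)"
      if "X \<in> sets (M1 \<Otimes>\<^sub>M M2)" for X
    proof -
      have "(\<lambda>x. x) -` X \<inter> space (restrict_space M1 A \<Otimes>\<^sub>M restrict_space M2 B) = X \<inter> (A \<times> B)"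
        using spA by (simp add: space_pair_measure space_restrict_space Int_commute)
      then show ?thesis using measurable_sets[OF * that] by simp
    qed
    then show "sets (restrict_space (M1 \<Otimes>\<^sub>M M2) (A \<times> B)) \<subseteq> sets (restrict_space M1 A \<Otimes>\<^sub>M restrict_space M2 B)"
      by (auto simp: sets_restrict_space Int_commute)
  qed
  fix a b assume "a \<in> sets (restrict_space M1 A)" "b \<in> sets (restrict_space M2 B)"
  then show "emeasure (restrict_space M1 A) a * emeasure (restrict_space M2 B) b =
       emeasure (restrict_space (M1 \<Otimes>\<^sub>M M2) (A \<times> B)) (a \<times> b)"
    using A B AB
    by (subst (1 2 3) emeasure_restrict_space)
       (auto simp: sets_restrict_space_iff M2.emeasure_pair_measure_Times)
qed

text \<open>Uniqueness on the intersection-stable system of rectangles; since \<open>P\<close> is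
  finite, the whole space alone serves as exhausting sequence. Leaving a generator \<open>E\<close>
  in the second factor is what allows rectangles there too, and hence triple products.\<close>

lemma finite_measure_pair_eqI:
  assumes fin: "finite_measure P"
    and sP: "sets P = sets (M1 \<Otimes>\<^sub>M M2)" and sQ: "sets Q = sets (M1 \<Otimes>\<^sub>M M2)"
    and E: "Int_stable E" "E \<subseteq> Pow (space M2)" "space M2 \<in> E" "sets M2 = sigma_sets (space M2) E"
    and eq: "\<And>A B. A \<in> sets M1 \<Longrightarrow> B \<in> E \<Longrightarrow> emeasure P (A \<times> B) = emeasure Q (A \<times> B)"
  shows "P = Q"
proof (rule measure_eqI_generator_eq[where A="\<lambda>_::nat. space M1 \<times> space M2"])
  let ?E = "{a \<times> b |a b. a \<in> sets M1 \<and> b \<in> E}"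
  show "Int_stable ?E"
  proof (rule Int_stableI)
    fix X Y assume "X \<in> ?E" "Y \<in> ?E"
    then obtain a b c d where X: "X = a \<times> b" "a \<in> sets M1" "b \<in> E" "Y = c \<times> d" "c \<in> sets M1" "d \<in> E"
      by auto
    then have "X \<inter> Y = (a \<inter> c) \<times> (b \<inter> d)" "b \<inter> d \<in> E" "a \<inter> c \<in> sets M1"
      using Int_stableD[OF E(1)] by auto
    then show "X \<inter> Y \<in> ?E" by blast
  qed
  show sub: "?E \<subseteq> Pow (space M1 \<times> space M2)"
    using E(2) sets.sets_into_space by blast
  have "sets (M1 \<Otimes>\<^sub>M M2) = sets (sigma (space M1 \<times> space M2) ?E)"
    by (rule sets_pair_eq[of "sets M1" _ "{space M1}" E _ "{space M2}"])
       (use E sets.space_closed[of M1] in \<open>auto simp: sets.sigma_sets_eq\<close>)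
  then show "sets P = sigma_sets (space M1 \<times> space M2) ?E" "sets Q = sigma_sets (space M1 \<times> space M2) ?E"
    using sub by (auto simp: sP sQ)
  show "\<And>X. X \<in> ?E \<Longrightarrow> emeasure P X = emeasure Q X"
    using eq by auto
  show "range (\<lambda>_. space M1 \<times> space M2) \<subseteq> ?E" using E(3) by auto
  show "(\<Union>i::nat. space M1 \<times> space M2) = space M1 \<times> space M2" by auto
  show "emeasure P (space M1 \<times> space M2) \<noteq> \<infinity>"
    using finite_measure.emeasure_finite[OF fin] by (simp add: top_unique)
qed

lemma finite_measure_triple_eqI:
  assumes fin: "finite_measure P"
    and sets: "sets P = sets (M1 \<Otimes>\<^sub>M (M2 \<Otimes>\<^sub>M M3))" "sets Q = sets (M1 \<Otimes>\<^sub>M (M2 \<Otimes>\<^sub>M M3))"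
    and eq: "\<And>A B C. A \<in> sets M1 \<Longrightarrow> B \<in> sets M2 \<Longrightarrow> C \<in> sets M3 \<Longrightarrow>
      emeasure P (A \<times> (B \<times> C)) = emeasure Q (A \<times> (B \<times> C))"
  shows "P = Q"
proof (rule finite_measure_pair_eqI[OF fin sets, where E="{B \<times> C |B C. B \<in> sets M2 \<and> C \<in> sets M3}"])
  show "Int_stable {B \<times> C |B C. B \<in> sets M2 \<and> C \<in> sets M3}"
    by (rule Int_stable_pair_measure_generator)
  show "{B \<times> C |B C. B \<in> sets M2 \<and> C \<in> sets M3} \<subseteq> Pow (space (M2 \<Otimes>\<^sub>M M3))"
    by (auto simp: space_pair_measure dest: sets.sets_into_space)
  show "space (M2 \<Otimes>\<^sub>M M3) \<in> {B \<times> C |B C. B \<in> sets M2 \<and> C \<in> sets M3}"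
    by (auto simp: space_pair_measure)
  show "sets (M2 \<Otimes>\<^sub>M M3) = sigma_sets (space (M2 \<Otimes>\<^sub>M M3)) {B \<times> C |B C. B \<in> sets M2 \<and> C \<in> sets M3}"
    by (simp add: sets_pair_measure space_pair_measure)
  show "emeasure P (A \<times> E) = emeasure Q (A \<times> E)"
    if "A \<in> sets M1" "E \<in> {B \<times> C |B C. B \<in> sets M2 \<and> C \<in> sets M3}" for A E
    using that(2) eq[OF that(1)] by blast
qed

text \<open>Dominated convergence with \<open>F\<close> itself as majorant: partial sums of
  nonnegative terms stay below their sum.\<close>

lemma has_sum_integral_nonneg_countable:
  fixes f :: "'i::countable \<Rightarrow> 'a \<Rightarrow> real"
  assumes meas: "\<And>i. integrable M (f i)" and nn: "\<And>i x. x \<in> space M \<Longrightarrow> 0 \<le> f i x"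
    and sum: "\<And>x. x \<in> space M \<Longrightarrow> ((\<lambda>i. f i x) has_sum F x) UNIV" and F: "integrable M F"
  shows "((\<lambda>i. LINT x|M. f i x) has_sum (LINT x|M. F x)) UNIV"
proof -
  \<comment> \<open>The terms are transported to the naturals and padded by zero off the range of
    \<open>to_nat\<close>, so that finite and infinite index types are treated alike.\<close>
  define R where "R = range (to_nat :: 'i \<Rightarrow> nat)"
  define f' where "f' n x = (if n \<in> R then f (from_nat n) x else 0)" for n x
  have bij: "bij_betw to_nat (UNIV::'i set) R"
    unfolding R_def bij_betw_def by auto
  have hs: "((\<lambda>n. f' n x) has_sum F x) UNIV" if "x \<in> space M" for x
  proof -
    have "((\<lambda>n. f' n x) has_sum F x) R"
      using sum[OF that] has_sum_reindex_bij_betw[OF bij, of "\<lambda>n. f' n x" "F x"]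
      by (simp add: f'_def R_def)
    then show ?thesis
      by (rule has_sum_cong_neutral[THEN iffD1, rotated -1]) (auto simp: f'_def)
  qed
  have int: "integrable M (f' n)" for n using meas[of "from_nat n"] by (cases "n \<in> R") (simp_all add: f'_def[abs_def])
  have nn': "0 \<le> f' n x" if "x \<in> space M" for n x using nn[OF that] by (auto simp: f'_def)
  have part: "(\<Sum>n<k. f' n x) \<le> F x" if "x \<in> space M" for k x
  proof (rule has_sum_mono_neutral[of "\<lambda>n. f' n x" "{..<k}" _ "\<lambda>n. f' n x" UNIV])
    show "((\<lambda>n. f' n x) has_sum (\<Sum>n<k. f' n x)) {..<k}" by (auto intro: has_sum_finite)
  qed (use hs nn' that in auto)
  have lim: "(\<lambda>k. LINT x|M. (\<Sum>n<k. f' n x)) \<longlonglongrightarrow> (LINT x|M. F x)"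
  proof (rule integral_dominated_convergence[where w=F])
    show "AE x in M. (\<lambda>k. \<Sum>n<k. f' n x) \<longlonglongrightarrow> F x"
      using has_sum_imp_sums[OF hs] by (auto simp: sums_def)
    show "AE x in M. norm (\<Sum>n<k. f' n x) \<le> F x" for k
      using part nn' by (auto simp: abs_of_nonneg sum_nonneg)
  qed (use F int in auto)
  have "(\<lambda>n. LINT x|M. f' n x) sums (LINT x|M. F x)"
    using lim int by (simp add: sums_def)
  \<comment> \<open>Nonnegativity upgrades convergence in the natural order to unconditional
    summability.\<close>
  moreover have "0 \<le> (LINT x|M. f' n x)" for n
    using nn' by (auto intro: integral_nonneg_AE)
  ultimately have "((\<lambda>n. LINT x|M. f' n x) has_sum (LINT x|M. F x)) UNIV"
    by (intro sums_nonneg_imp_has_sum) auto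
  then have "((\<lambda>n. LINT x|M. f' n x) has_sum (LINT x|M. F x)) R"
    by (rule has_sum_cong_neutral[THEN iffD1, rotated -1]) (auto simp: f'_def)
  then show ?thesis
    using has_sum_reindex_bij_betw[OF bij, of "\<lambda>n. LINT x|M. f' n x" "LINT x|M. F x"]
    by (simp add: f'_def R_def)
qed

text \<open>Comparison with the series of \<open>p m * C\<close>. This is the point at which a bound
  uniform in the index enters.\<close>

lemma convex_combination_has_sum:
  fixes p a :: "'i \<Rightarrow> real"
  assumes p: "\<And>m. 0 \<le> p m" "(p has_sum 1) UNIV" and a: "\<And>m. 0 \<le> a m" "\<And>m. a m \<le> C"
  shows "((\<lambda>m. p m * a m) has_sum (\<Sum>\<^sub>\<infinity>m. p m * a m)) UNIV"
proof (rule has_sum_infsum, rule summable_on_comparison_test)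
  show "(\<lambda>m. p m * C) summable_on UNIV"
    using p(2) by (intro summable_on_cmult_left) (auto simp: summable_on_def)
  show "\<And>m. p m * a m \<le> p m * C"
    using a p(1) by (intro mult_left_mono) auto
  show "\<And>m. 0 \<le> p m * a m"
    using a p(1) by auto
qed

lemma convex_combination_le:
  fixes p a :: "'i \<Rightarrow> real"
  assumes p: "\<And>m. 0 \<le> p m" "(p has_sum 1) UNIV" and a: "\<And>m. 0 \<le> a m" "\<And>m. a m \<le> C"
  shows "(\<Sum>\<^sub>\<infinity>m. p m * a m) \<le> C"
proof -
  have 1: "((\<lambda>m. p m * C) has_sum 1 * C) UNIV" using p(2) by (rule has_sum_cmult_left)
  have "p m * a m \<le> p m * C" for m
    by (rule mult_left_mono[OF a(2) p(1)])
  from has_sum_mono[OF convex_combination_has_sum[OF p a] 1 this]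
  show ?thesis by simp
qed

text \<open>An unordered sum is a limit along the net of finite index sets, while measurability
  passes to limits of sequences. The sets of indices with code below n are finite and eventually
  contain every finite set, so they form a sequence along which the net converges.\<close>

lemma borel_measurable_infsum_countable:
  fixes f :: "'i::countable \<Rightarrow> 'a \<Rightarrow> real"
  assumes meas: "\<And>i. f i \<in> borel_measurable S"
    and sum: "\<And>x. x \<in> space S \<Longrightarrow> (\<lambda>i. f i x) summable_on UNIV"
  shows "(\<lambda>x. \<Sum>\<^sub>\<infinity>i. f i x) \<in> borel_measurable S"
proof -
  define e :: "nat \<Rightarrow> 'i \<Rightarrow> bool" where "e n m \<longleftrightarrow> to_nat m < n" for n m
  have fin: "finite {m::'i. e n m}" for n
    unfolding e_def by (rule finite_imageD[of to_nat]) (auto intro: finite_subset[of _ "{..<n}"] simp: inj_on_def)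
  show ?thesis
  proof (rule borel_measurable_LIMSEQ_real[where u="\<lambda>n x. \<Sum>m | e n m. f m x"])
    fix x assume "x \<in> space S"
    then have "((\<lambda>F. \<Sum>m\<in>F. f m x) \<longlongrightarrow> (\<Sum>\<^sub>\<infinity>m. f m x)) (finite_subsets_at_top UNIV)"
      using has_sum_infsum[OF sum] by (simp add: has_sum_def)
    moreover have "filterlim (\<lambda>n. {m::'i. e n m}) (finite_subsets_at_top UNIV) sequentially"
      unfolding filterlim_finite_subsets_at_top
    proof (intro allI impI)
      fix X :: "'i set" assume X: "finite X \<and> X \<subseteq> UNIV"
      then have "\<forall>m\<in>X. eventually (\<lambda>n. e n m) sequentially"
        by (auto simp: e_def eventually_gt_at_top)
      then have "eventually (\<lambda>n. \<forall>m\<in>X. e n m) sequentially"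
        using X by (simp add: eventually_ball_finite)
      then show "eventually (\<lambda>n. finite {m. e n m} \<and> X \<subseteq> {m. e n m} \<and> {m. e n m} \<subseteq> UNIV) sequentially"
        by eventually_elim (use fin in auto)
    qed
    ultimately show "(\<lambda>n. \<Sum>m | e n m. f m x) \<longlonglongrightarrow> (\<Sum>\<^sub>\<infinity>m. f m x)"
      by (rule filterlim_compose)
  next
    show "(\<lambda>x. \<Sum>m | e n m. f m x) \<in> borel_measurable S" for n
      using meas by (rule borel_measurable_sum)
  qed
qed

text \<open>Summation under the integral is available for nonnegative terms, so \<open>b\<close> is
  split into real and imaginary part and each of these into positive and negative part. The uniform
  bound \<open>C\<close> on the densities keeps every piece integrable over the finite measure
  \<open>S\<close>.\<close>

lemma has_sum_integral_bounded_density: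
  fixes w :: "'i::countable \<Rightarrow> 'a \<Rightarrow> real" and b :: "'a \<Rightarrow> complex"
  assumes S: "finite_measure S" and p: "\<And>m. 0 \<le> p m" "(p has_sum 1) UNIV"
    and w: "\<And>m. w m \<in> borel_measurable S" "\<And>m x. x \<in> space S \<Longrightarrow> 0 \<le> w m x"
      "\<And>m x. x \<in> space S \<Longrightarrow> w m x \<le> C"
    and b: "b \<in> borel_measurable S" "\<And>x. x \<in> space S \<Longrightarrow> norm (b x) \<le> B"
  shows "((\<lambda>m. complex_of_real (p m) * (LINT x|S. b x * complex_of_real (w m x))) has_sum
    (LINT x|S. b x * complex_of_real (\<Sum>\<^sub>\<infinity>m. p m * w m x))) UNIV"
proof -
  interpret finite_measure S by fact
  let ?W = "\<lambda>x. \<Sum>\<^sub>\<infinity>m. p m * w m x"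
  have hs: "((\<lambda>m. p m * w m x) has_sum ?W x) UNIV" if "x \<in> space S" for x
    by (rule convex_combination_has_sum[OF p]) (use w that in auto)
  have W: "?W \<in> borel_measurable S" "\<And>x. x \<in> space S \<Longrightarrow> 0 \<le> ?W x" "\<And>x. x \<in> space S \<Longrightarrow> ?W x \<le> C"
  proof -
    show "?W \<in> borel_measurable S"
    proof (rule borel_measurable_infsum_countable)
      show "(\<lambda>z. p m * w m z) \<in> borel_measurable S" for m using w(1) by measurable
    qed (use hs in \<open>auto intro: has_sum_imp_summable\<close>)
    show "0 \<le> ?W x" if "x \<in> space S" for x
      using w(2)[OF that] p(1) by (intro infsum_nonneg) auto
    show "?W x \<le> C" if "x \<in> space S" for x
      by (rule convex_combination_le[OF p]) (use w that in auto)
  qed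
  have int: "integrable S (\<lambda>x. c x * v x)"
    if "c \<in> borel_measurable S" "\<And>x. x \<in> space S \<Longrightarrow> \<bar>c x\<bar> \<le> B'"
      "v \<in> borel_measurable S" "\<And>x. x \<in> space S \<Longrightarrow> 0 \<le> v x" "\<And>x. x \<in> space S \<Longrightarrow> v x \<le> C"
    for c v :: "'a \<Rightarrow> real" and B'
  proof (rule integrable_const_bound[of _ "B' * C"])
    show "AE x in S. norm (c x * v x) \<le> B' * C"
      using that(2,4,5) by (intro AE_I2) (fastforce simp: abs_mult intro!: mult_mono)
    show "(\<lambda>x. c x * v x) \<in> borel_measurable S" using that(1,3) by measurable
  qed
  have nn: "((\<lambda>m. p m * (LINT x|S. c x * w m x)) has_sum (LINT x|S. c x * ?W x)) UNIV"
    if c: "c \<in> borel_measurable S" "\<And>x. x \<in> space S \<Longrightarrow> 0 \<le> c x" "\<And>x. x \<in> space S \<Longrightarrow> c x \<le> B'"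
    for c B'
  proof -
    have c': "\<bar>c x\<bar> \<le> B'" if "x \<in> space S" for x using c(2,3)[OF that] by simp
    have "((\<lambda>m. (LINT x|S. p m * (c x * w m x))) has_sum (LINT x|S. c x * ?W x)) UNIV"
    proof (rule has_sum_integral_nonneg_countable)
      show "integrable S (\<lambda>x. p m * (c x * w m x))" for m
        using int[OF c(1) c' w] by simp
      show "integrable S (\<lambda>x. c x * ?W x)"
        by (rule int[OF c(1) c' W])
      fix x assume x: "x \<in> space S"
      show "0 \<le> p m * (c x * w m x)" for m
        using p(1) c(2)[OF x] w(2)[OF x] by simp
      have "((\<lambda>m. c x * (p m * w m x)) has_sum c x * ?W x) UNIV"
        using hs[OF x] by (rule has_sum_cmult_right)
      then show "((\<lambda>m. p m * (c x * w m x)) has_sum c x * ?W x) UNIV"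
        by (simp add: mult.left_commute)
    qed
    then show ?thesis by simp
  qed
  have re: "((\<lambda>m. p m * (LINT x|S. c x * w m x)) has_sum (LINT x|S. c x * ?W x)) UNIV"
    if c: "c \<in> borel_measurable S" "\<And>x. x \<in> space S \<Longrightarrow> \<bar>c x\<bar> \<le> B" for c
  proof -
    have 1: "((\<lambda>m. p m * (LINT x|S. max 0 (c x) * w m x)) has_sum (LINT x|S. max 0 (c x) * ?W x)) UNIV"
      by (rule nn[of _ "\<bar>B\<bar>"]) (use c in \<open>fastforce+\<close>)
    have 2: "((\<lambda>m. p m * (LINT x|S. max 0 (- c x) * w m x)) has_sum (LINT x|S. max 0 (- c x) * ?W x)) UNIV"
      by (rule nn[of _ "\<bar>B\<bar>"]) (use c in \<open>fastforce+\<close>)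
    have split: "(LINT x|S. max 0 (c x) * v x) - (LINT x|S. max 0 (- c x) * v x) = (LINT x|S. c x * v x)"
      if "v \<in> borel_measurable S" "\<And>x. x \<in> space S \<Longrightarrow> 0 \<le> v x" "\<And>x. x \<in> space S \<Longrightarrow> v x \<le> C" for v
    proof -
      have "(LINT x|S. max 0 (c x) * v x) - (LINT x|S. max 0 (- c x) * v x)
         = (LINT x|S. max 0 (c x) * v x - max 0 (- c x) * v x)"
        by (rule Bochner_Integration.integral_diff[symmetric])
           (rule int[OF _ _ that, of _ "\<bar>B\<bar>"]; use c in fastforce)+
      also have "\<dots> = (LINT x|S. c x * v x)"
        by (rule Bochner_Integration.integral_cong) (auto simp: max_def)
      finally show ?thesis .
    qed
    have "((\<lambda>m. - (p m * (LINT x|S. max 0 (- c x) * w m x))) has_sum - (LINT x|S. max 0 (- c x) * ?W x)) UNIV"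
      unfolding has_sum_uminus minus_minus by (rule 2)
    from has_sum_add[OF 1 this]
    have "((\<lambda>m. p m * ((LINT x|S. max 0 (c x) * w m x) - (LINT x|S. max 0 (- c x) * w m x))) has_sum
      ((LINT x|S. max 0 (c x) * ?W x) - (LINT x|S. max 0 (- c x) * ?W x))) UNIV"
      by (simp add: right_diff_distrib)
    moreover have "(LINT x|S. max 0 (c x) * w m x) - (LINT x|S. max 0 (- c x) * w m x) = (LINT x|S. c x * w m x)" for m
      by (rule split[OF w])
    moreover have "(LINT x|S. max 0 (c x) * ?W x) - (LINT x|S. max 0 (- c x) * ?W x) = (LINT x|S. c x * ?W x)"
      by (rule split[OF W])
    ultimately show ?thesis by simp
  qed
  \<comment> \<open>The two real series are summed separately. The reassembly into a complex
    integral is then shown for an arbitrary density bounded by \<open>C\<close>, which covers each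
    \<open>w m\<close> and the mixture at once.\<close>
  have "((\<lambda>m. complex_of_real (p m * (LINT x|S. Re (b x) * w m x)) + \<i> * complex_of_real (p m * (LINT x|S. Im (b x) * w m x)))
     has_sum complex_of_real (LINT x|S. Re (b x) * ?W x) + \<i> * complex_of_real (LINT x|S. Im (b x) * ?W x)) UNIV"
  proof (intro has_sum_add has_sum_cmult_right has_sum_of_real re)
    show "\<bar>Re (b x)\<bar> \<le> B" "\<bar>Im (b x)\<bar> \<le> B" if "x \<in> space S" for x
      using b(2)[OF that] abs_Re_le_cmod[of "b x"] abs_Im_le_cmod[of "b x"] by linarith+
  qed (use b(1) in measurable)
  moreover
  have "complex_of_real (LINT x|S. Re (b x) * v x) + \<i> * complex_of_real (LINT x|S. Im (b x) * v x)
      = (LINT x|S. b x * complex_of_real (v x))"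
    if v: "v \<in> borel_measurable S" "\<And>x. x \<in> space S \<Longrightarrow> 0 \<le> v x" "\<And>x. x \<in> space S \<Longrightarrow> v x \<le> C" for v
  proof -
    have "integrable S (\<lambda>x. b x * complex_of_real (v x))"
    proof (rule integrable_const_bound[of _ "B * C"])
      show "AE x in S. norm (b x * complex_of_real (v x)) \<le> B * C"
      proof (rule AE_I2)
        fix x assume x: "x \<in> space S"
        have "norm (b x) * v x \<le> B * C"
          using b(2)[OF x] v(2,3)[OF x] norm_ge_zero[of "b x"] by (intro mult_mono) linarith+
        then show "norm (b x * complex_of_real (v x)) \<le> B * C"
          using v(2)[OF x] by (simp add: norm_mult)
      qed
      show "(\<lambda>x. b x * complex_of_real (v x)) \<in> borel_measurable S" using b(1) v(1) by measurable
    qed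
    from integral_Re[OF this] integral_Im[OF this] show ?thesis
      by (simp add: complex_eq_iff)
  qed
  note this[OF W] this[OF w, symmetric]
  ultimately show ?thesis
    by (simp add: distrib_left mult_ac)
qed

subsection \<open>The heat kernel on the closure of the domain\<close>

text \<open>\<open>mixture\<close> sums in \<open>ennreal\<close>, while the integrals are compared
  in the reals. The embedding is continuous and commutes with finite sums of nonnegative
  terms.\<close>

lemma has_sum_ennreal:
  assumes "(f has_sum s) A" "\<And>x. x \<in> A \<Longrightarrow> 0 \<le> f x"
  shows "((\<lambda>x. ennreal (f x)) has_sum ennreal s) A"
proof -
  have "((\<lambda>F. ennreal (sum f F)) \<longlongrightarrow> ennreal s) (finite_subsets_at_top A)"
    using assms(1) by (intro tendsto_ennrealI) (simp add: has_sum_def)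
  moreover have "eventually (\<lambda>F. ennreal (sum f F) = (\<Sum>x\<in>F. ennreal (f x))) (finite_subsets_at_top A)"
    by (rule eventually_finite_subsets_at_top_weakI) (use assms(2) in \<open>auto simp: subset_eq\<close>)
  ultimately show ?thesis
    unfolding has_sum_def by (rule Lim_transform_eventually)
qed

text \<open>The regularity of the boundary enters as \<open>frontier_D\<close>, the form in which it
  permits D and closure D to be exchanged under integrals.\<close>

locale neumann_kernel =
  fixes D :: "(real^'d) set" and T :: real and g :: "real^'d \<Rightarrow> real \<Rightarrow> real^'d \<Rightarrow> real"
  assumes open_D: "open D" and bounded_D: "bounded D" and frontier_D: "negligible (frontier D)"
    and T_pos: "0 < T" and g_props: "heat_kernel_props D T g"
begin

text \<open>The common reference measure: its space is exactly the set on which the kernel is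
  positive, symmetric and bounded, and it is finite because D is bounded.\<close>

definition N :: "(real^'d) measure" where
  "N = restrict_space lborel (closure D)"

lemma space_N [simp]: "space N = closure D"
  by (simp add: N_def space_restrict_space)

lemma in_sets_N: "F \<in> sets N \<longleftrightarrow> F \<in> sets borel \<and> F \<subseteq> closure D"
  unfolding N_def by (subst sets_restrict_space_iff) auto

lemma sets_N: "sets N = sets (restrict_space borel (closure D))"
  unfolding N_def by (rule sets_restrict_space_cong) simp

lemma measurable_N: "measurable N M = measurable (restrict_space borel (closure D)) M"
  by (rule measurable_cong_sets[OF sets_N refl])

sublocale N: finite_measure N
proof
  show "emeasure N (space N) \<noteq> \<infinity>"
    using emeasure_bounded_finite[OF bounded_closure[OF bounded_D]]
    unfolding space_N N_def by (subst emeasure_restrict_space) auto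
qed

sublocale NN: pair_sigma_finite N N ..

sublocale NN: finite_measure "N \<Otimes>\<^sub>M N"
  by (rule finite_measure_pair_measure) unfold_locales

lemma NN_eq: "N \<Otimes>\<^sub>M N = restrict_space (lborel \<Otimes>\<^sub>M lborel) (closure D \<times> closure D)"
  unfolding N_def by (rule pair_restrict_space) (auto intro: lborel.sigma_finite_measure_axioms)

lemma closure_D_borel [measurable]: "closure D \<in> sets borel" "D \<in> sets borel"
  using open_D by auto

lemma measurable_borel_N: "f \<in> borel \<rightarrow>\<^sub>M M \<Longrightarrow> f \<in> N \<rightarrow>\<^sub>M M"
  unfolding N_def by (rule measurable_restrict_space1) simp

lemma measurable_borel_NN: "f \<in> borel \<Otimes>\<^sub>M borel \<rightarrow>\<^sub>M M \<Longrightarrow> f \<in> N \<Otimes>\<^sub>M N \<rightarrow>\<^sub>M M"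
  unfolding NN_eq
  by (rule measurable_restrict_space1) (simp cong: measurable_cong_sets sets_pair_measure_cong)

text \<open>\<open>negligible\<close> refers to the completed Lebesgue measure; the frontier is
  closed, hence Borel, so it is a null set of \<open>lborel\<close> as well.\<close>

lemma AE_frontier: "AE x in lborel. x \<notin> frontier D"
proof (rule AE_not_in)
  have "emeasure lborel (frontier D) = 0"
    using frontier_D null_sets_completion_iff[of "frontier D" lborel]
    by (auto simp: negligible_iff_null_sets)
  then show "frontier D \<in> null_sets lborel" by (simp add: null_sets_def)
qed

lemma closure_cases: "x \<in> closure D \<longleftrightarrow> x \<in> D" if "x \<notin> frontier D"
  using that open_D closure_subset by (auto simp: frontier_def interior_open)

lemma AE_frontier_pair:
  "AE z in lborel \<Otimes>\<^sub>M lborel. z \<in> closure D \<times> closure D \<longleftrightarrow> z \<in> D \<times> D"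
proof -
  have [measurable]: "frontier D \<in> sets borel" by simp
  have 1: "AE z in lborel \<Otimes>\<^sub>M lborel. fst z \<notin> frontier D"
    by (rule lborel_pair.AE_pair_measure) (measurable, use AE_frontier in eventually_elim, simp)
  have 2: "AE z in lborel \<Otimes>\<^sub>M lborel. snd z \<notin> frontier D"
    by (rule lborel_pair.AE_pair_measure) (measurable, simp add: AE_frontier)
  show ?thesis using 1 2
    by eventually_elim (auto simp: closure_cases)
qed

lemma set_integral_D:
  fixes f :: "real^'d \<Rightarrow> 'e::{banach, second_countable_topology}"
  assumes "f \<in> borel_measurable N"
  shows "(LINT x:D|lborel. f x) = (LINT x|N. f x)"
proof -
  have m: "(\<lambda>x. indicator (closure D) x *\<^sub>R f x) \<in> borel_measurable lborel"
    using assms by (simp add: N_def borel_measurable_restrict_space_iff)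
  \<comment> \<open>\<open>f\<close> is only known to be measurable on closure D, so the restriction
    to D is taken of its extension by zero.\<close>
  have "(\<lambda>x. indicator D x *\<^sub>R (indicator (closure D) x *\<^sub>R f x)) \<in> borel_measurable lborel"
    by (rule borel_measurable_scaleR[OF _ m]) simp
  moreover have "(\<lambda>x. indicator D x *\<^sub>R (indicator (closure D) x *\<^sub>R f x)) = (\<lambda>x. indicator D x *\<^sub>R f x)"
    using closure_subset by (fastforce simp: indicator_def)
  ultimately have m': "(\<lambda>x. indicator D x *\<^sub>R f x) \<in> borel_measurable lborel" by simp
  have "(LINT x|N. f x) = (LINT x|lborel. indicator (closure D) x *\<^sub>R f x)"
    unfolding N_def by (rule integral_restrict_space) simp
  also have "\<dots> = (LINT x|lborel. indicator D x *\<^sub>R f x)"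
  proof (rule integral_cong_AE[OF m m'])
    show "AE x in lborel. indicator (closure D) x *\<^sub>R f x = indicator D x *\<^sub>R f x"
      using AE_frontier by eventually_elim (simp add: closure_cases indicator_def)
  qed
  finally show ?thesis by (simp add: set_lebesgue_integral_def)
qed

lemma set_integral_N:
  fixes f :: "real^'d \<Rightarrow> 'e::{banach, second_countable_topology}"
  assumes "F \<in> sets N"
  shows "(LINT x:F|lborel. f x) = (LINT x|N. indicator F x *\<^sub>R f x)"
proof -
  have "F \<subseteq> closure D" using assms by (simp add: in_sets_N)
  then have "indicator (closure D) x *\<^sub>R indicator F x *\<^sub>R f x = indicator F x *\<^sub>R f x" for x
    by (auto simp: indicator_def)
  then show ?thesis
    unfolding N_def set_lebesgue_integral_def by (subst integral_restrict_space) (auto simp del: scaleR_scaleR)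
qed

lemma space_in_sets_N: "closure D \<in> sets N"
  by (simp add: in_sets_N)

text \<open>A nonempty open set is not a null set. Positive mass is what later turns an
  almost-everywhere statement over \<open>N\<close> into the existence of a point.\<close>

lemma emeasure_N_pos:
  assumes "D \<noteq> {}"
  shows "emeasure N (closure D) \<noteq> 0"
proof
  assume "emeasure N (closure D) = 0"
  then have "emeasure lborel (closure D) = 0"
    unfolding N_def by (subst (asm) emeasure_restrict_space) auto
  then have "emeasure lborel D = 0"
    using emeasure_mono[OF closure_subset[of D], of lborel] by simp
  then have "D \<in> null_sets lborel" by (simp add: null_sets_def)
  then have "negligible D"
    unfolding negligible_iff_null_sets by (rule null_sets_completionI)
  then show False using open_not_negligible[OF open_D assms] by simp
qed

lemmas g_props_conj = g_props[unfolded heat_kernel_props_def]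

lemma g_propsD:
  "\<forall>x\<in>closure D. \<forall>y\<in>closure D. \<forall>t\<in>{0<..T}. g x t y = g y t x \<and> 0 < g x t y"
  "\<exists>c1>0. \<exists>c2>0. \<forall>x\<in>closure D. \<forall>y\<in>closure D. \<forall>t\<in>{0<..T}.
     g x t y \<le> c1 * t powr (- real CARD('d) / 2) * exp (- c2 * (norm (x - y))\<^sup>2 / t)"
  "\<forall>x\<in>closure D. \<forall>y\<in>closure D. \<forall>s t. 0 < s \<longrightarrow> 0 < t \<longrightarrow> s + t \<le> T \<longrightarrow>
     g x (s + t) y = (LINT z:D|lborel. g x s z * g z t y)"
  "(\<lambda>(x, t, y). g x t y) \<in> borel_measurable borel"
  by (rule g_props_conj[THEN conjunct1] g_props_conj[THEN conjunct2, THEN conjunct1]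
        g_props_conj[THEN conjunct2, THEN conjunct2, THEN conjunct1]
        g_props_conj[THEN conjunct2, THEN conjunct2, THEN conjunct2])+

lemma g_sym: "g x t y = g y t x"
  and g_pos: "0 < g x t y" if "x \<in> closure D" "y \<in> closure D" "0 < t" "t \<le> T"
  using g_propsD(1)[rule_format, OF that(1,2), of t] that(3,4) by auto

text \<open>For fixed t the exponential factor is at most 1, which leaves the constant c1 t^(-d/2).
  It depends on t but not on the two points.\<close>

lemma g_bound:
  assumes "0 < t" "t \<le> T"
  obtains C where "0 \<le> C" "\<And>x y. x \<in> closure D \<Longrightarrow> y \<in> closure D \<Longrightarrow> g x t y \<le> C"
proof -
  obtain c1 c2 where c12: "0 < c1" "0 < c2" and
    "\<forall>x\<in>closure D. \<forall>y\<in>closure D. \<forall>t\<in>{0<..T}.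
     g x t y \<le> c1 * t powr (- real CARD('d) / 2) * exp (- c2 * (norm (x - y))\<^sup>2 / t)"
    using g_propsD(2) by (elim exE conjE)
  moreover have "t \<in> {0<..T}" using assms by simp
  ultimately have c: "g x t y \<le> c1 * t powr (- real CARD('d) / 2) * exp (- c2 * (norm (x - y))\<^sup>2 / t)"
    if "x \<in> closure D" "y \<in> closure D" for x y using that by blast
  have "c1 * t powr (- real CARD('d) / 2) * exp (- c2 * (norm (x - y))\<^sup>2 / t)
      \<le> c1 * t powr (- real CARD('d) / 2)" for x y :: "real^'d"
    using c12 assms by (intro mult_left_le) auto
  then show ?thesis
    using c12 by (intro that[of "c1 * t powr (- real CARD('d) / 2)"]) (auto intro: order_trans[OF c])
qed

lemma g_measurable [measurable (raw)]:
  assumes "f \<in> borel_measurable M" "h \<in> borel_measurable M" "k \<in> borel_measurable M"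
  shows "(\<lambda>w. g (f w) (h w) (k w)) \<in> borel_measurable M"
proof -
  from measurable_compose[OF _ g_propsD(4), of "\<lambda>w. (f w, h w, k w)"] assms show ?thesis
    by (simp add: borel_prod[symmetric])
qed

lemma N_borel: "f \<in> M \<rightarrow>\<^sub>M N \<Longrightarrow> f \<in> borel_measurable M"
  using measurable_compose[OF _ measurable_borel_N[OF measurable_ident]] by (simp add: comp_def id_def)

lemma g_measurable_N [measurable (raw)]:
  assumes "f \<in> M \<rightarrow>\<^sub>M N" "k \<in> M \<rightarrow>\<^sub>M N"
  shows "(\<lambda>w. g (f w) t (k w)) \<in> borel_measurable M"
  using assms by (intro g_measurable N_borel) auto

lemma chapman_kolmogorov:
  assumes "x \<in> closure D" "y \<in> closure D" "0 < s" "0 < t" "s + t \<le> T"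
  shows "g x (s + t) y = (LINT z|N. g x s z * g z t y)"
proof -
  have "g x (s + t) y = (LINT z:D|lborel. g x s z * g z t y)"
    using g_propsD(3)[rule_format, OF assms] .
  also have "\<dots> = (LINT z|N. g x s z * g z t y)"
    by (rule set_integral_D, rule measurable_borel_N) simp
  finally show ?thesis .
qed

lemma N_integrable:
  fixes f :: "real^'d \<Rightarrow> real"
  assumes "f \<in> borel_measurable N" "\<And>x. x \<in> closure D \<Longrightarrow> \<bar>f x\<bar> \<le> B"
  shows "integrable N f"
  using assms by (intro N.integrable_const_bound[of _ B]) auto

lemma NN_integrable:
  fixes f :: "(real^'d) \<times> (real^'d) \<Rightarrow> real"
  assumes "f \<in> borel_measurable (N \<Otimes>\<^sub>M N)"
    "\<And>x y. x \<in> closure D \<Longrightarrow> y \<in> closure D \<Longrightarrow> \<bar>f (x, y)\<bar> \<le> B"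
  shows "integrable (N \<Otimes>\<^sub>M N) f"
  using assms by (intro NN.integrable_const_bound[of _ B]) (auto simp: space_pair_measure)

section \<open>Iterated kernels of cylinder events\<close>

lemma fd_kernel_measurable:
  assumes "\<And>t F. (t, F) \<in> set l \<Longrightarrow> F \<in> sets borel"
  shows "(\<lambda>z. fd_kernel g T l t0 (fst z) (snd z)) \<in> borel_measurable (borel \<Otimes>\<^sub>M borel)"
  using assms
proof (induction l arbitrary: t0)
  case Nil
  then show ?case by simp
next
  case (Cons a l)
  obtain t F where a: "a = (t, F)" by (cases a)
  have [measurable]: "F \<in> sets borel" using Cons.prems[of t F] a by auto
  have [measurable]: "(\<lambda>z. fd_kernel g T l t (fst z) (snd z)) \<in> borel_measurable (borel \<Otimes>\<^sub>M borel)"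
    using Cons by auto
  have "(\<lambda>w. fd_kernel g T l t (snd w) (snd (fst w))) \<in> borel_measurable ((borel \<Otimes>\<^sub>M borel) \<Otimes>\<^sub>M lborel)"
    using measurable_compose[of "\<lambda>w. (snd w, snd (fst w))" "((borel \<Otimes>\<^sub>M borel) \<Otimes>\<^sub>M lborel)"
        "borel \<Otimes>\<^sub>M borel" "\<lambda>z. fd_kernel g T l t (fst z) (snd z)" borel] by simp
  then show ?case
    unfolding a fd_kernel.simps set_lebesgue_integral_def
    by (intro lborel.borel_measurable_lebesgue_integral)
       (simp add: split_beta', intro borel_measurable_times g_measurable, simp_all)
qed

text \<open>Dropping the constraint to \<open>F\<close> only enlarges the integral, and
  Chapman-Kolmogorov then absorbs one time point per induction step. At \<open>t0 = 0\<close> the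
  bound says that the kernel divided by g(y,T,x), a conditional probability given the endpoints, is
  at most 1.\<close>

lemma fd_kernel_bounds:
  assumes "x \<in> closure D" "y \<in> closure D" "0 \<le> t0"
    "sorted_wrt (<) (t0 # map fst l @ [T])" "\<And>t F. (t, F) \<in> set l \<Longrightarrow> F \<in> sets N"
  shows "0 \<le> fd_kernel g T l t0 x y \<and> fd_kernel g T l t0 x y \<le> g y (T - t0) x"
  using assms
proof (induction l arbitrary: t0 x)
  case Nil
  then show ?case using g_pos[of y x "T - t0"] by simp
next
  case (Cons a l)
  obtain t F where a: "a = (t, F)" by (cases a)
  have F: "F \<in> sets N" using Cons.prems(5)[of t F] a by auto
  have t: "t0 < t" "0 < t" "t < T" "t - t0 \<le> T" "T - t \<le> T" "0 < T - t" using Cons.prems a by auto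
  have l: "(\<And>t F. (t, F) \<in> set l \<Longrightarrow> F \<in> sets N)" using Cons.prems(5) by auto
  have IH: "0 \<le> fd_kernel g T l t z y" "fd_kernel g T l t z y \<le> g y (T - t) z" if "z \<in> closure D" for z
    using Cons.IH[of z t] that Cons.prems a t l by auto
  obtain C1 where C1: "0 \<le> C1" "\<And>x y. x \<in> closure D \<Longrightarrow> y \<in> closure D \<Longrightarrow> g x (t - t0) y \<le> C1"
    using g_bound[of "t - t0"] t by auto
  obtain C2 where C2: "0 \<le> C2" "\<And>x y. x \<in> closure D \<Longrightarrow> y \<in> closure D \<Longrightarrow> g x (T - t) y \<le> C2"
    using g_bound[of "T - t"] t by auto
  have m0: "(\<lambda>z. fd_kernel g T l t z y) \<in> borel_measurable N"
  proof -
    have "(\<lambda>z. fd_kernel g T l t (fst z) (snd z)) \<in> borel_measurable (borel \<Otimes>\<^sub>M borel)"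
      by (rule fd_kernel_measurable) (use l in \<open>auto simp: in_sets_N\<close>)
    from measurable_compose[OF _ this, of "\<lambda>z. (z, y)" borel] show ?thesis
      by (intro measurable_borel_N) simp
  qed
  have [measurable]: "(\<lambda>z. g z (t - t0) x) \<in> borel_measurable N" "(\<lambda>z. g y (T - t) z) \<in> borel_measurable N"
    by (auto intro!: measurable_borel_N)
  note [measurable] = m0 F
  have gp: "0 < g z (t - t0) x" "0 < g y (T - t) z" if "z \<in> closure D" for z
    using g_pos[of z x "t - t0"] g_pos[of y z "T - t"] Cons.prems(1,2) that t by auto
  have le: "indicator F z * (g z (t - t0) x * fd_kernel g T l t z y) \<le> g z (t - t0) x * g y (T - t) z"
      and nn: "0 \<le> indicator F z * (g z (t - t0) x * fd_kernel g T l t z y)"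
    if "z \<in> closure D" for z
    using IH[OF that] gp[OF that] by (auto simp: indicator_def)
  have le': "\<bar>g z (t - t0) x * g y (T - t) z\<bar> \<le> C1 * C2" if "z \<in> closure D" for z
    using gp[OF that] C1(1) C1(2)[OF that Cons.prems(1)] C2(2)[OF Cons.prems(2) that]
    by (simp add: abs_mult mult_mono)
  have i1: "integrable N (\<lambda>z. g z (t - t0) x * g y (T - t) z)"
    by (rule N_integrable[OF _ le']) auto
  have i2: "integrable N (\<lambda>z. indicator F z * (g z (t - t0) x * fd_kernel g T l t z y))"
  proof (rule Bochner_Integration.integrable_bound[OF i1])
    show "AE z in N. norm (indicator F z * (g z (t - t0) x * fd_kernel g T l t z y))
        \<le> norm (g z (t - t0) x * g y (T - t) z)"
    proof (rule AE_I2)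
      fix z assume "z \<in> space N"
      then have "z \<in> closure D" by simp
      from le[OF this] nn[OF this]
      show "norm (indicator F z * (g z (t - t0) x * fd_kernel g T l t z y))
        \<le> norm (g z (t - t0) x * g y (T - t) z)" unfolding real_norm_def by linarith
    qed
  qed measurable
  have eq: "fd_kernel g T (a # l) t0 x y = (LINT z|N. indicator F z * (g z (t - t0) x * fd_kernel g T l t z y))"
    unfolding a fd_kernel.simps by (subst set_integral_N[OF F]) simp
  have "0 \<le> fd_kernel g T (a # l) t0 x y"
    unfolding eq using nn by (intro integral_nonneg_AE AE_I2) auto
  moreover have "fd_kernel g T (a # l) t0 x y \<le> (LINT z|N. g z (t - t0) x * g y (T - t) z)"
    unfolding eq using le by (intro integral_mono[OF i2 i1]) auto
  \<comment> \<open>Symmetry brings the factors into the order in which Chapman-Kolmogorov composes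
    them.\<close>
  moreover have "(LINT z|N. g z (t - t0) x * g y (T - t) z) = (LINT z|N. g x (t - t0) z * g z (T - t) y)"
  proof (rule Bochner_Integration.integral_cong[OF refl])
    fix z assume "z \<in> space N"
    then have z: "z \<in> closure D" by simp
    show "g z (t - t0) x * g y (T - t) z = g x (t - t0) z * g z (T - t) y"
      using g_sym[OF z Cons.prems(1), of "t - t0"] g_sym[OF z Cons.prems(2), of "T - t"] t by simp
  qed
  moreover have "\<dots> = g x (T - t0) y"
    using chapman_kolmogorov[OF Cons.prems(1,2), of "t - t0" "T - t"] Cons.prems(3) t by simp
  moreover have "\<dots> = g y (T - t0) x"
    using g_sym[OF Cons.prems(1,2), of "T - t0"] Cons.prems(3) t by simp
  ultimately show ?case by simp
qed

subsection \<open>Endpoint measures and their mixtures\<close>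

text \<open>The bound is a parameter and not existentially quantified, because a single
  \<open>C\<close> has to serve a whole family of weights.\<close>

definition weight_le :: "real \<Rightarrow> ((real^'d) \<times> (real^'d) \<Rightarrow> real) \<Rightarrow> bool" where
  "weight_le C r \<longleftrightarrow> r \<in> borel_measurable (N \<Otimes>\<^sub>M N) \<and>
     (\<forall>x\<in>closure D. \<forall>y\<in>closure D. 0 \<le> r (x, y) \<and> r (x, y) \<le> C)"

lemma weight_leD:
  assumes "weight_le C r"
  shows weight_measurable: "r \<in> borel_measurable (N \<Otimes>\<^sub>M N)"
    and weight_nonneg: "x \<in> closure D \<Longrightarrow> y \<in> closure D \<Longrightarrow> 0 \<le> r (x, y)"
    and weight_bound: "x \<in> closure D \<Longrightarrow> y \<in> closure D \<Longrightarrow> r (x, y) \<le> C"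
  using assms by (auto simp: weight_le_def)

text \<open>\<open>mu_of\<close> with an arbitrary weight in place of a product: mixing leads out of
  the products but not out of this class.\<close>

definition endpoint_measure :: "((real^'d) \<times> (real^'d) \<Rightarrow> real) \<Rightarrow> ((real^'d) \<times> (real^'d)) measure" where
  "endpoint_measure r = density (lborel \<Otimes>\<^sub>M lborel)
     (\<lambda>z. ennreal (indicator (D \<times> D) z * r z * g (fst z) T (snd z)))"

lemma sets_endpoint [simp]: "sets (endpoint_measure r) = sets (borel \<Otimes>\<^sub>M borel)"
  by (simp add: endpoint_measure_def cong: sets_pair_measure_cong)

lemma weight_g_measurable:
  assumes "weight_le C r"
  shows "(\<lambda>z. r z * g (fst z) T (snd z)) \<in> borel_measurable (N \<Otimes>\<^sub>M N)"
  using weight_measurable[OF assms] by measurable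

lemma id_measurable_NN: "(\<lambda>z. z) \<in> N \<Otimes>\<^sub>M N \<rightarrow>\<^sub>M lborel \<Otimes>\<^sub>M lborel"
  by (rule measurable_borel_NN) (simp cong: measurable_cong_sets sets_pair_measure_cong)

text \<open>The measure lives on the full product space but charges only D \<times> D. Up to a null
  set it is the image, under the inclusion of closure D \<times> closure D, of a measure with
  density with respect to \<open>N \<Otimes>\<^sub>M N\<close>.\<close>

lemma endpoint_measure_eq_distr:
  assumes r: "weight_le C r"
  shows "endpoint_measure r =
    distr (density (N \<Otimes>\<^sub>M N) (\<lambda>z. ennreal (r z * g (fst z) T (snd z)))) (lborel \<Otimes>\<^sub>M lborel) (\<lambda>z. z)"
    (is "_ = ?R")
proof (rule measure_eqI)
  show "sets (endpoint_measure r) = sets ?R" by (simp cong: sets_pair_measure_cong)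
  fix G assume "G \<in> sets (endpoint_measure r)"
  then have G: "G \<in> sets (lborel \<Otimes>\<^sub>M lborel)" by (simp cong: sets_pair_measure_cong)
  define f where "f z = r z * g (fst z) T (snd z)" for z
  have DD: "D \<times> D \<in> sets (lborel \<Otimes>\<^sub>M lborel)" "closure D \<times> closure D \<in> sets (lborel \<Otimes>\<^sub>M lborel)"
    by auto
  have m: "(\<lambda>z. indicator (closure D \<times> closure D) z *\<^sub>R f z) \<in> borel_measurable (lborel \<Otimes>\<^sub>M lborel)"
    using weight_g_measurable[OF r] DD
    unfolding NN_eq f_def[symmetric] by (subst (asm) borel_measurable_restrict_space_iff) auto
  have "(\<lambda>z. indicator (D \<times> D) z *\<^sub>R (indicator (closure D \<times> closure D) z *\<^sub>R f z)) \<in> borel_measurable (lborel \<Otimes>\<^sub>M lborel)"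
    by (rule borel_measurable_scaleR[OF _ m]) (use DD in simp)
  moreover have "(\<lambda>z. indicator (D \<times> D) z *\<^sub>R (indicator (closure D \<times> closure D) z *\<^sub>R f z)) = (\<lambda>z. indicator (D \<times> D) z * f z)"
    using closure_subset by (fastforce simp: indicator_def)
  ultimately have m': "(\<lambda>z. indicator (D \<times> D) z * f z) \<in> borel_measurable (lborel \<Otimes>\<^sub>M lborel)" by simp
  have "emeasure (endpoint_measure r) G = (\<integral>\<^sup>+z. ennreal (indicator (D \<times> D) z * f z) * indicator G z \<partial>(lborel \<Otimes>\<^sub>M lborel))"
    unfolding endpoint_measure_def f_def using G m'
    by (subst emeasure_density) (simp_all add: f_def mult.assoc)
  \<comment> \<open>Here the boundary is added to the domain of integration.\<close>
  also have "\<dots> = (\<integral>\<^sup>+z. ennreal (f z) * indicator G z * indicator (closure D \<times> closure D) z \<partial>(lborel \<Otimes>\<^sub>M lborel))"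
    by (rule nn_integral_cong_AE, use AE_frontier_pair in eventually_elim) (auto simp: indicator_def)
  also have "\<dots> = (\<integral>\<^sup>+z. ennreal (f z) * indicator G z \<partial>(N \<Otimes>\<^sub>M N))"
    unfolding NN_eq by (subst nn_integral_restrict_space) (use DD in auto)
  also have "\<dots> = (\<integral>\<^sup>+z. ennreal (f z) * indicator (G \<inter> space (N \<Otimes>\<^sub>M N)) z \<partial>(N \<Otimes>\<^sub>M N))"
    by (rule nn_integral_cong) (auto simp: indicator_def)
  also have "\<dots> = emeasure ?R G"
    using weight_g_measurable[OF r] measurable_sets[OF id_measurable_NN G] G
    by (subst emeasure_distr) (auto simp: emeasure_density f_def id_measurable_NN)
  finally show "emeasure (endpoint_measure r) G = emeasure ?R G" .
qed

lemma integral_endpoint: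
  fixes f :: "(real^'d) \<times> (real^'d) \<Rightarrow> real"
  assumes r: "weight_le C r" and f: "f \<in> borel_measurable (borel \<Otimes>\<^sub>M borel)"
  shows "(\<integral>z. f z \<partial>endpoint_measure r) = (\<integral>z. f z * (r z * g (fst z) T (snd z)) \<partial>(N \<Otimes>\<^sub>M N))"
proof -
  have f': "f \<in> borel_measurable (lborel \<Otimes>\<^sub>M lborel)"
    using f by (simp cong: measurable_cong_sets sets_pair_measure_cong)
  have "(\<integral>z. f z \<partial>endpoint_measure r) = (\<integral>z. f z \<partial>density (N \<Otimes>\<^sub>M N) (\<lambda>z. ennreal (r z * g (fst z) T (snd z))))"
    unfolding endpoint_measure_eq_distr[OF r]
    by (subst integral_distr) (use f' id_measurable_NN in auto)
  also have "\<dots> = (\<integral>z. (r z * g (fst z) T (snd z)) *\<^sub>R f z \<partial>(N \<Otimes>\<^sub>M N))"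
  proof (rule integral_density)
    show "AE z in N \<Otimes>\<^sub>M N. 0 \<le> r z * g (fst z) T (snd z)"
      using weight_nonneg[OF r] g_pos T_pos
      by (intro AE_I2) (auto simp: space_pair_measure intro!: mult_nonneg_nonneg less_imp_le[OF g_pos])
  qed (use measurable_borel_NN[OF f] weight_g_measurable[OF r] in auto)
  finally show ?thesis by (simp add: mult.commute)
qed

lemma weight_g_bound:
  assumes "weight_le C r"
  obtains B where "\<And>x y. x \<in> closure D \<Longrightarrow> y \<in> closure D \<Longrightarrow> 0 \<le> r (x, y) * g x T y"
    "\<And>x y. x \<in> closure D \<Longrightarrow> y \<in> closure D \<Longrightarrow> r (x, y) * g x T y \<le> B"
proof -
  obtain B where B: "0 \<le> B" "\<And>x y. x \<in> closure D \<Longrightarrow> y \<in> closure D \<Longrightarrow> g x T y \<le> B"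
    using g_bound[of T] T_pos by auto
  have "0 \<le> r (x, y) * g x T y \<and> r (x, y) * g x T y \<le> C * B"
    if "x \<in> closure D" "y \<in> closure D" for x y
  proof -
    have "0 \<le> r (x, y)" "r (x, y) \<le> C" "0 < g x T y" "g x T y \<le> B"
      using weight_nonneg[OF assms that] weight_bound[OF assms that] g_pos[OF that T_pos] B(2)[OF that] by auto
    then show ?thesis by (intro conjI mult_mono mult_nonneg_nonneg) auto
  qed
  then show ?thesis using that by blast
qed

lemma integrable_weight_g:
  assumes r: "weight_le C r" and f: "f \<in> borel_measurable (N \<Otimes>\<^sub>M N)"
    "\<And>x y. x \<in> closure D \<Longrightarrow> y \<in> closure D \<Longrightarrow> \<bar>f (x, y)\<bar> \<le> (B::real)"
  shows "integrable (N \<Otimes>\<^sub>M N) (\<lambda>z. f z * (r z * g (fst z) T (snd z)))"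
proof -
  obtain B' where B': "\<And>x y. x \<in> closure D \<Longrightarrow> y \<in> closure D \<Longrightarrow> 0 \<le> r (x, y) * g x T y"
    "\<And>x y. x \<in> closure D \<Longrightarrow> y \<in> closure D \<Longrightarrow> r (x, y) * g x T y \<le> B'"
    using weight_g_bound[OF r] by auto
  show ?thesis
  proof (rule NN_integrable[of _ "B * B'"])
    show "(\<lambda>z. f z * (r z * g (fst z) T (snd z))) \<in> borel_measurable (N \<Otimes>\<^sub>M N)"
      using f(1) weight_g_measurable[OF r] by measurable
    show "\<bar>f (x, y) * (r (x, y) * g (fst (x, y)) T (snd (x, y)))\<bar> \<le> B * B'"
      if "x \<in> closure D" "y \<in> closure D" for x y
      using f(2)[OF that] B'[OF that] unfolding abs_mult fst_conv snd_conv
      by (intro mult_mono) auto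
  qed
qed

lemma emeasure_endpoint:
  assumes r: "weight_le C r" and G: "G \<in> sets (borel \<Otimes>\<^sub>M borel)"
  shows "emeasure (endpoint_measure r) G
    = ennreal (\<integral>z. indicator G z * (r z * g (fst z) T (snd z)) \<partial>(N \<Otimes>\<^sub>M N))"
proof -
  have m: "(\<lambda>z. indicator G z :: real) \<in> borel_measurable (N \<Otimes>\<^sub>M N)"
    by (rule measurable_borel_NN) (use G in auto)
  have "0 \<le> r z * g (fst z) T (snd z)" if "z \<in> space (N \<Otimes>\<^sub>M N)" for z
  proof -
    obtain B where "\<And>x y. x \<in> closure D \<Longrightarrow> y \<in> closure D \<Longrightarrow> 0 \<le> r (x, y) * g x T y"
      using weight_g_bound[OF r] by blast
    then show ?thesis using that by (auto simp: space_pair_measure)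
  qed
  then have nn: "AE z in N \<Otimes>\<^sub>M N. 0 \<le> indicator G z * (r z * g (fst z) T (snd z))"
    by (intro AE_I2) simp
  have G': "G \<in> sets (lborel \<Otimes>\<^sub>M lborel)" using G by (simp cong: sets_pair_measure_cong)
  have "emeasure (endpoint_measure r) G =
      (\<integral>\<^sup>+z. ennreal (r z * g (fst z) T (snd z)) * indicator (G \<inter> space (N \<Otimes>\<^sub>M N)) z \<partial>(N \<Otimes>\<^sub>M N))"
    unfolding endpoint_measure_eq_distr[OF r]
    using weight_g_measurable[OF r] measurable_sets[OF id_measurable_NN G'] G'
    by (subst emeasure_distr) (auto simp: emeasure_density id_measurable_NN)
  also have "\<dots> = (\<integral>\<^sup>+z. ennreal (indicator G z * (r z * g (fst z) T (snd z))) \<partial>(N \<Otimes>\<^sub>M N))"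
    by (rule nn_integral_cong) (auto simp: indicator_def)
  also have "\<dots> = ennreal (\<integral>z. indicator G z * (r z * g (fst z) T (snd z)) \<partial>(N \<Otimes>\<^sub>M N))"
    by (rule nn_integral_eq_integral[OF integrable_weight_g[OF r m, of 1] nn]) (auto simp: indicator_def)
  finally show ?thesis .
qed

lemma weight_has_sum:
  fixes r :: "'i \<Rightarrow> (real^'d) \<times> (real^'d) \<Rightarrow> real"
  assumes r: "\<And>m. weight_le C (r m)" and p: "\<And>m. 0 \<le> p m" "(p has_sum 1) UNIV"
    and xy: "x \<in> closure D" "y \<in> closure D"
  shows "((\<lambda>m. p m * r m (x, y)) has_sum (\<Sum>\<^sub>\<infinity>m. p m * r m (x, y))) UNIV"
  by (rule convex_combination_has_sum[OF p]) (use weight_nonneg[OF r xy] weight_bound[OF r xy] in auto)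

text \<open>The coefficients sum to one, so the bound \<open>C\<close> survives mixing and a mixture
  falls under the same hypotheses as its components.\<close>

lemma weight_mixture:
  fixes r :: "'i::countable \<Rightarrow> (real^'d) \<times> (real^'d) \<Rightarrow> real"
  assumes r: "\<And>m. weight_le C (r m)" and p: "\<And>m. 0 \<le> p m" "(p has_sum 1) UNIV"
  shows "weight_le C (\<lambda>z. \<Sum>\<^sub>\<infinity>m. p m * r m z)"
  unfolding weight_le_def
proof (intro conjI ballI)
  fix x y assume xy: "x \<in> closure D" "y \<in> closure D"
  show "0 \<le> (\<Sum>\<^sub>\<infinity>m. p m * r m (x, y))"
    using weight_nonneg[OF r xy] p(1) by (intro infsum_nonneg) auto
  show "(\<Sum>\<^sub>\<infinity>m. p m * r m (x, y)) \<le> C"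
    by (rule convex_combination_le[OF p]) (use weight_nonneg[OF r xy] weight_bound[OF r xy] in auto)
next
  show "(\<lambda>z. \<Sum>\<^sub>\<infinity>m. p m * r m z) \<in> borel_measurable (N \<Otimes>\<^sub>M N)"
  proof (rule borel_measurable_infsum_countable)
    show "(\<lambda>z. p m * r m z) \<in> borel_measurable (N \<Otimes>\<^sub>M N)" for m
      using weight_measurable[OF r] by measurable
    fix z assume "z \<in> space (N \<Otimes>\<^sub>M N)"
    then obtain x y where z: "z = (x, y)" "x \<in> closure D" "y \<in> closure D"
      by (auto simp: space_pair_measure)
    show "(\<lambda>m. p m * r m z) summable_on UNIV"
      using weight_has_sum[OF r p z(2,3)] unfolding z(1) by (rule has_sum_imp_summable)
  qed
qed

text \<open>The one linearity statement behind the probabilities of the mixture. It is applied with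
  \<open>k\<close> the kernel of a rectangle of endpoints, of a cylinder event, or of a
  one-dimensional marginal.\<close>

lemma has_sum_integral_mixture:
  fixes r :: "'i::countable \<Rightarrow> (real^'d) \<times> (real^'d) \<Rightarrow> real"
  assumes r: "\<And>m. weight_le C (r m)" and p: "\<And>m. 0 \<le> p m" "(p has_sum 1) UNIV"
    and k: "k \<in> borel_measurable (N \<Otimes>\<^sub>M N)"
      "\<And>x y. x \<in> closure D \<Longrightarrow> y \<in> closure D \<Longrightarrow> 0 \<le> k (x, y)"
      "\<And>x y. x \<in> closure D \<Longrightarrow> y \<in> closure D \<Longrightarrow> k (x, y) \<le> B"
  shows "((\<lambda>m. p m * (\<integral>z. k z * r m z \<partial>(N \<Otimes>\<^sub>M N))) has_sum
     (\<integral>z. k z * (\<Sum>\<^sub>\<infinity>m. p m * r m z) \<partial>(N \<Otimes>\<^sub>M N))) UNIV"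
proof -
  have int: "integrable (N \<Otimes>\<^sub>M N) (\<lambda>z. k z * r' z)" if r': "weight_le C r'" for r'
  proof (rule NN_integrable[of _ "B * C"])
    show "(\<lambda>z. k z * r' z) \<in> borel_measurable (N \<Otimes>\<^sub>M N)"
      using k(1) weight_measurable[OF r'] by measurable
    show "\<bar>k (x, y) * r' (x, y)\<bar> \<le> B * C" if "x \<in> closure D" "y \<in> closure D" for x y
      using k(2,3)[OF that] weight_nonneg[OF r' that] weight_bound[OF r' that]
      unfolding abs_mult by (intro mult_mono) auto
  qed
  have "((\<lambda>m. (\<integral>z. p m * (k z * r m z) \<partial>(N \<Otimes>\<^sub>M N))) has_sum
     (\<integral>z. k z * (\<Sum>\<^sub>\<infinity>m. p m * r m z) \<partial>(N \<Otimes>\<^sub>M N))) UNIV"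
  proof (rule has_sum_integral_nonneg_countable)
    show "integrable (N \<Otimes>\<^sub>M N) (\<lambda>z. p m * (k z * r m z))" for m
      using int[OF r] by simp
    show "integrable (N \<Otimes>\<^sub>M N) (\<lambda>z. k z * (\<Sum>\<^sub>\<infinity>m. p m * r m z))"
      by (rule int[OF weight_mixture[OF r p]])
    fix z assume "z \<in> space (N \<Otimes>\<^sub>M N)"
    then obtain x y where z: "z = (x, y)" "x \<in> closure D" "y \<in> closure D"
      by (auto simp: space_pair_measure)
    show "0 \<le> p m * (k z * r m z)" for m
      using p(1) k(2)[OF z(2,3)] weight_nonneg[OF r z(2,3)] by (simp add: z)
    have "((\<lambda>m. k z * (p m * r m z)) has_sum k z * (\<Sum>\<^sub>\<infinity>m. p m * r m z)) UNIV"
      using weight_has_sum[OF r p z(2,3)] by (intro has_sum_cmult_right) (simp add: z)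
    then show "((\<lambda>m. p m * (k z * r m z)) has_sum k z * (\<Sum>\<^sub>\<infinity>m. p m * r m z)) UNIV"
      by (simp add: mult.left_commute)
  qed
  then show ?thesis by simp
qed

text \<open>\<open>mixture\<close> is given by \<open>measure_of\<close> from a bare set function.
  Identifying this function on the sigma-algebra with \<open>emeasure\<close> of an existing measure
  yields its countable additivity without a separate argument.\<close>

lemma mixture_endpoint:
  fixes r :: "'i::countable \<Rightarrow> (real^'d) \<times> (real^'d) \<Rightarrow> real"
  assumes r: "\<And>m. weight_le C (r m)" and p: "\<And>m. 0 \<le> p m" "(p has_sum 1) UNIV"
  shows "mixture p (\<lambda>m. endpoint_measure (r m)) = endpoint_measure (\<lambda>z. \<Sum>\<^sub>\<infinity>m. p m * r m z)"
    (is "_ = ?E")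
proof -
  have eq: "(\<Sum>\<^sub>\<infinity>m. ennreal (p m) * emeasure (endpoint_measure (r m)) G) = emeasure ?E G"
    if "G \<in> sets (lborel \<Otimes>\<^sub>M lborel)" for G
  proof -
    have G: "G \<in> sets (borel \<Otimes>\<^sub>M borel)" using that by (simp cong: sets_pair_measure_cong)
    obtain B where B: "0 \<le> B" "\<And>x y. x \<in> closure D \<Longrightarrow> y \<in> closure D \<Longrightarrow> g x T y \<le> B"
      using g_bound[of T] T_pos by auto
    have gT: "0 \<le> g x T y" if "x \<in> closure D" "y \<in> closure D" for x y
      using g_pos[OF that T_pos] by simp
    have m: "(\<lambda>z. indicator G z :: real) \<in> borel_measurable (N \<Otimes>\<^sub>M N)"
      by (rule measurable_borel_NN) (use G in auto)
    have "((\<lambda>m. p m * (\<integral>z. indicator G z * g (fst z) T (snd z) * r m z \<partial>(N \<Otimes>\<^sub>M N))) has_sum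
      (\<integral>z. indicator G z * g (fst z) T (snd z) * (\<Sum>\<^sub>\<infinity>m. p m * r m z) \<partial>(N \<Otimes>\<^sub>M N))) UNIV"
    proof (rule has_sum_integral_mixture[OF r p, of _ B])
      show "(\<lambda>z. indicator G z * g (fst z) T (snd z)) \<in> borel_measurable (N \<Otimes>\<^sub>M N)"
        using m by measurable
      fix x y assume "x \<in> closure D" "y \<in> closure D"
      from B(1) B(2)[OF this] gT[OF this]
      show "0 \<le> indicator G (x, y) * g (fst (x, y)) T (snd (x, y))"
        "indicator G (x, y) * g (fst (x, y)) T (snd (x, y)) \<le> B"
        by (auto simp: indicator_def)
    qed
    then have "((\<lambda>m. ennreal (p m * (\<integral>z. indicator G z * g (fst z) T (snd z) * r m z \<partial>(N \<Otimes>\<^sub>M N)))) has_sum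
      ennreal (\<integral>z. indicator G z * g (fst z) T (snd z) * (\<Sum>\<^sub>\<infinity>m. p m * r m z) \<partial>(N \<Otimes>\<^sub>M N))) UNIV"
    proof (rule has_sum_ennreal)
      fix m
      have "0 \<le> (\<integral>z. indicator G z * g (fst z) T (snd z) * r m z \<partial>(N \<Otimes>\<^sub>M N))"
        by (intro integral_nonneg_AE AE_I2)
           (use weight_nonneg[OF r] gT in \<open>auto simp: space_pair_measure\<close>)
      then show "0 \<le> p m * (\<integral>z. indicator G z * g (fst z) T (snd z) * r m z \<partial>(N \<Otimes>\<^sub>M N))"
        using p(1) by simp
    qed
    then show ?thesis
      unfolding emeasure_endpoint[OF r G] emeasure_endpoint[OF weight_mixture[OF r p] G]
      using p(1) by (intro infsumI) (simp add: ennreal_mult' mult_ac)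
  qed
  have sp: "UNIV = space ?E" "sets (lborel \<Otimes>\<^sub>M lborel) = sets ?E"
    by (simp_all add: endpoint_measure_def space_pair_measure)
  \<comment> \<open>\<open>measure_of\<close> depends only on the values on the generated
    sigma-algebra, where the two set functions agree by \<open>eq\<close>.\<close>
  have "mixture p (\<lambda>m. endpoint_measure (r m)) = measure_of UNIV (sets (lborel \<Otimes>\<^sub>M lborel)) (emeasure ?E)"
    unfolding mixture_def
  proof (rule measure_of_eq)
    fix G :: "((real^'d) \<times> (real^'d)) set" assume "G \<in> sigma_sets UNIV (sets (lborel \<Otimes>\<^sub>M lborel))"
    then have "G \<in> sets (lborel \<Otimes>\<^sub>M lborel)"
      unfolding sp(1) sp(2) by (simp only: sets.sigma_sets_eq)
    then show "(\<Sum>\<^sub>\<infinity>m. ennreal (p m) * emeasure (endpoint_measure (r m)) G) = emeasure ?E G" by (rule eq)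
  qed simp
  also have "\<dots> = ?E" unfolding sp(1) sp(2) by (rule measure_of_of_measure)
  finally show ?thesis .
qed

subsection \<open>One-dimensional marginals\<close>

text \<open>At the two end times the formula for the finite-dimensional distributions does not apply,
  and the marginal has to be read off the endpoint measure instead.\<close>
definition marginal_kernel :: "real \<Rightarrow> (real^'d) set \<Rightarrow> (real^'d) \<times> (real^'d) \<Rightarrow> real" where
  "marginal_kernel t F z =
     (if t = 0 then indicator F (fst z) * g (fst z) T (snd z)
      else if t = T then indicator F (snd z) * g (fst z) T (snd z)
      else fd_kernel g T [(t, F)] 0 (fst z) (snd z))"

lemma marginal_kernel_measurable:
  assumes F: "F \<in> sets N"
  shows "marginal_kernel t F \<in> borel_measurable (N \<Otimes>\<^sub>M N)"
proof -
  have "(\<lambda>z. fd_kernel g T [(t, F)] 0 (fst z) (snd z)) \<in> borel_measurable (N \<Otimes>\<^sub>M N)"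
    by (rule measurable_borel_NN[OF fd_kernel_measurable]) (use F in \<open>auto simp: in_sets_N\<close>)
  then show ?thesis
    unfolding marginal_kernel_def[abs_def] using F by (cases "t = 0"; cases "t = T") auto
qed

lemma marginal_kernel_bounds:
  assumes F: "F \<in> sets N" and t: "t \<in> {0..T}" and xy: "x \<in> closure D" "y \<in> closure D"
  shows "0 \<le> marginal_kernel t F (x, y)" "marginal_kernel t F (x, y) \<le> g x T y"
proof -
  have g: "0 < g x T y" "g y T x = g x T y"
    using g_pos[OF xy T_pos] g_sym[OF xy T_pos] by auto
  have "0 \<le> marginal_kernel t F (x, y) \<and> marginal_kernel t F (x, y) \<le> g x T y"
  proof (cases "t = 0 \<or> t = T")
    case True
    then show ?thesis using g by (auto simp: marginal_kernel_def indicator_def)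
  next
    case False
    with t have "0 < t" "t < T" by auto
    with False show ?thesis
      using fd_kernel_bounds[OF xy, of 0 "[(t, F)]"] F g
      by (simp add: marginal_kernel_def del: fd_kernel.simps)
  qed
  then show "0 \<le> marginal_kernel t F (x, y)" "marginal_kernel t F (x, y) \<le> g x T y" by auto
qed

section \<open>The functions u and v, related by reversal of time\<close>

lemma v_fun_eq_u_fun: "v_fun D T g \<psi> x t = u_fun D g \<psi> x (T - t)"
  by (simp add: v_fun_def u_fun_def)

lemma u_fun_N:
  assumes "\<phi> \<in> borel_measurable N" "0 < t"
  shows "u_fun D g \<phi> x t = (LINT y|N. g x t y * \<phi> y)"
proof -
  have "(\<lambda>y. g x t y) \<in> borel_measurable N" by (rule measurable_borel_N) simp
  with assms show ?thesis
    unfolding u_fun_def by (subst set_integral_D) auto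
qed

lemma u_fun_measurable:
  assumes [measurable]: "\<phi> \<in> borel_measurable N" and t: "0 \<le> t"
  shows "(\<lambda>x. u_fun D g \<phi> x t) \<in> borel_measurable N"
proof (cases "t = 0")
  case True
  then show ?thesis using assms by (simp add: u_fun_def)
next
  case False
  with t have "u_fun D g \<phi> x t = (LINT y|N. g x t y * \<phi> y)" for x
    using u_fun_N assms(1) by simp
  then show ?thesis by simp
qed

text \<open>The constant is chosen before \<phi> and depends only on \<open>t\<close> and
  \<open>B\<close>, so a single constant bounds u for all indices of the mixture.\<close>

lemma u_fun_bounded:
  assumes t: "t \<in> {0..T}"
  obtains C where "\<And>\<phi> x. \<phi> \<in> borel_measurable N \<Longrightarrow> (\<And>x. x \<in> closure D \<Longrightarrow> 0 \<le> \<phi> x \<and> \<phi> x \<le> B) \<Longrightarrow>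
     x \<in> closure D \<Longrightarrow> 0 \<le> u_fun D g \<phi> x t \<and> u_fun D g \<phi> x t \<le> C"
proof (cases "t = 0")
  case True
  then show ?thesis using that[of B] by (auto simp: u_fun_def)
next
  case False
  with t have t': "0 < t" "t \<le> T" by auto
  obtain Cg where Cg: "0 \<le> Cg" "\<And>x y. x \<in> closure D \<Longrightarrow> y \<in> closure D \<Longrightarrow> g x t y \<le> Cg"
    using g_bound[OF t'] by auto
  show ?thesis
  proof (rule that[of "Cg * B * measure N (closure D)"])
    fix \<phi> :: "real^'d \<Rightarrow> real" and x :: "real^'d"
    assume \<phi>[measurable]: "\<phi> \<in> borel_measurable N" and b: "\<And>x. x \<in> closure D \<Longrightarrow> 0 \<le> \<phi> x \<and> \<phi> x \<le> B"
      and x: "x \<in> closure D"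
    have [measurable]: "(\<lambda>y. g x t y) \<in> borel_measurable N" by (rule measurable_borel_N) simp
    have h: "0 \<le> g x t y * \<phi> y \<and> g x t y * \<phi> y \<le> Cg * B" if "y \<in> closure D" for y
      using g_pos[OF x that t'] Cg(2)[OF x that] b[OF that] by (auto intro!: mult_mono)
    have i: "integrable N (\<lambda>y. g x t y * \<phi> y)"
      by (rule N_integrable[of _ "Cg * B"]) (use h in auto)
    have "(LINT y|N. g x t y * \<phi> y) \<le> (LINT y|N. Cg * B)"
      by (rule integral_mono[OF i]) (use h in auto)
    moreover have "0 \<le> (LINT y|N. g x t y * \<phi> y)"
      by (intro integral_nonneg_AE AE_I2) (use h in auto)
    ultimately show "0 \<le> u_fun D g \<phi> x t \<and> u_fun D g \<phi> x t \<le> Cg * B * measure N (closure D)"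
      by (simp add: u_fun_N[OF \<phi> t'(1)] mult_ac)
  qed
qed

text \<open>Once the intermediate point w is fixed, a product weight separates the two endpoints:
  the integral over x gives u(w,t) and the integral over y gives v(w,t). Fubini is used to make w
  the outermost variable. At an end time w coincides with one of the endpoints and a single
  integration remains.\<close>

lemma integral_marginal_kernel_product:
  assumes F: "F \<in> sets N" and t: "t \<in> {0..T}"
    and \<phi>: "\<phi> \<in> borel_measurable N" "\<And>x. x \<in> closure D \<Longrightarrow> 0 \<le> \<phi> x \<and> \<phi> x \<le> B"
    and \<psi>: "\<psi> \<in> borel_measurable N" "\<And>x. x \<in> closure D \<Longrightarrow> 0 \<le> \<psi> x \<and> \<psi> x \<le> B'"
  shows "(\<integral>z. marginal_kernel t F z * (\<phi> (fst z) * \<psi> (snd z)) \<partial>(N \<Otimes>\<^sub>M N))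
     = (LINT x:F|lborel. u_fun D g \<phi> x t * v_fun D T g \<psi> x t)"
proof -
  note [measurable] = F \<phi>(1) \<psi>(1)
  obtain C where C: "0 \<le> C" "\<And>x y. x \<in> closure D \<Longrightarrow> y \<in> closure D \<Longrightarrow> g x T y \<le> C"
    using g_bound[of T] T_pos by auto
  have rhs: "(LINT x:F|lborel. u_fun D g \<phi> x t * v_fun D T g \<psi> x t)
     = (LINT x|N. indicator F x * (u_fun D g \<phi> x t * u_fun D g \<psi> x (T - t)))"
    by (subst set_integral_N[OF F]) (simp add: v_fun_eq_u_fun)
  \<comment> \<open>The factor \<open>c\<close> stands for the indicator of \<open>F\<close> in the
    first coordinate at time 0 and in the second at time T.\<close>
  have endpoint: "integrable (N \<Otimes>\<^sub>M N) (\<lambda>(x, y). c x y * (\<phi> x * g x T y * \<psi> y))"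
    if "(\<lambda>z. c (fst z) (snd z)) \<in> borel_measurable (N \<Otimes>\<^sub>M N)" "\<And>x y. \<bar>c x y\<bar> \<le> 1" for c :: "real^'d \<Rightarrow> real^'d \<Rightarrow> real"
  proof (rule NN_integrable[of _ "1 * (B * C * B')"])
    show "(\<lambda>(x, y). c x y * (\<phi> x * g x T y * \<psi> y)) \<in> borel_measurable (N \<Otimes>\<^sub>M N)"
      using that(1) unfolding split_beta' by measurable
    fix x y assume xy: "x \<in> closure D" "y \<in> closure D"
    have "\<bar>c x y * (\<phi> x * g x T y * \<psi> y)\<bar> \<le> 1 * (B * C * B')"
      unfolding abs_mult
      using that(2)[of x y] \<phi>(2)[OF xy(1)] \<psi>(2)[OF xy(2)] g_pos[OF xy T_pos] C(2)[OF xy] C(1)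
      by (intro mult_mono mult_nonneg_nonneg) auto
    then show "\<bar>case (x, y) of (x, y) \<Rightarrow> c x y * (\<phi> x * g x T y * \<psi> y)\<bar> \<le> 1 * (B * C * B')" by simp
  qed
  consider "t = 0" | "t = T" | "0 < t" "t < T" using t by force
  then show ?thesis
  proof cases
    case 1
    have "(\<integral>z. marginal_kernel t F z * (\<phi> (fst z) * \<psi> (snd z)) \<partial>(N \<Otimes>\<^sub>M N))
      = (\<integral>(x, y). indicator F x * (\<phi> x * g x T y * \<psi> y) \<partial>(N \<Otimes>\<^sub>M N))"
      by (rule Bochner_Integration.integral_cong) (auto simp: marginal_kernel_def 1)
    also have "\<dots> = (LINT x|N. LINT y|N. indicator F x * (\<phi> x * g x T y * \<psi> y))"
      by (rule NN.integral_fst'[symmetric, OF endpoint, simplified]) (auto simp: indicator_def)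
    also have "\<dots> = (LINT x|N. indicator F x * (\<phi> x * (LINT y|N. g x T y * \<psi> y)))"
      by (simp add: mult.assoc)
    also have "\<dots> = (LINT x|N. indicator F x * (u_fun D g \<phi> x t * u_fun D g \<psi> x (T - t)))"
      using 1 T_pos u_fun_N[OF \<psi>(1), of T] by (simp add: u_fun_def[of D g \<phi>])
    finally show ?thesis unfolding rhs .
  next
    case 2
    have "(\<integral>z. marginal_kernel t F z * (\<phi> (fst z) * \<psi> (snd z)) \<partial>(N \<Otimes>\<^sub>M N))
      = (\<integral>(x, y). indicator F y * (\<phi> x * g x T y * \<psi> y) \<partial>(N \<Otimes>\<^sub>M N))"
      using T_pos by (intro Bochner_Integration.integral_cong) (auto simp: marginal_kernel_def 2)
    also have "\<dots> = (LINT y|N. LINT x|N. indicator F y * (\<phi> x * g x T y * \<psi> y))"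
      by (rule NN.integral_snd[symmetric, OF endpoint, simplified]) (auto simp: indicator_def)
    \<comment> \<open>Symmetry is needed since u integrates over the last argument of the
      kernel.\<close>
    also have "\<dots> = (LINT y|N. LINT x|N. (indicator F y * \<psi> y) * (g y T x * \<phi> x))"
    proof (intro Bochner_Integration.integral_cong refl)
      fix x y assume "x \<in> space N" "y \<in> space N"
      then have "g x T y = g y T x" using g_sym[of x y T] T_pos by simp
      then show "indicator F y * (\<phi> x * g x T y * \<psi> y) = (indicator F y * \<psi> y) * (g y T x * \<phi> x)"
        by (simp add: mult_ac)
    qed
    also have "\<dots> = (LINT y|N. (indicator F y * \<psi> y) * (LINT x|N. g y T x * \<phi> x))"
      by simp
    also have "\<dots> = (LINT x|N. indicator F x * (u_fun D g \<phi> x t * u_fun D g \<psi> x (T - t)))"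
      using 2 T_pos u_fun_N[OF \<phi>(1), of T] by (simp add: u_fun_def[of D g \<psi>] mult_ac)
    finally show ?thesis unfolding rhs .
  next
    case 3
    then have t': "0 < T - t" "t \<le> T" "T - t \<le> T" by auto
    obtain C1 where C1: "0 \<le> C1" "\<And>x y. x \<in> closure D \<Longrightarrow> y \<in> closure D \<Longrightarrow> g x t y \<le> C1"
      using g_bound[of t] 3 by auto
    obtain C2 where C2: "0 \<le> C2" "\<And>x y. x \<in> closure D \<Longrightarrow> y \<in> closure D \<Longrightarrow> g x (T - t) y \<le> C2"
      using g_bound[of "T - t"] t' by auto
    define H where "H z w = indicator F w * ((g w t (fst z) * \<phi> (fst z)) * (g w (T - t) (snd z) * \<psi> (snd z)))" for z w
    have Hb: "\<bar>H (x, y) w\<bar> \<le> 1 * ((C1 * B) * (C2 * B'))"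
      if "x \<in> closure D" "y \<in> closure D" "w \<in> closure D" for x y w
      unfolding H_def abs_mult fst_conv snd_conv
      using C1(1) C1(2)[OF that(3,1)] C2(1) C2(2)[OF that(3,2)] \<phi>(2)[OF that(1)] \<psi>(2)[OF that(2)]
        g_pos[OF that(3,1) 3(1) t'(2)] g_pos[OF that(3,2) t'(1,3)]
      by (intro mult_mono mult_nonneg_nonneg) (auto simp: indicator_def)
    have Hm [measurable]: "(\<lambda>p. H (fst p) (snd p)) \<in> borel_measurable ((N \<Otimes>\<^sub>M N) \<Otimes>\<^sub>M N)"
      unfolding H_def by measurable
    interpret NNN: pair_sigma_finite "N \<Otimes>\<^sub>M N" N ..
    interpret NNNf: finite_measure "(N \<Otimes>\<^sub>M N) \<Otimes>\<^sub>M N"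
      by (rule finite_measure_pair_measure) unfold_locales
    have Hi: "integrable ((N \<Otimes>\<^sub>M N) \<Otimes>\<^sub>M N) (case_prod H)"
      by (rule NNNf.integrable_const_bound[of _ "1 * ((C1 * B) * (C2 * B'))"])
         (use Hb Hm in \<open>auto simp: space_pair_measure split_beta'\<close>)
    have "(\<integral>z. marginal_kernel t F z * (\<phi> (fst z) * \<psi> (snd z)) \<partial>(N \<Otimes>\<^sub>M N))
      = (\<integral>z. (LINT w|N. H z w) \<partial>(N \<Otimes>\<^sub>M N))"
    proof (rule Bochner_Integration.integral_cong[OF refl])
      fix z assume "z \<in> space (N \<Otimes>\<^sub>M N)"
      then obtain x y where z: "z = (x, y)" "x \<in> closure D" "y \<in> closure D"
        by (auto simp: space_pair_measure)
      have "marginal_kernel t F z * (\<phi> (fst z) * \<psi> (snd z))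
        = (LINT w|N. (indicator F w * (g w t x * g y (T - t) w)) * (\<phi> x * \<psi> y))"
        using 3 by (simp add: marginal_kernel_def z set_integral_N[OF F])
      also have "\<dots> = (LINT w|N. H z w)"
      proof (rule Bochner_Integration.integral_cong[OF refl])
        fix w assume "w \<in> space N"
        then have "g y (T - t) w = g w (T - t) y" using g_sym[of y w "T - t"] t' z by simp
        then show "(indicator F w * (g w t x * g y (T - t) w)) * (\<phi> x * \<psi> y) = H z w"
          by (simp add: H_def z mult_ac)
      qed
      finally show "marginal_kernel t F z * (\<phi> (fst z) * \<psi> (snd z)) = (LINT w|N. H z w)" .
    qed
    \<comment> \<open>Fubini on the triple product, where \<open>H\<close> is bounded and the
      measure finite.\<close>
    also have "\<dots> = (LINT w|N. \<integral>z. H z w \<partial>(N \<Otimes>\<^sub>M N))"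
      by (rule NNN.Fubini_integral[symmetric, OF Hi])
    also have "\<dots> = (LINT w|N. indicator F w * (u_fun D g \<phi> w t * u_fun D g \<psi> w (T - t)))"
    proof (rule Bochner_Integration.integral_cong[OF refl])
      fix w assume "w \<in> space N"
      then have w: "w \<in> closure D" by simp
      have "integrable (N \<Otimes>\<^sub>M N) (\<lambda>z. H z w)"
      proof (rule NN_integrable[of _ "1 * ((C1 * B) * (C2 * B'))"])
        show "(\<lambda>z. H z w) \<in> borel_measurable (N \<Otimes>\<^sub>M N)"
          using measurable_compose[OF _ Hm, of "\<lambda>z. (z, w)"] w by auto
      qed (use Hb w in auto)
      from NN.integral_fst'[OF this]
      have "(\<integral>z. H z w \<partial>(N \<Otimes>\<^sub>M N)) = (LINT x|N. LINT y|N. H (x, y) w)" by simp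
      also have "\<dots> = indicator F w * (u_fun D g \<phi> w t * u_fun D g \<psi> w (T - t))"
        unfolding u_fun_N[OF \<phi>(1) 3(1)] u_fun_N[OF \<psi>(1) t'(1)] H_def by simp
      finally show "(\<integral>z. H z w \<partial>(N \<Otimes>\<^sub>M N)) = indicator F w * (u_fun D g \<phi> w t * u_fun D g \<psi> w (T - t))" .
    qed
    finally show ?thesis unfolding rhs .
  qed
qed

end

subsection \<open>Processes generated by an endpoint measure\<close>

text \<open>The weight \<open>r\<close> stands for \<open>\<phi> \<otimes> \<psi>\<close> or for a mixture of such products; it is the endpoint
  density relative to \<open>g x T y\<close>.\<close>
locale generated_process = neumann_kernel D T g
  for D :: "(real^'d) set" and T :: real and g :: "real^'d \<Rightarrow> real \<Rightarrow> real^'d \<Rightarrow> real" +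
  fixes M :: "'w measure" and Z :: "real \<Rightarrow> 'w \<Rightarrow> real^'d"
    and r :: "(real^'d) \<times> (real^'d) \<Rightarrow> real" and C :: real
  assumes weight: "weight_le C r"
    and generated: "bernstein_generated M Z T D g (endpoint_measure r)"
begin

lemma bernstein: "bernstein_process M Z T D"
  using generated unfolding bernstein_generated_def by (rule conjunct1)

sublocale prob_space M
  using bernstein unfolding bernstein_process_def by (rule conjunct1)

lemma Z_closure: "\<omega> \<in> space M \<Longrightarrow> t \<in> {0..T} \<Longrightarrow> Z t \<omega> \<in> closure D"
  using bernstein unfolding bernstein_process_def by blast

lemma Z_borel: "t \<in> {0..T} \<Longrightarrow> Z t \<in> borel_measurable M"
  using bernstein unfolding bernstein_process_def by blast

lemma Z_measurable: "t \<in> {0..T} \<Longrightarrow> Z t \<in> M \<rightarrow>\<^sub>M N"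
  unfolding N_def using Z_closure Z_borel by (intro measurable_restrict_space2) auto

lemma Z_Pair_measurable: "s \<in> {0..T} \<Longrightarrow> t \<in> {0..T} \<Longrightarrow> (\<lambda>\<omega>. (Z s \<omega>, Z t \<omega>)) \<in> M \<rightarrow>\<^sub>M N \<Otimes>\<^sub>M N"
  using Z_measurable by (intro measurable_Pair) auto

lemmas generated_conj = generated[unfolded bernstein_generated_def]

text \<open>The denominator g(x,T,y) of the finite-dimensional formula cancels against the same
  factor in the endpoint density, leaving an expression linear in \<open>r\<close> with a bounded
  kernel.\<close>

lemma prob_fd:
  assumes "length ts = length Fs" "ts \<noteq> []" "sorted_wrt (<) ts" "0 < hd ts" "last ts < T"
    and Fs: "\<And>F. F \<in> set Fs \<Longrightarrow> F \<in> sets N"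
  shows "measure M {\<omega> \<in> space M. \<forall>k<length ts. Z (ts ! k) \<omega> \<in> Fs ! k}
    = (\<integral>z. fd_kernel g T (zip ts Fs) 0 (fst z) (snd z) * r z \<partial>(N \<Otimes>\<^sub>M N))"
proof -
  have "\<forall>F\<in>set Fs. F \<in> sets borel \<and> F \<subseteq> closure D" using Fs by (auto simp: in_sets_N)
  with assms have "measure M {\<omega> \<in> space M. \<forall>k<length ts. Z (ts ! k) \<omega> \<in> Fs ! k}
    = (\<integral>(x, y). fd_kernel g T (zip ts Fs) 0 x y / g x T y \<partial>endpoint_measure r)"
    using generated_conj[THEN conjunct2, THEN conjunct2, THEN conjunct2, rule_format, of ts Fs] by blast
  also have "\<dots> = (\<integral>z. fd_kernel g T (zip ts Fs) 0 (fst z) (snd z) / g (fst z) T (snd z) \<partial>endpoint_measure r)"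
    by (simp add: split_beta')
  also have "\<dots> = (\<integral>z. fd_kernel g T (zip ts Fs) 0 (fst z) (snd z) / g (fst z) T (snd z) * (r z * g (fst z) T (snd z)) \<partial>(N \<Otimes>\<^sub>M N))"
  proof (rule integral_endpoint[OF weight])
    have [measurable]: "(\<lambda>z. fd_kernel g T (zip ts Fs) 0 (fst z) (snd z)) \<in> borel_measurable (borel \<Otimes>\<^sub>M borel)"
      by (rule fd_kernel_measurable) (use Fs in \<open>auto dest!: set_zip_rightD simp: in_sets_N\<close>)
    show "(\<lambda>z. fd_kernel g T (zip ts Fs) 0 (fst z) (snd z) / g (fst z) T (snd z)) \<in> borel_measurable (borel \<Otimes>\<^sub>M borel)"
      by measurable
  qed
  also have "\<dots> = (\<integral>z. fd_kernel g T (zip ts Fs) 0 (fst z) (snd z) * r z \<partial>(N \<Otimes>\<^sub>M N))"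
  proof (rule Bochner_Integration.integral_cong[OF refl])
    fix z assume "z \<in> space (N \<Otimes>\<^sub>M N)"
    then have "g (fst z) T (snd z) > 0"
      using g_pos T_pos by (auto simp: space_pair_measure)
    then show "fd_kernel g T (zip ts Fs) 0 (fst z) (snd z) / g (fst z) T (snd z) * (r z * g (fst z) T (snd z))
      = fd_kernel g T (zip ts Fs) 0 (fst z) (snd z) * r z" by simp
  qed
  finally show ?thesis .
qed

lemma prob_endpoints:
  assumes A: "A \<in> sets N" and B: "B \<in> sets N"
  shows "measure M {\<omega> \<in> space M. Z 0 \<omega> \<in> A \<and> Z T \<omega> \<in> B}
    = (\<integral>z. indicator (A \<times> B) z * (r z * g (fst z) T (snd z)) \<partial>(N \<Otimes>\<^sub>M N))"
proof -
  have AB: "A \<in> sets borel" "A \<subseteq> closure D" "B \<in> sets borel" "B \<subseteq> closure D"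
    using A B by (auto simp: in_sets_N)
  have "measure M {\<omega> \<in> space M. Z 0 \<omega> \<in> A \<and> Z T \<omega> \<in> B} = measure (endpoint_measure r) (A \<times> B)"
    using generated_conj[THEN conjunct2, THEN conjunct1] AB by blast
  also have "\<dots> = enn2real (ennreal (\<integral>z. indicator (A \<times> B) z * (r z * g (fst z) T (snd z)) \<partial>(N \<Otimes>\<^sub>M N)))"
    unfolding measure_def by (subst emeasure_endpoint[OF weight]) (use AB in auto)
  also have "\<dots> = (\<integral>z. indicator (A \<times> B) z * (r z * g (fst z) T (snd z)) \<partial>(N \<Otimes>\<^sub>M N))"
  proof (intro enn2real_ennreal integral_nonneg_AE AE_I2)
    fix z assume "z \<in> space (N \<Otimes>\<^sub>M N)"
    then show "0 \<le> indicator (A \<times> B) z * (r z * g (fst z) T (snd z))"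
      using weight_nonneg[OF weight] less_imp_le[OF g_pos[OF _ _ T_pos order_refl]]
      by (auto simp: space_pair_measure)
  qed
  finally show ?thesis .
qed

text \<open>At an end time the other endpoint is left unconstrained by asking it to lie in closure
  D, which it always does.\<close>

lemma prob_marginal:
  assumes F: "F \<in> sets N" and t: "t \<in> {0..T}"
  shows "measure M {\<omega> \<in> space M. Z t \<omega> \<in> F} = (\<integral>z. marginal_kernel t F z * r z \<partial>(N \<Otimes>\<^sub>M N))"
proof -
  consider "t = 0" | "t = T" | "0 < t" "t < T" using t by force
  then show ?thesis
  proof cases
    case 1
    have "{\<omega> \<in> space M. Z t \<omega> \<in> F} = {\<omega> \<in> space M. Z 0 \<omega> \<in> F \<and> Z T \<omega> \<in> closure D}"
      using Z_closure[of _ T] T_pos 1 by auto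
    then show ?thesis
      by (simp only:, subst prob_endpoints[OF F space_in_sets_N])
         (intro Bochner_Integration.integral_cong,
          auto simp: marginal_kernel_def 1 space_pair_measure indicator_def)
  next
    case 2
    have "{\<omega> \<in> space M. Z t \<omega> \<in> F} = {\<omega> \<in> space M. Z 0 \<omega> \<in> closure D \<and> Z T \<omega> \<in> F}"
      using Z_closure[of _ 0] T_pos 2 by auto
    then show ?thesis
      by (simp only:, subst prob_endpoints[OF space_in_sets_N F])
         (intro Bochner_Integration.integral_cong,
          use T_pos in \<open>auto simp: marginal_kernel_def 2 space_pair_measure indicator_def\<close>)
  next
    case 3
    then show ?thesis
      using prob_fd[of "[t]" "[F]"] F by (simp add: marginal_kernel_def del: fd_kernel.simps)
  qed
qed

text \<open>The density \<open>w\<close> is a parameter: for a component it will be the product of u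
  and v, for the mixture a convex combination of such products. Knowing the law on all sets of
  \<open>N\<close> identifies the image measure, after which the expectation is a change of
  variables.\<close>

lemma expectation_marginal:
  fixes b :: "real^'d \<Rightarrow> complex"
  assumes t: "t \<in> {0..T}"
    and w: "w \<in> borel_measurable N" "\<And>x. x \<in> closure D \<Longrightarrow> 0 \<le> w x" "\<And>x. x \<in> closure D \<Longrightarrow> w x \<le> B"
    and law: "\<And>F. F \<in> sets N \<Longrightarrow> measure M {\<omega> \<in> space M. Z t \<omega> \<in> F} = (LINT x|N. indicator F x * w x)"
    and b: "b \<in> borel_measurable N"
  shows "(LINT \<omega>|M. b (Z t \<omega>)) = (LINT x|N. b x * complex_of_real (w x))"
proof -
  have "distr M N (Z t) = density N (\<lambda>x. ennreal (w x))"
  proof (rule measure_eqI)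
    fix F assume "F \<in> sets (distr M N (Z t))"
    then have F: "F \<in> sets N" by simp
    have i: "integrable N (\<lambda>x. indicator F x * w x)"
      by (rule N_integrable[of _ "\<bar>B\<bar>"]) (use F w in \<open>auto simp: indicator_def intro: order_trans[OF _ abs_ge_self]\<close>)
    have "emeasure (distr M N (Z t)) F = emeasure M {\<omega> \<in> space M. Z t \<omega> \<in> F}"
      by (subst emeasure_distr) (use Z_measurable[OF t] F in \<open>auto simp: vimage_def Int_def conj_commute\<close>)
    also have "\<dots> = ennreal (LINT x|N. indicator F x * w x)"
      by (simp add: emeasure_eq_measure law[OF F])
    also have "\<dots> = (\<integral>\<^sup>+x. ennreal (indicator F x * w x) \<partial>N)"
      by (rule nn_integral_eq_integral[symmetric, OF i]) (use w in auto)
    also have "\<dots> = (\<integral>\<^sup>+x. ennreal (w x) * indicator F x \<partial>N)"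
      by (intro nn_integral_cong) (auto simp: indicator_def)
    also have "\<dots> = emeasure (density N (\<lambda>x. ennreal (w x))) F"
      by (subst emeasure_density) (use F w in auto)
    finally show "emeasure (distr M N (Z t)) F = emeasure (density N (\<lambda>x. ennreal (w x))) F" .
  qed simp
  then have "(LINT \<omega>|M. b (Z t \<omega>)) = (LINT x|density N (\<lambda>x. ennreal (w x)). b x)"
    using integral_distr[OF Z_measurable[OF t] b] by simp
  also have "\<dots> = (LINT x|N. w x *\<^sub>R b x)"
    by (rule integral_density) (use b w in auto)
  finally show ?thesis by (simp add: scaleR_conv_of_real mult.commute)
qed

end

subsection \<open>The joint law with the endpoints\<close>

lemma space_gen_by [simp]: "space (gen_by M Z A) = space M"
  unfolding gen_by_def by (rule space_measure_of) auto

lemma sets_gen_by: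
  "sets (gen_by M Z A) = sigma_sets (space M)
     (\<Union>\<tau>\<in>A. {Z \<tau> -` B \<inter> space M |B. B \<in> sets borel})"
  unfolding gen_by_def by (rule sets_measure_of) auto

lemma measurable_gen_by:
  assumes "t \<in> A" shows "Z t \<in> borel_measurable (gen_by M Z A)"
  by (rule measurableI) (use assms in \<open>auto simp: sets_gen_by intro!: sigma_sets.Basic\<close>)

lemma subalgebra_gen_by:
  assumes "\<And>t. t \<in> A \<Longrightarrow> Z t \<in> borel_measurable M"
  shows "subalgebra M (gen_by M Z A)"
  unfolding subalgebra_def
proof
  have "(\<Union>\<tau>\<in>A. {Z \<tau> -` B \<inter> space M |B. B \<in> sets borel}) \<subseteq> sets M"
    using assms measurable_sets by blast
  then show "sets (gen_by M Z A) \<subseteq> sets M"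
    unfolding sets_gen_by by (rule sets.sigma_sets_subset)
qed simp

text \<open>For a single time the preimages already form a sigma-algebra, so every event of the
  present has this explicit form.\<close>

lemma sets_gen_by_single:
  "sets (gen_by M Z {s}) = {Z s -` B \<inter> space M |B. B \<in> sets borel}"
proof -
  have "sets (gen_by M Z {s}) = sets (vimage_algebra (space M) (Z s) borel)"
    by (simp add: sets_gen_by sets_vimage_algebra)
  then show ?thesis by (simp add: sets_vimage_algebra2)
qed

context generated_process
begin

lemma sigma_finite_subalgebra_gen_by:
  assumes "A \<subseteq> {0..T}"
  shows "sigma_finite_subalgebra M (gen_by M Z A)"
proof -
  have sub: "subalgebra M (gen_by M Z A)"
    by (rule subalgebra_gen_by) (use assms Z_borel in auto)
  then show ?thesis
    by (rule finite_measure_subalgebra_is_sigma_finite[OF finite_measure_subalgebra.intro,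
          OF finite_measure_axioms finite_measure_subalgebra_axioms.intro])
qed

text \<open>The prescribed endpoint probabilities are values on rectangles, and these determine the
  joint law.\<close>

lemma law_endpoints:
  "distr M (N \<Otimes>\<^sub>M N) (\<lambda>\<omega>. (Z 0 \<omega>, Z T \<omega>)) =
     density (N \<Otimes>\<^sub>M N) (\<lambda>z. ennreal (r z * g (fst z) T (snd z)))"
proof (rule finite_measure_pair_eqI[where E="sets N" and ?M1.0=N and ?M2.0=N])
  have Z: "(\<lambda>\<omega>. (Z 0 \<omega>, Z T \<omega>)) \<in> M \<rightarrow>\<^sub>M N \<Otimes>\<^sub>M N"
    using T_pos by (intro Z_Pair_measurable) auto
  show "finite_measure (distr M (N \<Otimes>\<^sub>M N) (\<lambda>\<omega>. (Z 0 \<omega>, Z T \<omega>)))"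
    by (rule finite_measure_distr[OF Z])
  show "Int_stable (sets N)" by (auto simp: Int_stable_def)
  show "sets N \<subseteq> Pow (space N)" by (rule sets.space_closed)
  show "sets N = sigma_sets (space N) (sets N)" by (simp only: sets.sigma_sets_eq)
  fix A B assume A: "A \<in> sets N" and B: "B \<in> sets N"
  have nn: "0 \<le> r z * g (fst z) T (snd z)" if "z \<in> space (N \<Otimes>\<^sub>M N)" for z
    using that weight_nonneg[OF weight] less_imp_le[OF g_pos[OF _ _ T_pos order_refl]]
    by (auto simp: space_pair_measure)
  have "emeasure (distr M (N \<Otimes>\<^sub>M N) (\<lambda>\<omega>. (Z 0 \<omega>, Z T \<omega>))) (A \<times> B)
      = emeasure M {\<omega> \<in> space M. Z 0 \<omega> \<in> A \<and> Z T \<omega> \<in> B}"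
    by (subst emeasure_distr[OF Z]) (use A B in \<open>auto intro!: arg_cong[where f="emeasure M"]\<close>)
  also have "\<dots> = ennreal (\<integral>z. indicator (A \<times> B) z * (r z * g (fst z) T (snd z)) \<partial>(N \<Otimes>\<^sub>M N))"
    by (simp add: emeasure_eq_measure prob_endpoints[OF A B])
  also have "\<dots> = (\<integral>\<^sup>+z. ennreal (indicator (A \<times> B) z * (r z * g (fst z) T (snd z))) \<partial>(N \<Otimes>\<^sub>M N))"
    by (rule nn_integral_eq_integral[symmetric, OF integrable_weight_g[OF weight, of _ 1]])
       (use A B nn in \<open>auto simp: indicator_def\<close>)
  also have "\<dots> = (\<integral>\<^sup>+z. ennreal (r z * g (fst z) T (snd z)) * indicator (A \<times> B) z \<partial>(N \<Otimes>\<^sub>M N))"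
    by (intro nn_integral_cong) (auto simp: indicator_def)
  also have "\<dots> = emeasure (density (N \<Otimes>\<^sub>M N) (\<lambda>z. ennreal (r z * g (fst z) T (snd z)))) (A \<times> B)"
    by (subst emeasure_density) (use A B weight_g_measurable[OF weight] in auto)
  finally show "emeasure (distr M (N \<Otimes>\<^sub>M N) (\<lambda>\<omega>. (Z 0 \<omega>, Z T \<omega>))) (A \<times> B) = \<dots>" .
qed (auto simp: space_in_sets_N)

text \<open>The bridge transition density g(y,T-s,w) g(w,s,x) / g(y,T,x) multiplied by the endpoint
  density r(x,y) g(x,T,y), with the kernel at time T cancelled by symmetry. The intermediate point
  is a separate argument because later it is held fixed.\<close>

definition bridge_density :: "real \<Rightarrow> (real^'d) \<Rightarrow> (real^'d) \<times> (real^'d) \<Rightarrow> real" where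
  "bridge_density s w z = r z * (g w s (fst z) * g (snd z) (T - s) w)"

lemma bridge_density_measurable [measurable]:
  "(\<lambda>p. bridge_density s (fst p) (snd p)) \<in> borel_measurable (N \<Otimes>\<^sub>M (N \<Otimes>\<^sub>M N))"
proof -
  note [measurable] = weight_measurable[OF weight]
  show ?thesis unfolding bridge_density_def by measurable
qed

lemma bridge_density_bounds:
  assumes s: "0 < s" "s < T"
  obtains B where "0 \<le> B" "\<And>w x y. w \<in> closure D \<Longrightarrow> x \<in> closure D \<Longrightarrow> y \<in> closure D \<Longrightarrow>
    0 \<le> bridge_density s w (x, y) \<and> bridge_density s w (x, y) \<le> B"
proof -
  have s': "0 < T - s" "s \<le> T" "T - s \<le> T" using s by auto
  obtain C1 where C1: "0 \<le> C1" "\<And>x y. x \<in> closure D \<Longrightarrow> y \<in> closure D \<Longrightarrow> g x s y \<le> C1"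
    using g_bound[of s] s by auto
  obtain C2 where C2: "0 \<le> C2" "\<And>x y. x \<in> closure D \<Longrightarrow> y \<in> closure D \<Longrightarrow> g x (T - s) y \<le> C2"
    using g_bound[of "T - s"] s by auto
  have "0 \<le> bridge_density s w (x, y) \<and> bridge_density s w (x, y) \<le> \<bar>C\<bar> * (C1 * C2)"
    if "w \<in> closure D" "x \<in> closure D" "y \<in> closure D" for w x y
    using weight_nonneg[OF weight that(2,3)] weight_bound[OF weight that(2,3)]
      C1(2)[OF that(1,2)] C2(2)[OF that(3,1)] g_pos[OF that(1,2) s(1) s'(2)] g_pos[OF that(3,1) s'(1,3)] C1(1) C2(1)
    unfolding bridge_density_def fst_conv snd_conv
    by (intro conjI mult_mono mult_nonneg_nonneg) auto
  moreover have "0 \<le> \<bar>C\<bar> * (C1 * C2)" using C1(1) C2(1) by simp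
  ultimately show ?thesis using that by blast
qed

text \<open>The event constrains \<open>Z 0\<close> and \<open>Z T\<close> through a set in the
  sigma-algebra of the pair, over which the conditional probability of \<open>Z s\<close> lying in
  \<open>F\<close> may be integrated. Its prescribed value is a function of the endpoints, whose law
  is known.\<close>

lemma prob_bridge:
  assumes s: "0 < s" "s < T" and F: "F \<in> sets N" and A: "A \<in> sets N" and B: "B \<in> sets N"
  shows "measure M {\<omega> \<in> space M. Z s \<omega> \<in> F \<and> Z 0 \<omega> \<in> A \<and> Z T \<omega> \<in> B}
    = (\<integral>z. indicator (A \<times> B) z * (LINT w|N. indicator F w * bridge_density s w z) \<partial>(N \<Otimes>\<^sub>M N))"
proof -
  define G where "G = gen_by M Z {0, T}"
  interpret G: sigma_finite_subalgebra M G
    unfolding G_def using T_pos by (intro sigma_finite_subalgebra_gen_by) auto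
  have sT: "s \<in> {0..T}" "0 \<in> {0..T}" "T \<in> {0..T}" using s by auto
  note [measurable] = F A B weight_measurable[OF weight] Z_borel[OF sT(1)] Z_borel[OF sT(2)] Z_borel[OF sT(3)]
  have ABF: "A \<in> sets borel" "B \<in> sets borel" "F \<in> sets borel" "F \<subseteq> closure D"
    using F A B by (auto simp: in_sets_N)
  note [measurable] = ABF(1-3)
  \<comment> \<open>The prescribed conditional probability that \<open>Z s\<close> lies in
    \<open>F\<close>, as a function of the endpoints.\<close>
  define q where "q x y = (LINT z:F|lborel. g y (T - s) z * g z s x) / g y T x" for x y
  have q_N: "q x y = (LINT z|N. indicator F z * (g y (T - s) z * g z s x)) / g y T x" for x y
    unfolding q_def set_integral_N[OF F] by simp
  have q_meas: "(\<lambda>z. q (fst z) (snd z)) \<in> borel_measurable (N \<Otimes>\<^sub>M N)"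
    unfolding q_N by measurable
  define S where "S = {\<omega> \<in> space M. Z 0 \<omega> \<in> A \<and> Z T \<omega> \<in> B}"
  define X where "X = (indicator (Z s -` F \<inter> space M) :: _ \<Rightarrow> real)"
  have S_eq: "S = (Z 0 -` A \<inter> space G) \<inter> (Z T -` B \<inter> space G)"
    by (auto simp: S_def G_def)
  have S: "S \<in> sets G"
    unfolding S_eq using ABF measurable_gen_by[of 0 "{0, T}" Z M] measurable_gen_by[of T "{0, T}" Z M]
    by (intro sets.Int measurable_sets) (auto simp: G_def)
  have F_ev: "Z s -` F \<inter> space M \<in> sets M" using ABF by measurable
  have X: "integrable M X"
    unfolding X_def by (rule integrable_real_indicator[OF F_ev]) (simp add: emeasure_eq_measure)
  have AE_q: "AE \<omega> in M. real_cond_exp M G X \<omega> = q (Z 0 \<omega>) (Z T \<omega>)"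
  proof -
    have "AE \<omega> in M. real_cond_exp M (gen_by M Z {0, T}) (indicator (Z s -` F \<inter> space M)) \<omega>
       = (LINT z:F|lborel. g (Z T \<omega>) (T - s) z * g z (s - 0) (Z 0 \<omega>)) / g (Z T \<omega>) (T - 0) (Z 0 \<omega>)"
      using generated_conj[THEN conjunct2, THEN conjunct2, THEN conjunct1, rule_format, of 0 s T F] s ABF by auto
    then show ?thesis by (simp add: G_def X_def q_def)
  qed
  have Z0T: "(\<lambda>\<omega>. (Z 0 \<omega>, Z T \<omega>)) \<in> M \<rightarrow>\<^sub>M N \<Otimes>\<^sub>M N"
    by (rule Z_Pair_measurable[OF sT(2,3)])
  have S_M: "S \<in> sets M" unfolding S_def by measurable
  have "{\<omega> \<in> space M. Z s \<omega> \<in> F \<and> Z 0 \<omega> \<in> A \<and> Z T \<omega> \<in> B} = S \<inter> (Z s -` F \<inter> space M)"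
    by (auto simp: S_def)
  then have "measure M {\<omega> \<in> space M. Z s \<omega> \<in> F \<and> Z 0 \<omega> \<in> A \<and> Z T \<omega> \<in> B} = (\<integral>\<omega>\<in>S. X \<omega> \<partial>M)"
    using Int_absorb2[of "S \<inter> (Z s -` F \<inter> space M)" "space M"]
    by (simp add: set_lebesgue_integral_def X_def indicator_inter_arith[symmetric] inf.coboundedI2)
  \<comment> \<open>The defining property of conditional expectation, available because
    \<open>S\<close> is an event of the endpoints.\<close>
  also have "\<dots> = (\<integral>\<omega>\<in>S. real_cond_exp M G X \<omega> \<partial>M)"
    by (rule G.real_cond_exp_intA[OF X S])
  also have "\<dots> = (\<integral>\<omega>. indicator S \<omega> *\<^sub>R q (Z 0 \<omega>) (Z T \<omega>) \<partial>M)"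
    unfolding set_lebesgue_integral_def
  proof (rule integral_cong_AE)
    show "(\<lambda>\<omega>. indicator S \<omega> *\<^sub>R real_cond_exp M G X \<omega>) \<in> borel_measurable M"
      using S_M by measurable
    show "(\<lambda>\<omega>. indicator S \<omega> *\<^sub>R q (Z 0 \<omega>) (Z T \<omega>)) \<in> borel_measurable M"
      using measurable_compose[OF Z0T q_meas] S_M by simp
    show "AE \<omega> in M. indicator S \<omega> *\<^sub>R real_cond_exp M G X \<omega> = indicator S \<omega> *\<^sub>R q (Z 0 \<omega>) (Z T \<omega>)"
      using AE_q by eventually_elim simp
  qed
  also have "\<dots> = (\<integral>\<omega>. (\<lambda>z. indicator (A \<times> B) z * q (fst z) (snd z)) (Z 0 \<omega>, Z T \<omega>) \<partial>M)"
    by (rule Bochner_Integration.integral_cong) (auto simp: S_def indicator_def)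
  also have "\<dots> = (\<integral>z. indicator (A \<times> B) z * q (fst z) (snd z) \<partial>distr M (N \<Otimes>\<^sub>M N) (\<lambda>\<omega>. (Z 0 \<omega>, Z T \<omega>)))"
    by (rule integral_distr[symmetric, OF Z0T]) (use q_meas in measurable)
  also have "\<dots> = (\<integral>z. (r z * g (fst z) T (snd z)) *\<^sub>R (indicator (A \<times> B) z * q (fst z) (snd z)) \<partial>(N \<Otimes>\<^sub>M N))"
    unfolding law_endpoints
  proof (rule integral_density)
    show "AE z in N \<Otimes>\<^sub>M N. 0 \<le> r z * g (fst z) T (snd z)"
      using weight_nonneg[OF weight] less_imp_le[OF g_pos[OF _ _ T_pos order_refl]]
      by (intro AE_I2) (auto simp: space_pair_measure)
  qed (use q_meas in measurable)
  also have "\<dots> = (\<integral>z. indicator (A \<times> B) z * (LINT w|N. indicator F w * bridge_density s w z) \<partial>(N \<Otimes>\<^sub>M N))"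
  proof (rule Bochner_Integration.integral_cong[OF refl])
    fix z assume "z \<in> space (N \<Otimes>\<^sub>M N)"
    then obtain x y where z: "z = (x, y)" "x \<in> closure D" "y \<in> closure D"
      by (auto simp: space_pair_measure)
    have "0 < g x T y" "g y T x = g x T y"
      using g_pos[OF z(2,3) T_pos] g_sym[OF z(2,3) T_pos] by auto
    then have "g x T y * q x y = (LINT z|N. indicator F z * (g y (T - s) z * g z s x))"
      by (simp add: q_N)
    moreover have "(LINT w|N. indicator F w * bridge_density s w z)
        = r z * (LINT z|N. indicator F z * (g y (T - s) z * g z s x))"
      unfolding bridge_density_def z
      by (subst Bochner_Integration.integral_mult_right_zero[symmetric])
         (simp add: mult_ac)
    ultimately show "(r z * g (fst z) T (snd z)) *\<^sub>R (indicator (A \<times> B) z * q (fst z) (snd z))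
      = indicator (A \<times> B) z * (LINT w|N. indicator F w * bridge_density s w z)"
      by (simp add: z mult_ac)
  qed
  finally show ?thesis .
qed

text \<open>\<open>prob_bridge\<close> gives the values on triple rectangles. The work lies in
  rewriting its real iterated integral, with w innermost, as a \<open>nn_integral\<close> over the
  triple product.\<close>

lemma law_bridge:
  assumes s: "0 < s" "s < T"
  shows "distr M (N \<Otimes>\<^sub>M (N \<Otimes>\<^sub>M N)) (\<lambda>\<omega>. (Z s \<omega>, (Z 0 \<omega>, Z T \<omega>))) =
     density (N \<Otimes>\<^sub>M (N \<Otimes>\<^sub>M N)) (\<lambda>p. ennreal (bridge_density s (fst p) (snd p)))"
proof (rule finite_measure_triple_eqI[where ?M1.0=N and ?M2.0=N and ?M3.0=N])
  have Z: "(\<lambda>\<omega>. (Z s \<omega>, (Z 0 \<omega>, Z T \<omega>))) \<in> M \<rightarrow>\<^sub>M N \<Otimes>\<^sub>M (N \<Otimes>\<^sub>M N)"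
    using s by (intro measurable_Pair Z_measurable) auto
  show "finite_measure (distr M (N \<Otimes>\<^sub>M (N \<Otimes>\<^sub>M N)) (\<lambda>\<omega>. (Z s \<omega>, (Z 0 \<omega>, Z T \<omega>))))"
    by (rule finite_measure_distr[OF Z])
  interpret NNN: pair_sigma_finite N "N \<Otimes>\<^sub>M N" ..
  obtain b where b: "0 \<le> b" "\<And>w x y. w \<in> closure D \<Longrightarrow> x \<in> closure D \<Longrightarrow> y \<in> closure D \<Longrightarrow>
    0 \<le> bridge_density s w (x, y) \<and> bridge_density s w (x, y) \<le> b"
    using bridge_density_bounds[OF s] by auto
  fix F A B assume F: "F \<in> sets N" and A: "A \<in> sets N" and B: "B \<in> sets N"
    define E where E: "E = A \<times> B"
  note [measurable] = F A B
  have E_meas [measurable]: "E \<in> sets (N \<Otimes>\<^sub>M N)" unfolding E by simp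
  let ?I = "\<lambda>z. LINT w|N. indicator F w * bridge_density s w z"
  have i1: "integrable N (\<lambda>w. indicator F w * bridge_density s w z)"
    and n1: "\<And>w. w \<in> space N \<Longrightarrow> 0 \<le> indicator F w * bridge_density s w z"
    and I0: "0 \<le> ?I z" and I1: "?I z \<le> b * measure N (closure D)" if z: "z \<in> space (N \<Otimes>\<^sub>M N)" for z
  proof -
    have bd: "0 \<le> bridge_density s w z \<and> bridge_density s w z \<le> b" if "w \<in> closure D" for w
      using b(2)[OF that] z by (auto simp: space_pair_measure)
    have m: "(\<lambda>w. bridge_density s w z) \<in> borel_measurable N"
      using measurable_compose[OF _ bridge_density_measurable[of s], of "\<lambda>w. (w, z)" N] z by simp
    show i1: "integrable N (\<lambda>w. indicator F w * bridge_density s w z)"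
      by (rule N_integrable[of _ b]) (use m bd b(1) in \<open>auto simp: indicator_def\<close>)
    show "\<And>w. w \<in> space N \<Longrightarrow> 0 \<le> indicator F w * bridge_density s w z" using bd by simp
    then show "0 \<le> ?I z" by (intro integral_nonneg_AE AE_I2)
    have "?I z \<le> (LINT w|N. b)"
      by (rule integral_mono[OF i1]) (use bd b(1) in \<open>auto simp: indicator_def\<close>)
    then show "?I z \<le> b * measure N (closure D)" by (simp add: mult.commute)
  qed
  have mI: "?I \<in> borel_measurable (N \<Otimes>\<^sub>M N)"
  proof (rule N.borel_measurable_lebesgue_integral)
    have "(\<lambda>p. bridge_density s (snd p) (fst p)) \<in> borel_measurable ((N \<Otimes>\<^sub>M N) \<Otimes>\<^sub>M N)"
      using measurable_compose[OF _ bridge_density_measurable[of s], of "\<lambda>p. (snd p, fst p)" "(N \<Otimes>\<^sub>M N) \<Otimes>\<^sub>M N"] by simp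
    then show "(\<lambda>(z, w). indicator F w * bridge_density s w z) \<in> borel_measurable ((N \<Otimes>\<^sub>M N) \<Otimes>\<^sub>M N)"
      unfolding split_beta' by measurable
  qed
  have "emeasure (distr M (N \<Otimes>\<^sub>M (N \<Otimes>\<^sub>M N)) (\<lambda>\<omega>. (Z s \<omega>, (Z 0 \<omega>, Z T \<omega>)))) (F \<times> E)
      = emeasure M {\<omega> \<in> space M. Z s \<omega> \<in> F \<and> Z 0 \<omega> \<in> A \<and> Z T \<omega> \<in> B}"
    by (subst emeasure_distr[OF Z]) (auto intro!: arg_cong[where f="emeasure M"] simp: E)
  also have "\<dots> = ennreal (\<integral>z. indicator E z * ?I z \<partial>(N \<Otimes>\<^sub>M N))"
    by (simp add: emeasure_eq_measure prob_bridge[OF s F A B] E)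
  also have "\<dots> = (\<integral>\<^sup>+z. ennreal (indicator E z * ?I z) \<partial>(N \<Otimes>\<^sub>M N))"
  proof (rule nn_integral_eq_integral[symmetric])
    show "integrable (N \<Otimes>\<^sub>M N) (\<lambda>z. indicator E z * ?I z)"
      by (rule NN_integrable[of _ "b * measure N (closure D)"])
         (use mI I0 I1 b(1) in \<open>auto simp: space_pair_measure indicator_def\<close>)
  qed (use I0 in auto)
  \<comment> \<open>From here on the integrals are \<open>ennreal\<close>-valued, so that Tonelli
    applies to the iterated form.\<close>
  also have "\<dots> = (\<integral>\<^sup>+z. (\<integral>\<^sup>+w. ennreal (bridge_density s w z) * indicator (F \<times> E) (w, z) \<partial>N) \<partial>(N \<Otimes>\<^sub>M N))"
  proof (rule nn_integral_cong)
    fix z assume z: "z \<in> space (N \<Otimes>\<^sub>M N)"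
    have "ennreal (?I z) = (\<integral>\<^sup>+w. ennreal (indicator F w * bridge_density s w z) \<partial>N)"
      by (rule nn_integral_eq_integral[symmetric, OF i1[OF z]]) (use n1[OF z] in auto)
    then show "ennreal (indicator E z * ?I z)
      = (\<integral>\<^sup>+w. ennreal (bridge_density s w z) * indicator (F \<times> E) (w, z) \<partial>N)"
      by (cases "z \<in> E") (auto simp: indicator_def intro!: nn_integral_cong)
  qed
  also have "\<dots> = (\<integral>\<^sup>+p. ennreal (bridge_density s (fst p) (snd p)) * indicator (F \<times> E) p \<partial>(N \<Otimes>\<^sub>M (N \<Otimes>\<^sub>M N)))"
    using NNN.nn_integral_snd[of "\<lambda>p. ennreal (bridge_density s (fst p) (snd p)) * indicator (F \<times> E) p"] by simp
  also have "\<dots> = emeasure (density (N \<Otimes>\<^sub>M (N \<Otimes>\<^sub>M N)) (\<lambda>p. ennreal (bridge_density s (fst p) (snd p)))) (F \<times> E)"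
    by (subst emeasure_density) auto
  finally show "emeasure (distr M (N \<Otimes>\<^sub>M (N \<Otimes>\<^sub>M N)) (\<lambda>\<omega>. (Z s \<omega>, (Z 0 \<omega>, Z T \<omega>)))) (F \<times> (A \<times> B))
    = emeasure (density (N \<Otimes>\<^sub>M (N \<Otimes>\<^sub>M N)) (\<lambda>p. ennreal (bridge_density s (fst p) (snd p)))) (F \<times> (A \<times> B))"
    unfolding E .
qed auto

text \<open>The joint law in iterated form with w outermost, ready for computations at a fixed value
  of \<open>Z s\<close>.\<close>

lemma nn_integral_bridge:
  assumes s: "0 < s" "s < T" and H: "H \<in> borel_measurable (N \<Otimes>\<^sub>M (N \<Otimes>\<^sub>M N))"
  shows "(\<integral>\<^sup>+\<omega>. H (Z s \<omega>, (Z 0 \<omega>, Z T \<omega>)) \<partial>M)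
    = (\<integral>\<^sup>+w. \<integral>\<^sup>+z. ennreal (bridge_density s w z) * H (w, z) \<partial>(N \<Otimes>\<^sub>M N) \<partial>N)"
proof -
  have Z: "(\<lambda>\<omega>. (Z s \<omega>, (Z 0 \<omega>, Z T \<omega>))) \<in> M \<rightarrow>\<^sub>M N \<Otimes>\<^sub>M (N \<Otimes>\<^sub>M N)"
    using s by (intro measurable_Pair Z_measurable) auto
  have "(\<integral>\<^sup>+\<omega>. H (Z s \<omega>, (Z 0 \<omega>, Z T \<omega>)) \<partial>M)
      = (\<integral>\<^sup>+p. H p \<partial>distr M (N \<Otimes>\<^sub>M (N \<Otimes>\<^sub>M N)) (\<lambda>\<omega>. (Z s \<omega>, (Z 0 \<omega>, Z T \<omega>))))"
    by (rule nn_integral_distr[symmetric, OF Z]) (use H in simp)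
  also have "\<dots> = (\<integral>\<^sup>+p. ennreal (bridge_density s (fst p) (snd p)) * H p \<partial>(N \<Otimes>\<^sub>M (N \<Otimes>\<^sub>M N)))"
    unfolding law_bridge[OF s] by (rule nn_integral_density) (use H in auto)
  also have "\<dots> = (\<integral>\<^sup>+w. \<integral>\<^sup>+z. ennreal (bridge_density s w z) * H (w, z) \<partial>(N \<Otimes>\<^sub>M N) \<partial>N)"
    using NN.nn_integral_fst[of "\<lambda>p. ennreal (bridge_density s (fst p) (snd p)) * H p" N] H by simp
  finally show ?thesis .
qed

subsection \<open>Factorization under the Markov property\<close>

text \<open>Conditional independence of \<open>Z 0\<close> and \<open>Z T\<close> given \<open>Z s\<close> reads \<open>f w (x, y) = \<alpha> w x * \<beta> w y / W w\<close>
  almost everywhere, where \<open>f\<close> is the joint density and \<open>\<alpha>\<close>, \<open>\<beta>\<close>, \<open>W\<close> are its marginals.\<close>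
lemma markov_factorization:
  assumes pos: "\<And>x y. x \<in> closure D \<Longrightarrow> y \<in> closure D \<Longrightarrow> 0 < r (x, y)" and ne: "D \<noteq> {}"
    and markov: "markov_process M Z T D"
  obtains \<nu>0 \<nu>T where "sets \<nu>0 = sets N" "sets \<nu>T = sets N"
    "density (N \<Otimes>\<^sub>M N) (\<lambda>z. ennreal (r z)) = \<nu>0 \<Otimes>\<^sub>M \<nu>T"
proof -
  \<comment> \<open>Any time strictly between 0 and T would serve.\<close>
  define s where "s = T / 2"
  have s: "0 < s" "s < T" "0 < T - s" "s \<le> T" "T - s \<le> T" using T_pos by (auto simp: s_def)
  have sT: "s \<in> {0..T}" "0 \<in> {0..T}" "T \<in> {0..T}" using s by auto
  define f where "f w z = ennreal (bridge_density s w z)" for w z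
  obtain b where b: "0 \<le> b" "\<And>w x y. w \<in> closure D \<Longrightarrow> x \<in> closure D \<Longrightarrow> y \<in> closure D \<Longrightarrow>
    0 \<le> bridge_density s w (x, y) \<and> bridge_density s w (x, y) \<le> b"
    using bridge_density_bounds[OF s(1,2)] by auto
  have f_le: "f w z \<le> ennreal b" if "w \<in> closure D" "z \<in> space (N \<Otimes>\<^sub>M N)" for w z
    using that b(2) unfolding f_def by (intro ennreal_leI) (auto simp: space_pair_measure)
  have f_pos: "f w z \<noteq> 0" if w: "w \<in> closure D" and zN: "z \<in> space (N \<Otimes>\<^sub>M N)" for w z
  proof -
    obtain x y where z: "z = (x, y)" "x \<in> closure D" "y \<in> closure D"
      using zN by (auto simp: space_pair_measure)
    have "0 < bridge_density s w z"
      unfolding bridge_density_def z fst_conv snd_conv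
      using pos[OF z(2,3)] g_pos[OF w z(2) s(1,4)] g_pos[OF z(3) w s(3,5)] by simp
    then show ?thesis by (simp add: f_def)
  qed
  have f_meas [measurable]: "(\<lambda>p. f (fst p) (snd p)) \<in> borel_measurable (N \<Otimes>\<^sub>M (N \<Otimes>\<^sub>M N))"
    unfolding f_def by measurable
  have f_meas' [measurable (raw)]: "(\<lambda>a. f (h a) (k a)) \<in> borel_measurable L"
    if "h \<in> L \<rightarrow>\<^sub>M N" "k \<in> L \<rightarrow>\<^sub>M N \<Otimes>\<^sub>M N" for h k and L :: "'l measure"
    using measurable_compose[OF measurable_Pair[OF that] f_meas] by simp
  have f_w: "(\<lambda>z. f w z) \<in> borel_measurable (N \<Otimes>\<^sub>M N)" if "w \<in> closure D" for w
    by (rule f_meas') (use that in auto)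

  \<comment> \<open>Marginals of the joint density: \<open>\<alpha>\<close> for
    \<open>(Z s, Z 0)\<close>, \<open>\<beta>\<close> for \<open>(Z s, Z T)\<close>,
    \<open>W\<close> for \<open>Z s\<close> alone. \<open>\<beta>\<^sub>B B\<close> integrates
    \<open>\<beta>\<close> over \<open>B\<close>.\<close>
  define \<alpha> where "\<alpha> w x = (\<integral>\<^sup>+y. f w (x, y) \<partial>N)" for w x
  define \<beta> where "\<beta> w y = (\<integral>\<^sup>+x. f w (x, y) \<partial>N)" for w y
  define W where "W w = (\<integral>\<^sup>+z. f w z \<partial>(N \<Otimes>\<^sub>M N))" for w
  define \<beta>\<^sub>B where "\<beta>\<^sub>B B w = (\<integral>\<^sup>+y. indicator B y * \<beta> w y \<partial>N)" for B w
  have \<alpha>_meas: "(\<lambda>p. \<alpha> (fst p) (snd p)) \<in> borel_measurable (N \<Otimes>\<^sub>M N)"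
    unfolding \<alpha>_def by measurable
  have \<beta>_meas: "(\<lambda>p. \<beta> (fst p) (snd p)) \<in> borel_measurable (N \<Otimes>\<^sub>M N)"
    unfolding \<beta>_def by measurable
  have [measurable (raw)]: "(\<lambda>a. \<alpha> (h a) (k a)) \<in> borel_measurable L" "(\<lambda>a. \<beta> (h a) (k a)) \<in> borel_measurable L"
    if "h \<in> L \<rightarrow>\<^sub>M N" "k \<in> L \<rightarrow>\<^sub>M N" for h k and L :: "'l measure"
    using measurable_compose[OF measurable_Pair[OF that] \<alpha>_meas]
      measurable_compose[OF measurable_Pair[OF that] \<beta>_meas] by simp_all
  have W_meas [measurable]: "W \<in> borel_measurable N"
    unfolding W_def[abs_def] by measurable
  have \<beta>\<^sub>B_meas [measurable]: "\<beta>\<^sub>B B \<in> borel_measurable N" if [measurable]: "B \<in> sets N" for B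
    unfolding \<beta>\<^sub>B_def[abs_def] by measurable

  \<comment> \<open>Finiteness together with positivity of \<open>W\<close> makes the quotients in
    \<open>ennreal\<close> genuine, so that multiplying by \<open>W w\<close> undoes dividing by
    it.\<close>
  have W_fin: "W w \<noteq> \<top>" if "w \<in> closure D" for w
  proof -
    have "W w \<le> (\<integral>\<^sup>+z. ennreal b \<partial>(N \<Otimes>\<^sub>M N))"
      unfolding W_def by (rule nn_integral_mono) (rule f_le[OF that])
    also have "\<dots> < \<top>" by (simp add: less_top[symmetric] ennreal_mult_eq_top_iff)
    finally show ?thesis by simp
  qed
  have W_pos: "W w \<noteq> 0" if w: "w \<in> closure D" for w
  proof
    assume "W w = 0"
    then have "AE z in N \<Otimes>\<^sub>M N. f w z = 0"
      unfolding W_def by (subst (asm) nn_integral_0_iff_AE) (use f_w[OF w] in auto)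
    then have "AE z in N \<Otimes>\<^sub>M N. False"
      using AE_space by eventually_elim (use f_pos[OF w] in auto)
    then have "emeasure (N \<Otimes>\<^sub>M N) (space (N \<Otimes>\<^sub>M N)) = 0"
      unfolding eventually_False ae_filter_eq_bot_iff .
    then have "emeasure N (closure D) * emeasure N (closure D) = 0"
      using N.emeasure_pair_measure_Times[OF space_in_sets_N space_in_sets_N] by (simp add: space_pair_measure)
    then show False using emeasure_N_pos[OF ne] by simp
  qed
  have \<beta>_fin: "\<beta> w y \<noteq> \<top>" if "w \<in> closure D" "y \<in> closure D" for w y
  proof -
    have "\<beta> w y \<le> (\<integral>\<^sup>+x. ennreal b \<partial>N)"
      unfolding \<beta>_def by (rule nn_integral_mono) (use f_le that in \<open>auto simp: space_pair_measure\<close>)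
    also have "\<dots> < \<top>" by (simp add: less_top[symmetric] ennreal_mult_eq_top_iff)
    finally show ?thesis by simp
  qed
  have \<beta>\<^sub>B_eq: "\<beta>\<^sub>B B w = (\<integral>\<^sup>+z. f w z * indicator B (snd z) \<partial>(N \<Otimes>\<^sub>M N))"
    if [measurable]: "B \<in> sets N" and [simp]: "w \<in> closure D" for B w
  proof -
    have "(\<integral>\<^sup>+z. f w z * indicator B (snd z) \<partial>(N \<Otimes>\<^sub>M N)) = (\<integral>\<^sup>+y. \<integral>\<^sup>+x. f w (x, y) * indicator B y \<partial>N \<partial>N)"
      using NN.nn_integral_snd[of "\<lambda>z. f w z * indicator B (snd z)"] by simp
    also have "\<dots> = \<beta>\<^sub>B B w"
      unfolding \<beta>\<^sub>B_def \<beta>_def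
      by (rule nn_integral_cong) (subst nn_integral_multc, auto simp: mult.commute)
    finally show ?thesis by simp
  qed
  have \<beta>\<^sub>B_le: "\<beta>\<^sub>B B w \<le> W w" if "B \<in> sets N" "w \<in> closure D" for B w
    unfolding \<beta>\<^sub>B_eq[OF that] W_def by (intro nn_integral_mono) (auto simp: indicator_def)

  \<comment> \<open>The probability that \<open>Z T\<close> lies in \<open>B\<close>, given that
    \<open>Z s = w\<close>. It is real-valued to be comparable with \<open>real_cond_exp\<close>,
    and no information is lost as the quotient is at most 1.\<close>
  define h where "h B w = enn2real (\<beta>\<^sub>B B w / W w)" for B w
  have h_meas [measurable]: "h B \<in> borel_measurable N" if [measurable]: "B \<in> sets N" for B
    unfolding h_def[abs_def] by measurable
  have quot: "\<beta>\<^sub>B B w / W w \<le> 1" if "B \<in> sets N" "w \<in> closure D" for B w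
    using \<beta>\<^sub>B_le[OF that] W_pos[OF that(2)] W_fin[OF that(2)]
    by (metis divide_right_mono_ennreal ennreal_divide_self less_top not_gr_zero)
  have h_enn: "ennreal (h B w) = \<beta>\<^sub>B B w / W w" if "B \<in> sets N" "w \<in> closure D" for B w
    unfolding h_def using quot[OF that] by (intro ennreal_enn2real) (auto intro: le_less_trans)
  have h_bounds: "0 \<le> h B w" "h B w \<le> 1" if "B \<in> sets N" "w \<in> closure D" for B w
    using quot[OF that] enn2real_mono[OF quot[OF that]] by (auto simp: h_def)

  have cond: "AE \<omega> in M. real_cond_exp M (gen_by M Z {s}) (\<lambda>\<omega>. indicator B (Z T \<omega>)) \<omega> = h B (Z s \<omega>)"
    if B: "B \<in> sets N" for B
  proof -
    interpret G: sigma_finite_subalgebra M "gen_by M Z {s}"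
      using sT by (intro sigma_finite_subalgebra_gen_by) auto
    note [measurable] = B Z_measurable[OF sT(1)] Z_measurable[OF sT(3)]
    have Bb: "B \<in> sets borel" using B by (simp add: in_sets_N)
    have hZ: "(\<lambda>\<omega>. h B (Z s \<omega>)) \<in> borel_measurable M" by measurable
    show ?thesis
    proof (rule G.real_cond_exp_charact)
      show "integrable M (\<lambda>\<omega>. indicator B (Z T \<omega>) :: real)"
        by (rule integrable_const_bound[of _ 1]) (auto simp: indicator_def)
      show "integrable M (\<lambda>\<omega>. h B (Z s \<omega>))"
        by (rule integrable_const_bound[of _ 1]) (use h_bounds[OF B] Z_closure sT hZ in auto)
      \<comment> \<open>The sigma-algebra of \<open>Z s\<close> is generated by preimages of Borel
        sets of the whole space, whereas \<open>h B\<close> is measurable on closure D only; it is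
        extended by zero.\<close>
      define h' where "h' x = indicator (closure D) x *\<^sub>R h B x" for x
      have "h' \<in> borel_measurable borel"
        using h_meas[OF B] unfolding measurable_N
        unfolding h'_def[abs_def] by (subst (asm) borel_measurable_restrict_space_iff) auto
      then have "(\<lambda>\<omega>. h' (Z s \<omega>)) \<in> borel_measurable (gen_by M Z {s})"
        using measurable_gen_by[of s "{s}" Z M] by simp
      then show "(\<lambda>\<omega>. h B (Z s \<omega>)) \<in> borel_measurable (gen_by M Z {s})"
        by (rule measurable_cong[THEN iffD1, rotated]) (use Z_closure sT in \<open>auto simp: h'_def\<close>)
      fix G assume "G \<in> sets (gen_by M Z {s})"
      then obtain F' where F': "F' \<in> sets borel" "G = Z s -` F' \<inter> space M"
        by (auto simp: sets_gen_by_single)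
      define F where "F = F' \<inter> closure D"
      have F [measurable]: "F \<in> sets N" using F' by (auto simp: F_def in_sets_N)
      have G: "\<And>\<omega>. \<omega> \<in> space M \<Longrightarrow> indicator G \<omega> = indicator F (Z s \<omega>)"
        using F' Z_closure sT by (auto simp: F_def indicator_def)
      have "(\<integral>\<^sup>+\<omega>. ennreal (indicator F (Z s \<omega>) * indicator B (Z T \<omega>)) \<partial>M)
          = (\<integral>\<^sup>+\<omega>. (\<lambda>p. indicator F (fst p) * indicator B (snd (snd p))) (Z s \<omega>, (Z 0 \<omega>, Z T \<omega>)) \<partial>M)"
        by (intro nn_integral_cong) (auto simp: indicator_def)
      also have "\<dots> = (\<integral>\<^sup>+w. \<integral>\<^sup>+z. f w z * (indicator F w * indicator B (snd z)) \<partial>(N \<Otimes>\<^sub>M N) \<partial>N)"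
        unfolding f_def by (subst nn_integral_bridge[OF s(1,2)]) simp_all
      \<comment> \<open>For each w both inner integrals equal
        \<open>indicator F w * \<beta>\<^sub>B B w\<close>, the second because integrating
        \<open>f w\<close> over the endpoints restores the factor \<open>W w\<close>.\<close>
      also have "\<dots> = (\<integral>\<^sup>+w. \<integral>\<^sup>+z. f w z * (indicator F w * ennreal (h B w)) \<partial>(N \<Otimes>\<^sub>M N) \<partial>N)"
      proof (rule nn_integral_cong)
        fix w assume "w \<in> space N"
        then have w [simp]: "w \<in> closure D" by simp
        have "(\<integral>\<^sup>+z. f w z * (indicator F w * indicator B (snd z)) \<partial>(N \<Otimes>\<^sub>M N)) = indicator F w * \<beta>\<^sub>B B w"
          unfolding \<beta>\<^sub>B_eq[OF B w] by (subst nn_integral_cmult[symmetric]) (auto simp: mult_ac)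
        also have "\<beta>\<^sub>B B w = W w * ennreal (h B w)"
          unfolding h_enn[OF B w] using W_pos[OF w] W_fin[OF w]
          by (metis ennreal_divide_times ennreal_times_divide mult.commute mult_divide_eq_ennreal top.not_eq_extremum)
        also have "indicator F w * (W w * ennreal (h B w)) = (\<integral>\<^sup>+z. f w z * (indicator F w * ennreal (h B w)) \<partial>(N \<Otimes>\<^sub>M N))"
          unfolding W_def by (subst nn_integral_multc) (auto simp: mult_ac)
        finally show "(\<integral>\<^sup>+z. f w z * (indicator F w * indicator B (snd z)) \<partial>(N \<Otimes>\<^sub>M N))
          = (\<integral>\<^sup>+z. f w z * (indicator F w * ennreal (h B w)) \<partial>(N \<Otimes>\<^sub>M N))" .
      qed
      also have "\<dots> = (\<integral>\<^sup>+\<omega>. (\<lambda>p. indicator F (fst p) * ennreal (h B (fst p))) (Z s \<omega>, (Z 0 \<omega>, Z T \<omega>)) \<partial>M)"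
        unfolding f_def by (subst nn_integral_bridge[OF s(1,2)]) simp_all
      also have "\<dots> = (\<integral>\<^sup>+\<omega>. ennreal (indicator F (Z s \<omega>) * h B (Z s \<omega>)) \<partial>M)"
        by (intro nn_integral_cong) (auto simp: indicator_def)
      finally have eq: "(\<integral>\<^sup>+\<omega>. ennreal (indicator F (Z s \<omega>) * indicator B (Z T \<omega>)) \<partial>M)
         = (\<integral>\<^sup>+\<omega>. ennreal (indicator F (Z s \<omega>) * h B (Z s \<omega>)) \<partial>M)" .
      have "(\<integral>\<omega>\<in>G. (indicator B (Z T \<omega>) :: real) \<partial>M) = (\<integral>\<omega>. indicator F (Z s \<omega>) * indicator B (Z T \<omega>) \<partial>M)"
        unfolding set_lebesgue_integral_def by (intro Bochner_Integration.integral_cong) (auto simp: G)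
      also have "\<dots> = (\<integral>\<omega>. indicator F (Z s \<omega>) * h B (Z s \<omega>) \<partial>M)"
        by (subst (1 2) integral_eq_nn_integral)
           (use h_bounds[OF B] Z_closure sT eq in \<open>auto simp: eq\<close>)
      also have "\<dots> = (\<integral>\<omega>\<in>G. h B (Z s \<omega>) \<partial>M)"
        unfolding set_lebesgue_integral_def by (intro Bochner_Integration.integral_cong) (auto simp: G)
      finally show "(\<integral>\<omega>\<in>G. indicator B (Z T \<omega>) \<partial>M) = (\<integral>\<omega>\<in>G. h B (Z s \<omega>) \<partial>M)" .
    qed
  qed

  \<comment> \<open>The only use of the Markov property: the event on \<open>(Z 0, Z s)\<close>
    belongs to the past of s, so over it the indicator of \<open>Z T\<close> lying in
    \<open>B\<close> may be replaced by its conditional probability given the present alone.\<close>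
  have past: "(\<integral>\<^sup>+\<omega>. ennreal (indicator F (Z s \<omega>) * indicator A (Z 0 \<omega>) * indicator B (Z T \<omega>)) \<partial>M)
      = (\<integral>\<^sup>+\<omega>. ennreal (indicator F (Z s \<omega>) * indicator A (Z 0 \<omega>) * h B (Z s \<omega>)) \<partial>M)"
    if F: "F \<in> sets N" and A: "A \<in> sets N" and B: "B \<in> sets N" for F A B
  proof -
    interpret G: sigma_finite_subalgebra M "gen_by M Z {0..s}"
      using sT by (intro sigma_finite_subalgebra_gen_by) auto
    note [measurable] = F A B Z_measurable[OF sT(1)] Z_measurable[OF sT(2)] Z_measurable[OF sT(3)]
    have bor: "F \<in> sets borel" "A \<in> sets borel" using F A by (auto simp: in_sets_N)
    define S where "S = (Z 0 -` A \<inter> space M) \<inter> (Z s -` F \<inter> space M)"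
    have S: "S \<in> sets (gen_by M Z {0..s})"
      using measurable_sets[OF measurable_gen_by[of 0 "{0..s}" Z M] bor(2)]
        measurable_sets[OF measurable_gen_by[of s "{0..s}" Z M] bor(1)] s
      by (auto simp: S_def)
    have S_M [measurable]: "S \<in> sets M" unfolding S_def by measurable
    have ind: "indicator S \<omega> = indicator F (Z s \<omega>) * (indicator A (Z 0 \<omega>) :: real)" if "\<omega> \<in> space M" for \<omega>
      using that by (auto simp: S_def indicator_def)
    have hZ: "(\<lambda>\<omega>. h B (Z s \<omega>)) \<in> borel_measurable M" by measurable
    have X: "integrable M (\<lambda>\<omega>. indicator B (Z T \<omega>) :: real)"
      by (rule integrable_const_bound[of _ 1]) (auto simp: indicator_def)
    have "(indicator B :: _ \<Rightarrow> real) \<in> borel_measurable (restrict_space borel (closure D))"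
      using B unfolding measurable_N[symmetric] by measurable
    moreover have "bounded ((indicator B :: _ \<Rightarrow> real) ` closure D)"
      by (auto intro!: boundedI[of _ 1] simp: indicator_def)
    ultimately have "AE \<omega> in M. real_cond_exp M (gen_by M Z {0..s}) (\<lambda>\<omega>. indicator B (Z T \<omega>)) \<omega>
        = real_cond_exp M (gen_by M Z {s}) (\<lambda>\<omega>. indicator B (Z T \<omega>)) \<omega>"
      using markov s unfolding markov_process_def by (meson less_imp_le order_refl)
    with cond[OF B] have ce: "AE \<omega> in M. real_cond_exp M (gen_by M Z {0..s}) (\<lambda>\<omega>. indicator B (Z T \<omega>)) \<omega> = h B (Z s \<omega>)"
      by eventually_elim simp
    have "(\<integral>\<omega>. (indicator F (Z s \<omega>) * indicator A (Z 0 \<omega>) * indicator B (Z T \<omega>) :: real) \<partial>M) = (\<integral>\<omega>\<in>S. indicator B (Z T \<omega>) \<partial>M)"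
      unfolding set_lebesgue_integral_def by (intro Bochner_Integration.integral_cong) (auto simp: ind)
    also have "\<dots> = (\<integral>\<omega>\<in>S. real_cond_exp M (gen_by M Z {0..s}) (\<lambda>\<omega>. indicator B (Z T \<omega>)) \<omega> \<partial>M)"
      by (rule G.real_cond_exp_intA[OF X S])
    also have "\<dots> = (\<integral>\<omega>\<in>S. h B (Z s \<omega>) \<partial>M)"
      unfolding set_lebesgue_integral_def
    proof (rule integral_cong_AE)
      show "AE \<omega> in M. indicator S \<omega> *\<^sub>R real_cond_exp M (gen_by M Z {0..s}) (\<lambda>\<omega>. indicator B (Z T \<omega>)) \<omega>
          = indicator S \<omega> *\<^sub>R h B (Z s \<omega>)"
        using ce by eventually_elim simp
    qed (use hZ in measurable)
    also have "\<dots> = (\<integral>\<omega>. indicator F (Z s \<omega>) * indicator A (Z 0 \<omega>) * h B (Z s \<omega>) \<partial>M)"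
      unfolding set_lebesgue_integral_def by (intro Bochner_Integration.integral_cong) (auto simp: ind)
    finally have eq: "(\<integral>\<omega>. indicator F (Z s \<omega>) * indicator A (Z 0 \<omega>) * indicator B (Z T \<omega>) \<partial>M)
      = (\<integral>\<omega>. indicator F (Z s \<omega>) * indicator A (Z 0 \<omega>) * h B (Z s \<omega>) \<partial>M)" .
    have "(\<integral>\<^sup>+\<omega>. ennreal (indicator F (Z s \<omega>) * indicator A (Z 0 \<omega>) * indicator B (Z T \<omega>)) \<partial>M)
      = ennreal (\<integral>\<omega>. indicator F (Z s \<omega>) * indicator A (Z 0 \<omega>) * indicator B (Z T \<omega>) \<partial>M)"
    proof (rule nn_integral_eq_integral)
      show "integrable M (\<lambda>\<omega>. indicator F (Z s \<omega>) * indicator A (Z 0 \<omega>) * indicator B (Z T \<omega>) :: real)"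
        by (rule integrable_const_bound[of _ 1]) (auto simp: indicator_def)
    qed auto
    also have "\<dots> = (\<integral>\<^sup>+\<omega>. ennreal (indicator F (Z s \<omega>) * indicator A (Z 0 \<omega>) * h B (Z s \<omega>)) \<partial>M)"
      unfolding eq
    proof (rule nn_integral_eq_integral[symmetric])
      show "integrable M (\<lambda>\<omega>. indicator F (Z s \<omega>) * indicator A (Z 0 \<omega>) * h B (Z s \<omega>))"
        by (rule integrable_const_bound[of _ 1]) (use h_bounds[OF B] Z_closure sT in \<open>auto simp: indicator_def\<close>)
    qed (use h_bounds[OF B] Z_closure sT in auto)
    finally show ?thesis .
  qed

  \<comment> \<open>The density the triple would have if the endpoints were conditionally
    independent given \<open>Z s\<close>.\<close>
  define f' where "f' w z = \<alpha> w (fst z) * (\<beta> w (snd z) / W w)" for w z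
  have f'_meas [measurable]: "(\<lambda>p. f' (fst p) (snd p)) \<in> borel_measurable (N \<Otimes>\<^sub>M (N \<Otimes>\<^sub>M N))"
    unfolding f'_def by measurable
  have dens_eq: "density (N \<Otimes>\<^sub>M (N \<Otimes>\<^sub>M N)) (\<lambda>p. f (fst p) (snd p)) = density (N \<Otimes>\<^sub>M (N \<Otimes>\<^sub>M N)) (\<lambda>p. f' (fst p) (snd p))"
  proof (rule finite_measure_triple_eqI[where ?M1.0=N and ?M2.0=N and ?M3.0=N])
    have Z: "(\<lambda>\<omega>. (Z s \<omega>, (Z 0 \<omega>, Z T \<omega>))) \<in> M \<rightarrow>\<^sub>M N \<Otimes>\<^sub>M (N \<Otimes>\<^sub>M N)"
      using sT by (intro measurable_Pair Z_measurable) auto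
    show "finite_measure (density (N \<Otimes>\<^sub>M (N \<Otimes>\<^sub>M N)) (\<lambda>p. f (fst p) (snd p)))"
      unfolding f_def law_bridge[OF s(1,2), symmetric] by (rule finite_measure_distr[OF Z])
    fix F A B assume F: "F \<in> sets N" and A: "A \<in> sets N" and B: "B \<in> sets N"
    define E where E: "E = A \<times> B"
    note [measurable] = F A B
    have "emeasure (density (N \<Otimes>\<^sub>M (N \<Otimes>\<^sub>M N)) (\<lambda>p. f (fst p) (snd p))) (F \<times> E)
       = (\<integral>\<^sup>+w. \<integral>\<^sup>+z. f w z * indicator (F \<times> E) (w, z) \<partial>(N \<Otimes>\<^sub>M N) \<partial>N)"
      using NN.nn_integral_fst[of "\<lambda>p. f (fst p) (snd p) * indicator (F \<times> E) p" N]
      by (subst emeasure_density) (simp_all add: E)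
    also have "\<dots> = (\<integral>\<^sup>+\<omega>. indicator (F \<times> E) (Z s \<omega>, (Z 0 \<omega>, Z T \<omega>)) \<partial>M)"
      unfolding f_def by (rule nn_integral_bridge[OF s(1,2), symmetric]) (simp add: E)
    also have "\<dots> = (\<integral>\<^sup>+\<omega>. ennreal (indicator F (Z s \<omega>) * indicator A (Z 0 \<omega>) * indicator B (Z T \<omega>)) \<partial>M)"
      by (intro nn_integral_cong) (auto simp: indicator_def E)
    also have "\<dots> = (\<integral>\<^sup>+\<omega>. ennreal (indicator F (Z s \<omega>) * indicator A (Z 0 \<omega>) * h B (Z s \<omega>)) \<partial>M)"
      by (rule past[OF F A B])
    also have "\<dots> = (\<integral>\<^sup>+\<omega>. (\<lambda>p. indicator F (fst p) * ennreal (h B (fst p)) * indicator A (fst (snd p))) (Z s \<omega>, (Z 0 \<omega>, Z T \<omega>)) \<partial>M)"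
      by (intro nn_integral_cong) (auto simp: indicator_def)
    \<comment> \<open>Nothing depends on \<open>Z T\<close> any more, so integrating out y will turn
      \<open>f\<close> into \<open>\<alpha>\<close>, while \<open>h B w\<close> expands to the
      integral of \<open>\<beta> w y / W w\<close> over \<open>B\<close>.\<close>
    also have "\<dots> = (\<integral>\<^sup>+w. \<integral>\<^sup>+z. f w z * (indicator F w * ennreal (h B w) * indicator A (fst z)) \<partial>(N \<Otimes>\<^sub>M N) \<partial>N)"
      unfolding f_def by (subst nn_integral_bridge[OF s(1,2)]) simp_all
    also have "\<dots> = (\<integral>\<^sup>+w. \<integral>\<^sup>+z. f' w z * indicator (F \<times> E) (w, z) \<partial>(N \<Otimes>\<^sub>M N) \<partial>N)"
    proof (rule nn_integral_cong)
      fix w assume "w \<in> space N"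
      then have w [simp]: "w \<in> closure D" by simp
      have "(\<integral>\<^sup>+z. f w z * (indicator F w * ennreal (h B w) * indicator A (fst z)) \<partial>(N \<Otimes>\<^sub>M N))
         = (\<integral>\<^sup>+x. \<integral>\<^sup>+y. f w (x, y) * (indicator F w * ennreal (h B w) * indicator A x) \<partial>N \<partial>N)"
        using N.nn_integral_fst[of "\<lambda>z. f w z * (indicator F w * ennreal (h B w) * indicator A (fst z))" N] by simp
      also have "\<dots> = (\<integral>\<^sup>+x. \<alpha> w x * (indicator F w * ennreal (h B w) * indicator A x) \<partial>N)"
        unfolding \<alpha>_def by (intro nn_integral_cong nn_integral_multc) auto
      also have "\<dots> = (\<integral>\<^sup>+x. \<integral>\<^sup>+y. f' w (x, y) * indicator (F \<times> E) (w, (x, y)) \<partial>N \<partial>N)"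
      proof (rule nn_integral_cong)
        fix x assume "x \<in> space N"
        then have x [simp]: "x \<in> closure D" by simp
        have "(\<integral>\<^sup>+y. f' w (x, y) * indicator (F \<times> E) (w, (x, y)) \<partial>N)
          = (\<integral>\<^sup>+y. (\<alpha> w x * indicator F w * indicator A x / W w) * (indicator B y * \<beta> w y) \<partial>N)"
          by (intro nn_integral_cong) (auto simp: f'_def E indicator_def ennreal_times_divide divide_ennreal_def mult_ac)
        also have "\<dots> = (\<alpha> w x * indicator F w * indicator A x / W w) * \<beta>\<^sub>B B w"
          unfolding \<beta>\<^sub>B_def by (rule nn_integral_cmult) measurable
        finally show "\<alpha> w x * (indicator F w * ennreal (h B w) * indicator A x)
          = (\<integral>\<^sup>+y. f' w (x, y) * indicator (F \<times> E) (w, (x, y)) \<partial>N)"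
          unfolding h_enn[OF B w] by (simp add: divide_ennreal_def mult_ac)
      qed
      also have "\<dots> = (\<integral>\<^sup>+z. f' w z * indicator (F \<times> E) (w, z) \<partial>(N \<Otimes>\<^sub>M N))"
        using N.nn_integral_fst[of "\<lambda>z. f' w z * indicator (F \<times> E) (w, z)" N]
        by (simp add: f'_def E)
      finally show "(\<integral>\<^sup>+z. f w z * (indicator F w * ennreal (h B w) * indicator A (fst z)) \<partial>(N \<Otimes>\<^sub>M N))
         = (\<integral>\<^sup>+z. f' w z * indicator (F \<times> E) (w, z) \<partial>(N \<Otimes>\<^sub>M N))" .
    qed
    also have "\<dots> = emeasure (density (N \<Otimes>\<^sub>M (N \<Otimes>\<^sub>M N)) (\<lambda>p. f' (fst p) (snd p))) (F \<times> E)"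
      using NN.nn_integral_fst[of "\<lambda>p. f' (fst p) (snd p) * indicator (F \<times> E) p" N]
      by (subst emeasure_density) (simp_all add: E)
    finally show "emeasure (density (N \<Otimes>\<^sub>M (N \<Otimes>\<^sub>M N)) (\<lambda>p. f (fst p) (snd p))) (F \<times> (A \<times> B))
      = emeasure (density (N \<Otimes>\<^sub>M (N \<Otimes>\<^sub>M N)) (\<lambda>p. f' (fst p) (snd p))) (F \<times> (A \<times> B))"
      unfolding E .
  qed auto
  interpret NNN: pair_sigma_finite N "N \<Otimes>\<^sub>M N" ..
  have "AE p in N \<Otimes>\<^sub>M (N \<Otimes>\<^sub>M N). f (fst p) (snd p) = f' (fst p) (snd p)"
    by (rule NNN.density_unique[OF _ _ dens_eq]) measurable
  then have "AE w in N. AE z in N \<Otimes>\<^sub>M N. f w z = f' w z"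
    using NNN.AE_pair by fastforce
  \<comment> \<open>\<open>N\<close> is not the zero measure, so the set of good w cannot be empty.
    One slice suffices for the splitting of \<open>r\<close>.\<close>
  then have "\<exists>w\<in>closure D. AE z in N \<Otimes>\<^sub>M N. f w z = f' w z"
  proof (rule contrapos_pp)
    assume neg: "\<not> (\<exists>w\<in>closure D. AE z in N \<Otimes>\<^sub>M N. f w z = f' w z)"
    show "\<not> (AE w in N. AE z in N \<Otimes>\<^sub>M N. f w z = f' w z)"
    proof
      assume "AE w in N. AE z in N \<Otimes>\<^sub>M N. f w z = f' w z"
      then have "AE w in N. False" using AE_space by eventually_elim (use neg in auto)
      then have "emeasure N (space N) = 0"
        unfolding eventually_False ae_filter_eq_bot_iff .
      then show False using emeasure_N_pos[OF ne] by simp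
    qed
  qed
  then obtain w where w: "w \<in> closure D" and AEw: "AE z in N \<Otimes>\<^sub>M N. f w z = f' w z" by auto
  \<comment> \<open>Dividing the slice by the kernel factors isolates \<open>r\<close>: g(w,s,x)
    goes to the function of x, g(y,T-s,w) to that of y. The normalization \<open>1 / W w\<close> is
    put into \<open>c\<close>.\<close>
  define a where "a x = \<alpha> w x * ennreal (1 / g w s x)" for x
  define c where "c y = \<beta> w y / W w * ennreal (1 / g y (T - s) w)" for y
  have gm [measurable]: "(\<lambda>x. g w s x) \<in> borel_measurable N" "(\<lambda>y. g y (T - s) w) \<in> borel_measurable N"
    by (auto intro!: measurable_borel_N)
  have [measurable]: "(\<lambda>_. w) \<in> N \<rightarrow>\<^sub>M N" "(\<lambda>x. x) \<in> N \<rightarrow>\<^sub>M N" using w by auto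
  have a_meas [measurable]: "a \<in> borel_measurable N"
    unfolding a_def[abs_def] by (intro borel_measurable_times_ennreal) simp_all
  have c_meas [measurable]: "c \<in> borel_measurable N"
    unfolding c_def[abs_def] by (intro borel_measurable_times_ennreal borel_measurable_divide_ennreal) simp_all
  have c_fin: "c y \<noteq> \<infinity>" if "y \<in> closure D" for y
    using \<beta>_fin[OF w that] W_pos[OF w] by (auto simp: c_def ennreal_mult_eq_top_iff ennreal_divide_eq_top_iff)
  have "AE z in N \<Otimes>\<^sub>M N. ennreal (r z) = a (fst z) * c (snd z)"
    using AEw AE_space
  proof eventually_elim
    fix z assume eq: "f w z = f' w z" and "z \<in> space (N \<Otimes>\<^sub>M N)"
    then obtain x y where z: "z = (x, y)" "x \<in> closure D" "y \<in> closure D"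
      by (auto simp: space_pair_measure)
    have gg: "0 < g w s x" "0 < g y (T - s) w"
      using g_pos[OF w z(2) s(1,4)] g_pos[OF z(3) w s(3,5)] by auto
    have "r z = bridge_density s w z * (1 / g w s x) * (1 / g y (T - s) w)"
      using gg by (simp add: bridge_density_def z)
    then have "ennreal (r z) = ennreal (bridge_density s w z * (1 / g w s x) * (1 / g y (T - s) w))"
      by (rule arg_cong)
    also have "\<dots> = f w z * ennreal (1 / g w s x) * ennreal (1 / g y (T - s) w)"
      unfolding f_def using gg by (simp only: ennreal_mult'' divide_nonneg_pos zero_le_one)
    also have "\<dots> = a x * c y"
      unfolding eq by (simp add: f'_def a_def c_def z mult_ac)
    finally show "ennreal (r z) = a (fst z) * c (snd z)" by (simp add: z)
  qed
  then have "density (N \<Otimes>\<^sub>M N) (\<lambda>z. ennreal (r z)) = density (N \<Otimes>\<^sub>M N) (\<lambda>z. a (fst z) * c (snd z))"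
    by (intro density_cong) (use weight_measurable[OF weight] in auto)
  also have "\<dots> = density N a \<Otimes>\<^sub>M density N c"
  proof -
    \<comment> \<open>Finiteness of \<open>c\<close> gives this, and it is what permits the product
      density to be written as a product of measures.\<close>
    have "sigma_finite_measure (density N c)"
      by (subst N.sigma_finite_iff_density_finite) (use c_fin in auto)
    then show ?thesis
      by (subst pair_measure_density) (auto simp: split_beta' intro: N.sigma_finite_measure_axioms)
  qed
  finally show ?thesis by (intro that[of "density N a" "density N c"]) auto
qed

end

section \<open>Mixtures of generated processes and the failure of the Markov property\<close>

theorem theorem2:
  fixes D :: "(real^'d) set" and T :: real
    and g :: "real^'d \<Rightarrow> real \<Rightarrow> real^'d \<Rightarrow> real"
    and \<phi> \<psi> :: "nat^'d \<Rightarrow> real^'d \<Rightarrow> real"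
    and p :: "nat^'d \<Rightarrow> real"
    and M :: "nat^'d \<Rightarrow> 'w measure" and Z :: "nat^'d \<Rightarrow> real \<Rightarrow> 'w \<Rightarrow> real^'d"
    and Mb :: "'v measure" and Zb :: "real \<Rightarrow> 'v \<Rightarrow> real^'d"
  assumes D: "open D" "bounded D" "negligible (frontier D)"
    and T: "0 < T"
    and g: "heat_kernel_props D T g"
    and pos: "\<And>m x. x \<in> closure D \<Longrightarrow> 0 < \<phi> m x \<and> 0 < \<psi> m x"
    and cont: "\<And>m. continuous_on (closure D) (\<phi> m) \<and> continuous_on (closure D) (\<psi> m)"
    and norm: "\<And>m. (LINT z:D \<times> D|lborel \<Otimes>\<^sub>M lborel. \<phi> m (fst z) * g (fst z) T (snd z) * \<psi> m (snd z)) = 1"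
    and bdd_phi: "\<exists>B. \<forall>m. \<forall>x\<in>closure D. \<phi> m x \<le> B"
    and bdd_psi: "\<exists>B. \<forall>m. \<forall>x\<in>closure D. \<psi> m x \<le> B"
    and p: "\<And>m. 0 \<le> p m" "(p has_sum 1) UNIV"
    and Zm: "\<And>m. bernstein_generated (M m) (Z m) T D g (mu_of D T g (\<phi> m) (\<psi> m))"
    and Zb: "bernstein_generated Mb Zb T D g (mixture p (\<lambda>m. mu_of D T g (\<phi> m) (\<psi> m)))"
  shows
    \<comment> \<open>(a)\<close>
    "(\<forall>ts Fs. length ts = length Fs \<longrightarrow> ts \<noteq> [] \<longrightarrow> sorted_wrt (<) ts \<longrightarrow>
        0 < hd ts \<longrightarrow> last ts < T \<longrightarrow> (\<forall>F\<in>set Fs. F \<in> sets borel \<and> F \<subseteq> closure D) \<longrightarrow>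
        ((\<lambda>m. p m * measure (M m) {\<omega> \<in> space (M m). \<forall>k<length ts. Z m (ts ! k) \<omega> \<in> Fs ! k})
           has_sum measure Mb {\<omega> \<in> space Mb. \<forall>k<length ts. Zb (ts ! k) \<omega> \<in> Fs ! k}) UNIV)
     \<and> ((\<nexists>\<nu>0 \<nu>T. sets \<nu>0 = sets (restrict_space borel (closure D))
                 \<and> sets \<nu>T = sets (restrict_space borel (closure D))
                 \<and> density (restrict_space (lborel \<Otimes>\<^sub>M lborel) (closure D \<times> closure D))
                     (\<lambda>(x, y). ennreal (\<Sum>\<^sub>\<infinity>m. p m * \<phi> m x * \<psi> m y)) = \<nu>0 \<Otimes>\<^sub>M \<nu>T)
         \<longrightarrow> \<not> markov_process Mb Zb T D)
     \<comment> \<open>(b)\<close>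
     \<and> (\<forall>t\<in>{0..T}. \<forall>F. F \<in> sets borel \<longrightarrow> F \<subseteq> closure D \<longrightarrow>
        ((\<lambda>m. p m * measure (M m) {\<omega> \<in> space (M m). Z m t \<omega> \<in> F})
           has_sum measure Mb {\<omega> \<in> space Mb. Zb t \<omega> \<in> F}) UNIV
        \<and> (\<forall>m. measure (M m) {\<omega> \<in> space (M m). Z m t \<omega> \<in> F}
               = (LINT x:F|lborel. u_fun D g (\<phi> m) x t * v_fun D T g (\<psi> m) x t)))
     \<comment> \<open>(c)\<close>
     \<and> (\<forall>t\<in>{0..T}. \<forall>b :: real^'d \<Rightarrow> complex.
         b \<in> borel_measurable (restrict_space borel (closure D)) \<longrightarrow> bounded (b ` closure D) \<longrightarrow>
        ((\<lambda>m. complex_of_real (p m) * (LINT \<omega>|M m. b (Z m t \<omega>)))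
           has_sum (LINT \<omega>|Mb. b (Zb t \<omega>))) UNIV
        \<and> (\<forall>m. (LINT \<omega>|M m. b (Z m t \<omega>))
               = (LINT x:D|lborel. b x * complex_of_real (u_fun D g (\<phi> m) x t * v_fun D T g (\<psi> m) x t))))"
proof -
  \<comment> \<open>An empty D would contradict the normalization of the endpoint densities to total
    mass 1.\<close>
  have "\<exists>z. z \<in> D"
  proof (rule ccontr)
    assume "\<nexists>z. z \<in> D"
    then have "D \<times> D = {}" by auto
    then show False using norm by (simp add: set_lebesgue_integral_def)
  qed
  then have D_ne: "D \<noteq> {}" by auto
  interpret neumann_kernel D T g
    using D T g by unfold_locales
  define r where "r m z = \<phi> m (fst z) * \<psi> m (snd z)" for m z
  define rb where "rb z = (\<Sum>\<^sub>\<infinity>m. p m * r m z)" for z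
  obtain B0 where B0: "\<And>m x. x \<in> closure D \<Longrightarrow> \<phi> m x \<le> B0" using bdd_phi by blast
  obtain BT where BT: "\<And>m x. x \<in> closure D \<Longrightarrow> \<psi> m x \<le> BT" using bdd_psi by blast
  have phi: "\<phi> m \<in> borel_measurable N" "\<psi> m \<in> borel_measurable N" for m
    unfolding measurable_N using cont by (auto intro: borel_measurable_continuous_on_restrict)
  have phi_bd: "0 \<le> \<phi> m x \<and> \<phi> m x \<le> B0" "0 \<le> \<psi> m x \<and> \<psi> m x \<le> BT" if "x \<in> closure D" for m x
    using pos[OF that, of m] B0[OF that] BT[OF that] by auto
  have r: "weight_le (B0 * BT) (r m)" for m
    unfolding weight_le_def
  proof (intro conjI ballI)
    note [measurable] = phi
    show "r m \<in> borel_measurable (N \<Otimes>\<^sub>M N)" unfolding r_def[abs_def] by measurable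
    fix x y assume "x \<in> closure D" "y \<in> closure D"
    from phi_bd(1)[OF this(1), of m] phi_bd(2)[OF this(2), of m]
    show "0 \<le> r m (x, y)" "r m (x, y) \<le> B0 * BT" by (auto simp: r_def intro!: mult_mono)
  qed
  have rb: "weight_le (B0 * BT) rb"
    unfolding rb_def[abs_def] by (rule weight_mixture[OF r p])
  have mu: "mu_of D T g (\<phi> m) (\<psi> m) = endpoint_measure (r m)" for m
    unfolding mu_of_def endpoint_measure_def r_def by (simp add: split_beta' mult_ac)
  have mix: "mixture p (\<lambda>m. mu_of D T g (\<phi> m) (\<psi> m)) = endpoint_measure rb"
    unfolding mu rb_def[abs_def] by (rule mixture_endpoint[OF r p])
  have Pm: "generated_process D T g (M m) (Z m) (r m) (B0 * BT)" for m
    using r Zm[of m] unfolding mu by unfold_locales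
  interpret Pb: generated_process D T g Mb Zb rb "B0 * BT"
    using rb Zb unfolding mix by unfold_locales
  obtain Cg where Cg: "0 \<le> Cg" "\<And>x y. x \<in> closure D \<Longrightarrow> y \<in> closure D \<Longrightarrow> g x T y \<le> Cg"
    using g_bound[of T] T_pos by auto
  have in_N: "F \<in> sets N" if "F \<in> sets borel" "F \<subseteq> closure D" for F
    using that by (simp add: in_sets_N)

  have fd: "((\<lambda>m. p m * measure (M m) {\<omega> \<in> space (M m). \<forall>k<length ts. Z m (ts ! k) \<omega> \<in> Fs ! k})
      has_sum measure Mb {\<omega> \<in> space Mb. \<forall>k<length ts. Zb (ts ! k) \<omega> \<in> Fs ! k}) UNIV"
    if a: "length ts = length Fs" "ts \<noteq> []" "sorted_wrt (<) ts" "0 < hd ts" "last ts < T"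
      and Fs: "\<forall>F\<in>set Fs. F \<in> sets borel \<and> F \<subseteq> closure D" for ts Fs
  proof -
    have FsN: "\<And>F. F \<in> set Fs \<Longrightarrow> F \<in> sets N" using Fs in_N by blast
    have zip: "\<And>t F. (t, F) \<in> set (zip ts Fs) \<Longrightarrow> F \<in> sets N"
      using FsN by (blast dest: set_zip_rightD)
    \<comment> \<open>The bound on the kernel needs both end times around the list; they are
      strictly outside because \<open>hd ts\<close> and \<open>last ts\<close> are the extreme
      entries.\<close>
    have "sorted_wrt (<) (0 # ts @ [T])"
    proof -
      have "0 < t \<and> t < T" if "t \<in> set ts" for t
      proof -
        have "hd ts \<le> t"
          using that a(2,3) by (cases ts) auto
        moreover have "t \<le> last ts"
          using that a(2,3) by (cases ts rule: rev_cases) (auto simp: sorted_wrt_append)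
        ultimately show ?thesis using a by auto
      qed
      then show ?thesis using a(3) T by (auto simp: sorted_wrt_append)
    qed
    then have srt: "sorted_wrt (<) (0 # map fst (zip ts Fs) @ [T])" using a(1) by simp
    have "((\<lambda>m. p m * (\<integral>z. fd_kernel g T (zip ts Fs) 0 (fst z) (snd z) * r m z \<partial>(N \<Otimes>\<^sub>M N)))
      has_sum (\<integral>z. fd_kernel g T (zip ts Fs) 0 (fst z) (snd z) * rb z \<partial>(N \<Otimes>\<^sub>M N))) UNIV"
      unfolding rb_def
    proof (rule has_sum_integral_mixture[OF r p, of _ Cg])
      show "(\<lambda>z. fd_kernel g T (zip ts Fs) 0 (fst z) (snd z)) \<in> borel_measurable (N \<Otimes>\<^sub>M N)"
        by (rule measurable_borel_NN[OF fd_kernel_measurable]) (use zip in \<open>auto simp: in_sets_N\<close>)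
      fix x y assume xy: "x \<in> closure D" "y \<in> closure D"
      have "0 \<le> fd_kernel g T (zip ts Fs) 0 x y \<and> fd_kernel g T (zip ts Fs) 0 x y \<le> g y (T - 0) x"
        by (rule fd_kernel_bounds[OF xy order_refl srt]) (rule zip)
      with Cg(2)[OF xy(2,1)]
      show "0 \<le> fd_kernel g T (zip ts Fs) 0 (fst (x, y)) (snd (x, y))"
        "fd_kernel g T (zip ts Fs) 0 (fst (x, y)) (snd (x, y)) \<le> Cg" by auto
    qed
    moreover have "measure (M m) {\<omega> \<in> space (M m). \<forall>k<length ts. Z m (ts ! k) \<omega> \<in> Fs ! k}
        = (\<integral>z. fd_kernel g T (zip ts Fs) 0 (fst z) (snd z) * r m z \<partial>(N \<Otimes>\<^sub>M N))" for m
      by (rule generated_process.prob_fd[OF Pm a]) (rule FsN)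
    moreover have "measure Mb {\<omega> \<in> space Mb. \<forall>k<length ts. Zb (ts ! k) \<omega> \<in> Fs ! k}
        = (\<integral>z. fd_kernel g T (zip ts Fs) 0 (fst z) (snd z) * rb z \<partial>(N \<Otimes>\<^sub>M N))"
      by (rule Pb.prob_fd[OF a]) (rule FsN)
    ultimately show ?thesis by (simp only:)
  qed

  have marginal_sum: "((\<lambda>m. p m * measure (M m) {\<omega> \<in> space (M m). Z m t \<omega> \<in> F})
      has_sum measure Mb {\<omega> \<in> space Mb. Zb t \<omega> \<in> F}) UNIV"
    if t: "t \<in> {0..T}" and F: "F \<in> sets N" for t F
  proof -
    have "((\<lambda>m. p m * (\<integral>z. marginal_kernel t F z * r m z \<partial>(N \<Otimes>\<^sub>M N)))
      has_sum (\<integral>z. marginal_kernel t F z * rb z \<partial>(N \<Otimes>\<^sub>M N))) UNIV"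
      unfolding rb_def
    proof (rule has_sum_integral_mixture[OF r p, of _ Cg])
      show "marginal_kernel t F \<in> borel_measurable (N \<Otimes>\<^sub>M N)" by (rule marginal_kernel_measurable[OF F])
      fix x y assume xy: "x \<in> closure D" "y \<in> closure D"
      show "0 \<le> marginal_kernel t F (x, y)" "marginal_kernel t F (x, y) \<le> Cg"
        using marginal_kernel_bounds[OF F t xy] Cg(2)[OF xy] by auto
    qed
    then show ?thesis
      unfolding generated_process.prob_marginal[OF Pm F t] Pb.prob_marginal[OF F t] .
  qed

  have marginal: "measure (M m) {\<omega> \<in> space (M m). Z m t \<omega> \<in> F}
      = (LINT x:F|lborel. u_fun D g (\<phi> m) x t * v_fun D T g (\<psi> m) x t)"
    if t: "t \<in> {0..T}" and F: "F \<in> sets N" for t F m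
    unfolding generated_process.prob_marginal[OF Pm F t] r_def
    by (rule integral_marginal_kernel_product[OF F t phi(1) phi_bd(1) phi(2) phi_bd(2)])

  have expectation: "((\<lambda>m. complex_of_real (p m) * (LINT \<omega>|M m. b (Z m t \<omega>)))
           has_sum (LINT \<omega>|Mb. b (Zb t \<omega>))) UNIV
        \<and> (\<forall>m. (LINT \<omega>|M m. b (Z m t \<omega>))
               = (LINT x:D|lborel. b x * complex_of_real (u_fun D g (\<phi> m) x t * v_fun D T g (\<psi> m) x t)))"
    if t: "t \<in> {0..T}" and b: "b \<in> borel_measurable (restrict_space borel (closure D))"
      and b_bd: "bounded (b ` closure D)" for t and b :: "real^'d \<Rightarrow> complex"
  proof -
    have t': "0 \<le> t" "0 \<le> T - t" "T - t \<in> {0..T}" using t by auto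
    have bN: "b \<in> borel_measurable N" using b by (simp add: measurable_N)
    obtain Bb where Bb: "\<And>x. x \<in> closure D \<Longrightarrow> cmod (b x) \<le> Bb"
      using b_bd by (auto simp: bounded_iff)
    define w where "w m x = u_fun D g (\<phi> m) x t * v_fun D T g (\<psi> m) x t" for m x
    obtain C1 where C1: "\<And>m x. x \<in> closure D \<Longrightarrow> 0 \<le> u_fun D g (\<phi> m) x t \<and> u_fun D g (\<phi> m) x t \<le> C1"
      using u_fun_bounded[OF t, of B0] phi(1) phi_bd(1) by metis
    obtain C2 where C2: "\<And>m x. x \<in> closure D \<Longrightarrow> 0 \<le> v_fun D T g (\<psi> m) x t \<and> v_fun D T g (\<psi> m) x t \<le> C2"
      unfolding v_fun_eq_u_fun using u_fun_bounded[OF t'(3), of BT] phi(2) phi_bd(2) by metis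
    have w_meas: "w m \<in> borel_measurable N" for m
      unfolding w_def[abs_def] v_fun_eq_u_fun
      by (intro borel_measurable_times u_fun_measurable phi t')
    have w_bd: "0 \<le> w m x" "w m x \<le> C1 * C2" if "x \<in> closure D" for m x
      using C1[OF that, of m] C2[OF that, of m] by (auto simp: w_def intro!: mult_mono)
    \<comment> \<open>The candidate density of the mixed process at time t. In general it is not a
      single product of a u and a v.\<close>
    define W where "W x = (\<Sum>\<^sub>\<infinity>m. p m * w m x)" for x
    have W_sum: "((\<lambda>m. p m * w m x) has_sum W x) UNIV" if "x \<in> closure D" for x
      unfolding W_def by (rule convex_combination_has_sum[OF p]) (use w_bd that in auto)
    have W_meas: "W \<in> borel_measurable N"
      unfolding W_def[abs_def]
    proof (rule borel_measurable_infsum_countable)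
      show "(\<lambda>x. p m * w m x) \<in> borel_measurable N" for m using w_meas by measurable
      show "(\<lambda>m. p m * w m x) summable_on UNIV" if "x \<in> space N" for x
        using W_sum that by (auto intro: has_sum_imp_summable)
    qed
    have W_bd: "0 \<le> W x" "W x \<le> C1 * C2" if x: "x \<in> closure D" for x
    proof -
      show "0 \<le> W x" unfolding W_def using w_bd(1)[OF x] p(1) by (intro infsum_nonneg) auto
      show "W x \<le> C1 * C2" unfolding W_def
        by (rule convex_combination_le[OF p]) (use w_bd x in auto)
    qed
    have law: "measure (M m) {\<omega> \<in> space (M m). Z m t \<omega> \<in> F} = (LINT x|N. indicator F x * w m x)"
      if F: "F \<in> sets N" for m F
      unfolding marginal[OF t F] w_def by (subst set_integral_N[OF F]) simp
    have law_b: "measure Mb {\<omega> \<in> space Mb. Zb t \<omega> \<in> F} = (LINT x|N. indicator F x * W x)"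
      if F: "F \<in> sets N" for F
    \<comment> \<open>One series is summed twice: to the probability for the mixed process by (b),
      and to the integral of \<open>W\<close> by summation under the integral.\<close>
    proof (rule has_sum_unique[OF marginal_sum[OF t F]])
      have bound: "integrable N (\<lambda>x. indicator F x * v x)"
        if "v \<in> borel_measurable N" "\<And>x. x \<in> closure D \<Longrightarrow> 0 \<le> v x" "\<And>x. x \<in> closure D \<Longrightarrow> v x \<le> C1 * C2" for v
        by (rule N_integrable[of _ "\<bar>C1 * C2\<bar>"])
           (use F that in \<open>auto simp: indicator_def intro: order_trans[OF _ abs_ge_self]\<close>)
      have "((\<lambda>m. (LINT x|N. p m * (indicator F x * w m x))) has_sum (LINT x|N. indicator F x * W x)) UNIV"
      proof (rule has_sum_integral_nonneg_countable)
        show "integrable N (\<lambda>x. p m * (indicator F x * w m x))" for m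
          using bound[OF w_meas w_bd] by simp
        show "integrable N (\<lambda>x. indicator F x * W x)" by (rule bound[OF W_meas W_bd])
        fix x assume "x \<in> space N"
        then have x: "x \<in> closure D" by simp
        show "0 \<le> p m * (indicator F x * w m x)" for m using p(1) w_bd(1)[OF x] by simp
        have "((\<lambda>m. indicator F x * (p m * w m x)) has_sum indicator F x * W x) UNIV"
          by (rule has_sum_cmult_right[OF W_sum[OF x]])
        then show "((\<lambda>m. p m * (indicator F x * w m x)) has_sum indicator F x * W x) UNIV"
          by (simp add: mult.left_commute)
      qed
      then show "((\<lambda>m. p m * measure (M m) {\<omega> \<in> space (M m). Z m t \<omega> \<in> F})
        has_sum (LINT x|N. indicator F x * W x)) UNIV"
        unfolding law[OF F] by simp
    qed
    have Em: "(LINT \<omega>|M m. b (Z m t \<omega>)) = (LINT x|N. b x * complex_of_real (w m x))" for m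
      by (rule generated_process.expectation_marginal[OF Pm t w_meas w_bd law bN])
    have Eb: "(LINT \<omega>|Mb. b (Zb t \<omega>)) = (LINT x|N. b x * complex_of_real (W x))"
      by (rule Pb.expectation_marginal[OF t W_meas W_bd law_b bN])
    have "((\<lambda>m. complex_of_real (p m) * (LINT \<omega>|M m. b (Z m t \<omega>))) has_sum (LINT \<omega>|Mb. b (Zb t \<omega>))) UNIV"
      unfolding Em Eb W_def
      by (rule has_sum_integral_bounded_density[OF N.finite_measure_axioms p w_meas _ _ bN])
         (use w_bd Bb in auto)
    moreover have "(LINT \<omega>|M m. b (Z m t \<omega>))
       = (LINT x:D|lborel. b x * complex_of_real (u_fun D g (\<phi> m) x t * v_fun D T g (\<psi> m) x t))" for m
      unfolding Em w_def[symmetric] using bN w_meas[of m] by (subst set_integral_D) auto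
    ultimately show ?thesis by blast
  qed

  have rb_pos: "0 < rb (x, y)" if xy: "x \<in> closure D" "y \<in> closure D" for x y
  proof -
    have nn: "0 \<le> p m * r m (x, y)" for m
      using p(1) weight_nonneg[OF r xy] by simp
    have sum: "((\<lambda>m. p m * r m (x, y)) has_sum rb (x, y)) UNIV"
      unfolding rb_def by (rule weight_has_sum[OF r p xy])
    \<comment> \<open>The coefficients sum to one, so some index carries positive weight; its
      strictly positive term bounds the mixture from below.\<close>
    have "\<exists>m. p m \<noteq> 0"
    proof (rule ccontr)
      assume "\<nexists>m. p m \<noteq> 0"
      then have "(p has_sum 0) UNIV" by (auto intro!: has_sum_0)
      with p(2) show False using has_sum_unique by fastforce
    qed
    then obtain m where "p m \<noteq> 0" by auto
    then have "0 < p m * r m (x, y)"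
      using p(1)[of m] pos[OF xy(1), of m] pos[OF xy(2), of m] by (auto simp: r_def less_le)
    also have "p m * r m (x, y) \<le> rb (x, y)"
      using has_sum_mono_neutral[OF has_sum_finite[of "{m}"] sum, of "\<lambda>m. p m * r m (x, y)"] nn by simp
    finally show ?thesis .
  qed
  have nonmarkov: "\<not> markov_process Mb Zb T D"
    if nex: "\<nexists>\<nu>0 \<nu>T. sets \<nu>0 = sets (restrict_space borel (closure D))
                 \<and> sets \<nu>T = sets (restrict_space borel (closure D))
                 \<and> density (restrict_space (lborel \<Otimes>\<^sub>M lborel) (closure D \<times> closure D))
                     (\<lambda>(x, y). ennreal (\<Sum>\<^sub>\<infinity>m. p m * \<phi> m x * \<psi> m y)) = \<nu>0 \<Otimes>\<^sub>M \<nu>T"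
  proof
    assume "markov_process Mb Zb T D"
    from Pb.markov_factorization[OF rb_pos D_ne this] obtain \<nu>0 \<nu>T where
      "sets \<nu>0 = sets N" "sets \<nu>T = sets N" "density (N \<Otimes>\<^sub>M N) (\<lambda>z. ennreal (rb z)) = \<nu>0 \<Otimes>\<^sub>M \<nu>T"
      by blast
    moreover have "(\<lambda>z. ennreal (rb z)) = (\<lambda>(x, y). ennreal (\<Sum>\<^sub>\<infinity>m. p m * \<phi> m x * \<psi> m y))"
      by (auto simp: rb_def r_def mult.assoc)
    ultimately show False using nex unfolding NN_eq sets_N by metis
  qed
  show ?thesis
    by (intro conjI allI ballI impI)
       ((rule fd; assumption), (rule nonmarkov, assumption),
        (rule marginal_sum[OF _ in_N]; assumption), (rule marginal[OF _ in_N]; assumption),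
        (rule expectation[THEN conjunct1]; assumption),
        (rule expectation[THEN conjunct2, rule_format]; assumption))
qed

end
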